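(* Let $k\ge1$, let $\mathbb{F}_k=\langle g_1,\dots,g_k\rangle$ be the free group of rank $k$, $N$ a normal subgroup of $\mathbb{F}_k$, $G=\mathbb{F}_k/N$ and $\pi:\mathbb{F}_k\to G$ the canonical factor map. Let $\Xi$ be either $\Sigma_G$, or $\underline{\Sigma}_G$ where in the latter case it is assumed that $k\ge2$ and $N\ne\{\mathrm{id}\}$. Let $$\mathcal{C}=\{\omega=((\tau_1,h_1),\dots,(\tau_n,h_n))\in\Xi^*:h_1=\mathrm{id}\},\qquad \mathcal{C}'=\{\omega\in\mathcal{C}:h_{|\omega|}\,\pi(\tau_{|\omega|})=\mathrm{id}\}.$$ Then the following are equivalent: (i) $G$ is amenable; (ii) $(1,0,\mathcal{C})$ satisfies the exhausting principle; (iii) $\mathcal{P}_1(0,\mathcal{C})=\mathcal{P}_1(0,\mathcal{C}')$. Moreover, the following are equivalent: (a) $G$ is finite; (b) $\mathcal{C}$ is finitely irreducible; (c) $\Xi$ is compact.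
   Context: Let $I=\{g_1,\dots,g_k,g_1^{-1},\dots,g_k^{-1}\}$. The shift spaces are $$\Sigma_G=\{(\tau_n,h_n)_{n\in\mathbb{N}}\in(I\times G)^{\mathbb{N}}:h_n\pi(\tau_n)=h_{n+1}\ \forall n\},$$ $$\underline{\Sigma}_G=\{(\tau_n,h_n)_{n\in\mathbb{N}}\in(I\times G)^{\mathbb{N}}:\tau_n\tau_{n+1}\ne\mathrm{id},\ h_n\pi(\tau_n)=h_{n+1}\ \forall n\}.$$ These are Markov shifts over the countable alphabet $I\times G$, with left shift $\sigma$ and the topology inherited from the product of discrete topologies. $\Xi^*$ is the set of finite non-empty admissible words (finite words over $I\times G$ whose consecutive letters satisfy the defining transition rule); $|\omega|$ is the length of $\omega\in\Xi^*$ and $[\omega]$ the set of sequences in $\Xi$ beginning with $\omega$. For $\mathcal{D}\subset\Xi^*$ the pressure with scaling function $1$ and potential $0$ is $$\mathcal{P}_1(0,\mathcal{D})=\limsup_{T\to\infty}\frac1T\log\operatorname{card}\{\omega\in\mathcal{D}:T-\eta<|\omega|\le T\}\in[-\infty,\infty],$$ where $\eta>0$ is any fixed number (the value does not depend on $\eta$) and $\log0=-\infty$. For a $\sigma$-invariant $K\subset\Xi$ put $K^*=\{\omega\in\Xi^*:[\omega]\cap K\neq\emptyset\}$. The triple $(1,0,\mathcal{C})$ satisfies the exhausting principle if there is a sequence $(K_n)$ of compact $\sigma$-invariant subsets of $\Xi$ with $\lim_{n\to\infty}\mathcal{P}_1(0,\mathcal{C}\cap K_n^* )=\mathcal{P}_1(0,\mathcal{C})$.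 $\mathcal{C}$ is finitely irreducible if there is a finite set $\Lambda\subset\Xi^*$ such that for all $C_1,C_2\in\mathcal{C}$ there is $D\in\Lambda\cup\{\emptyset\}$ ($\emptyset$ the empty word) with $C_1DC_2\in\mathcal{C}$. *)

theory Defs
  imports "HOL-Analysis.Analysis" "HOL-Algebra.Coset"
begin

text \<open>
  The letter \<open>(a, True)\<close> stands for the generator \<open>a\<close> and \<open>(a, False)\<close> for its inverse. Elements
  of the free group are the reduced words; the product of reduced words is obtained by
  prepending the letters of the first one to the second one, cancelling where possible.
\<close>

type_synonym 'a letter = "'a \<times> bool"

definition letter_inv :: "'a letter \<Rightarrow> 'a letter" where
  "letter_inv x = (fst x, \<not> snd x)"

definition reduced_words :: "'a set \<Rightarrow> 'a letter list set" where
  "reduced_words S = {w. fst ` set w \<subseteq> S \<and> successively (\<lambda>x y. y \<noteq> letter_inv x) w}"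

fun cancel_cons :: "'a letter \<Rightarrow> 'a letter list \<Rightarrow> 'a letter list" where
  "cancel_cons x [] = [x]"
| "cancel_cons x (y # w) = (if y = letter_inv x then w else x # y # w)"

definition free_group :: "'a set \<Rightarrow> 'a letter list monoid" where
  "free_group S = \<lparr>carrier = reduced_words S, mult = foldr cancel_cons, one = []\<rparr>"

definition free_gen :: "'a \<Rightarrow> 'a letter list" where
  "free_gen a = [(a, True)]"

lemma letter_inv_simps [simp]:
  "letter_inv (letter_inv x) = x" "letter_inv x \<noteq> x" "x \<noteq> letter_inv x"
  "fst (letter_inv x) = fst x"
  by (cases x; simp add: letter_inv_def)+

lemma cancel_cons_reduced:
  "fst x \<in> S \<Longrightarrow> w \<in> reduced_words S \<Longrightarrow> cancel_cons x w \<in> reduced_words S"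
  by (cases w) (auto simp: reduced_words_def successively_Cons)

lemma foldr_cancel_cons_reduced:
  "fst ` set u \<subseteq> S \<Longrightarrow> w \<in> reduced_words S \<Longrightarrow> foldr cancel_cons u w \<in> reduced_words S"
  by (induction u) (auto intro: cancel_cons_reduced)

lemma cancel_cons_cancel:
  assumes "w \<in> reduced_words S"
  shows "cancel_cons x (cancel_cons (letter_inv x) w) = w"
proof (cases w)
  case (Cons y ys)
  then show ?thesis
    using assms by (cases ys) (auto simp: reduced_words_def)
qed simp

lemma foldr_cancel_cons_assoc:
  assumes "w \<in> reduced_words S" "fst ` set u \<subseteq> S" "fst ` set v \<subseteq> S"
  shows "foldr cancel_cons (foldr cancel_cons u v) w = foldr cancel_cons u (foldr cancel_cons v w)"
  using assms(2)
proof (induction u)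
  case (Cons x u)
  let ?p = "foldr cancel_cons u v"
  have IH: "foldr cancel_cons ?p w = foldr cancel_cons u (foldr cancel_cons v w)"
    using Cons by simp
  have *: "foldr cancel_cons (cancel_cons x p) w = cancel_cons x (foldr cancel_cons p w)"
    if "fst ` set p \<subseteq> S" for p
  proof (cases p)
    case (Cons y ys)
    have "foldr cancel_cons ys w \<in> reduced_words S"
      using that Cons assms(1) by (intro foldr_cancel_cons_reduced) auto
    then show ?thesis
      using Cons by (auto simp: cancel_cons_cancel)
  qed simp
  have "fst ` set (cancel_cons x p) \<subseteq> S" if "fst x \<in> S" "fst ` set p \<subseteq> S" for x p
    using that by (cases p) auto
  then have "fst ` set (foldr cancel_cons u' v) \<subseteq> S" if "fst ` set u' \<subseteq> S" for u'
    using that assms(3) by (induction u') auto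
  then have "fst ` set ?p \<subseteq> S"
    using Cons.prems by simp
  then show ?case
    using * IH by simp
qed simp

lemma foldr_cancel_cons_Nil:
  "w \<in> reduced_words S \<Longrightarrow> foldr cancel_cons w [] = w"
proof (induction w)
  case (Cons x w)
  then have "w \<in> reduced_words S"
    by (auto simp: reduced_words_def successively_Cons)
  with Cons show ?case
    by (cases w) (auto simp: reduced_words_def)
qed simp

lemma foldr_cancel_cons_rev_inv:
  assumes "w \<in> reduced_words S"
  shows "foldr cancel_cons (rev (map letter_inv u)) (foldr cancel_cons u w) = w"
  using assms
proof (induction u)
  case (Cons x u)
  let ?p = "foldr cancel_cons u w"
  have "cancel_cons (letter_inv x) (cancel_cons x ?p) = ?p"
    using foldr_cancel_cons_reduced[of u UNIV w] assms
      cancel_cons_cancel[of ?p UNIV "letter_inv x"]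
    by (simp add: reduced_words_def)
  then show ?case
    using Cons by simp
qed simp

lemma group_free_group: "group (free_group S)"
proof (rule groupI)
  fix x y assume "x \<in> carrier (free_group S)" "y \<in> carrier (free_group S)"
  then show "x \<otimes>\<^bsub>free_group S\<^esub> y \<in> carrier (free_group S)"
    using foldr_cancel_cons_reduced[of x S y] by (auto simp: free_group_def reduced_words_def)
next
  show "\<one>\<^bsub>free_group S\<^esub> \<in> carrier (free_group S)"
    by (simp add: free_group_def reduced_words_def)
next
  fix x y z
  assume "x \<in> carrier (free_group S)" "y \<in> carrier (free_group S)" "z \<in> carrier (free_group S)"
  then show "x \<otimes>\<^bsub>free_group S\<^esub> y \<otimes>\<^bsub>free_group S\<^esub> z
      = x \<otimes>\<^bsub>free_group S\<^esub> (y \<otimes>\<^bsub>free_group S\<^esub> z)"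
    using foldr_cancel_cons_assoc[of z S x y] by (auto simp: free_group_def reduced_words_def)
next
  fix x assume x: "x \<in> carrier (free_group S)"
  then show "\<one>\<^bsub>free_group S\<^esub> \<otimes>\<^bsub>free_group S\<^esub> x = x"
    by (simp add: free_group_def)
  let ?y = "foldr cancel_cons (rev (map letter_inv x)) []"
  have nil: "[] \<in> reduced_words S"
    by (simp add: reduced_words_def)
  have S: "fst ` set x \<subseteq> S" "fst ` set (rev (map letter_inv x)) \<subseteq> S"
    using x by (auto simp: free_group_def reduced_words_def)
  have y: "?y \<in> carrier (free_group S)"
    using foldr_cancel_cons_reduced[OF S(2) nil] by (simp add: free_group_def)
  then have "?y \<otimes>\<^bsub>free_group S\<^esub> x = foldr cancel_cons (rev (map letter_inv x)) x"
    using foldr_cancel_cons_assoc[of x S "rev (map letter_inv x)" "[]"] x S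
    by (simp add: free_group_def)
  also have "\<dots> = foldr cancel_cons (rev (map letter_inv x)) (foldr cancel_cons x [])"
    using x by (simp add: free_group_def foldr_cancel_cons_Nil)
  also have "\<dots> = []"
    by (rule foldr_cancel_cons_rev_inv[OF nil])
  finally show "\<exists>y\<in>carrier (free_group S). y \<otimes>\<^bsub>free_group S\<^esub> x = \<one>\<^bsub>free_group S\<^esub>"
    using y by (auto simp: free_group_def)
qed

text \<open>
  Amenability as a discrete group: there is a finitely additive, left invariant probability
  measure defined on all subsets of the group.
\<close>

definition amenable :: "('a, 'b) monoid_scheme \<Rightarrow> bool" where
  "amenable G \<longleftrightarrow> (\<exists>\<mu> :: 'a set \<Rightarrow> real.
     (\<forall>A. A \<subseteq> carrier G \<longrightarrow> 0 \<le> \<mu> A) \<and>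
     \<mu> (carrier G) = 1 \<and>
     (\<forall>A B. A \<subseteq> carrier G \<longrightarrow> B \<subseteq> carrier G \<longrightarrow> A \<inter> B = {} \<longrightarrow> \<mu> (A \<union> B) = \<mu> A + \<mu> B) \<and>
     (\<forall>g\<in>carrier G. \<forall>A. A \<subseteq> carrier G \<longrightarrow> \<mu> (g <#\<^bsub>G\<^esub> A) = \<mu> A))"

text \<open>\<open>A\<close> is the alphabet and \<open>R a b\<close> says that the letter \<open>a\<close> may be followed by \<open>b\<close>.\<close>

definition markov_shift :: "'a set \<Rightarrow> ('a \<Rightarrow> 'a \<Rightarrow> bool) \<Rightarrow> (nat \<Rightarrow> 'a) set" where
  "markov_shift A R = {x. \<forall>n. x n \<in> A \<and> R (x n) (x (Suc n))}"

definition left_shift :: "(nat \<Rightarrow> 'a) \<Rightarrow> nat \<Rightarrow> 'a" where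
  "left_shift x = (\<lambda>n. x (Suc n))"

definition shift_topology :: "'a set \<Rightarrow> ('a \<Rightarrow> 'a \<Rightarrow> bool) \<Rightarrow> (nat \<Rightarrow> 'a) topology" where
  "shift_topology A R =
     subtopology (product_topology (\<lambda>_. discrete_topology A) UNIV) (markov_shift A R)"

definition admissible_words :: "'a set \<Rightarrow> ('a \<Rightarrow> 'a \<Rightarrow> bool) \<Rightarrow> 'a list set" where
  "admissible_words A R = {w. w \<noteq> [] \<and> set w \<subseteq> A \<and> successively R w}"

definition cylinder :: "'a set \<Rightarrow> ('a \<Rightarrow> 'a \<Rightarrow> bool) \<Rightarrow> 'a list \<Rightarrow> (nat \<Rightarrow> 'a) set" where
  "cylinder A R w = {x \<in> markov_shift A R. \<forall>i<length w. x i = w ! i}"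

definition words_of :: "'a set \<Rightarrow> ('a \<Rightarrow> 'a \<Rightarrow> bool) \<Rightarrow> (nat \<Rightarrow> 'a) set \<Rightarrow> 'a list set" where
  "words_of A R K = {w \<in> admissible_words A R. cylinder A R w \<inter> K \<noteq> {}}"

definition log_card :: "'a set \<Rightarrow> ereal" where
  "log_card X = (if infinite X then \<infinity> else if X = {} then -\<infinity> else ereal (ln (real (card X))))"

text \<open>The pressure with scaling function \<open>1\<close> and potential \<open>0\<close>; the limit is over real \<open>T\<close>
  and \<open>\<eta>\<close> is the length of the window of admitted word lengths.\<close>

definition pressure :: "real \<Rightarrow> 'a list set \<Rightarrow> ereal" where
  "pressure \<eta> D = Limsup at_top (\<lambda>T::real.
     ereal (1 / T) * log_card {w \<in> D. T - \<eta> < real (length w) \<and> real (length w) \<le> T})"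

text \<open>Invariance of \<open>K\<close> under the non-invertible shift \<open>\<sigma>\<close> means \<open>\<sigma>(K) \<subseteq> K\<close>.\<close>

definition exhausting_principle ::
    "real \<Rightarrow> 'a set \<Rightarrow> ('a \<Rightarrow> 'a \<Rightarrow> bool) \<Rightarrow> 'a list set \<Rightarrow> bool" where
  "exhausting_principle \<eta> A R C \<longleftrightarrow> (\<exists>K :: nat \<Rightarrow> (nat \<Rightarrow> 'a) set.
     (\<forall>n. compactin (shift_topology A R) (K n) \<and> left_shift ` K n \<subseteq> K n) \<and>
     (\<lambda>n. pressure \<eta> (C \<inter> words_of A R (K n))) \<longlonglongrightarrow> pressure \<eta> C)"

definition finitely_irreducible :: "'a set \<Rightarrow> ('a \<Rightarrow> 'a \<Rightarrow> bool) \<Rightarrow> 'a list set \<Rightarrow> bool" where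
  "finitely_irreducible A R C \<longleftrightarrow> (\<exists>\<Lambda>. finite \<Lambda> \<and> \<Lambda> \<subseteq> admissible_words A R \<and>
     (\<forall>C1\<in>C. \<forall>C2\<in>C. \<exists>D\<in>\<Lambda> \<union> {[]}. C1 @ D @ C2 \<in> C))"

text \<open>\<open>F\<^sub>k\<close> is generated by the \<open>g\<^sub>i = free_gen i\<close> for \<open>1 \<le> i \<le> k\<close>.\<close>

abbreviation free_group_of_rank :: "nat \<Rightarrow> nat letter list monoid" where
  "free_group_of_rank k \<equiv> free_group {1..k}"

text \<open>The factor map \<open>F\<^sub>k \<rightarrow> F\<^sub>k/N\<close>; elements of \<open>F\<^sub>k/N\<close> are cosets of \<open>N\<close>, that is, sets.\<close>

definition factor_map :: "nat \<Rightarrow> nat letter list set \<Rightarrow> nat letter list \<Rightarrow> nat letter list set" where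
  "factor_map k N x = N #>\<^bsub>free_group_of_rank k\<^esub> x"

definition sym_gens :: "nat \<Rightarrow> nat letter list set" where
  "sym_gens k = free_gen ` {1..k} \<union> (\<lambda>i. inv\<^bsub>free_group_of_rank k\<^esub> (free_gen i)) ` {1..k}"

type_synonym ext_letter = "nat letter list \<times> nat letter list set"

definition ext_alphabet :: "nat \<Rightarrow> nat letter list set \<Rightarrow> ext_letter set" where
  "ext_alphabet k N = sym_gens k \<times> carrier (free_group_of_rank k Mod N)"

definition ext_step :: "nat \<Rightarrow> nat letter list set \<Rightarrow> ext_letter \<Rightarrow> ext_letter \<Rightarrow> bool" where
  "ext_step k N a b \<longleftrightarrow> snd a \<otimes>\<^bsub>free_group_of_rank k Mod N\<^esub> factor_map k N (fst a) = snd b"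

definition ext_step_reduced ::
    "nat \<Rightarrow> nat letter list set \<Rightarrow> ext_letter \<Rightarrow> ext_letter \<Rightarrow> bool" where
  "ext_step_reduced k N a b \<longleftrightarrow>
     fst a \<otimes>\<^bsub>free_group_of_rank k\<^esub> fst b \<noteq> \<one>\<^bsub>free_group_of_rank k\<^esub> \<and> ext_step k N a b"

definition words_from_one ::
    "nat \<Rightarrow> nat letter list set \<Rightarrow> (ext_letter \<Rightarrow> ext_letter \<Rightarrow> bool) \<Rightarrow> ext_letter list set" where
  "words_from_one k N R =
     {w \<in> admissible_words (ext_alphabet k N) R. snd (hd w) = \<one>\<^bsub>free_group_of_rank k Mod N\<^esub>}"

definition loops_at_one ::
    "nat \<Rightarrow> nat letter list set \<Rightarrow> (ext_letter \<Rightarrow> ext_letter \<Rightarrow> bool) \<Rightarrow> ext_letter list set" where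
  "loops_at_one k N R =
     {w \<in> words_from_one k N R.
        snd (last w) \<otimes>\<^bsub>free_group_of_rank k Mod N\<^esub> factor_map k N (fst (last w))
          = \<one>\<^bsub>free_group_of_rank k Mod N\<^esub>}"

end

theory Submission
  imports Defs "HOL-Real_Asymp.Real_Asymp"
begin

text \<open>
  Let \<open>\<kappa>\<close> be the growth rate of the number of admissible words (\<open>2k\<close> or \<open>2k - 1\<close>). All of (i)--(iii) say
  that the number of admissible loops at the identity grows with the same rate.

  Sequences staying in a finite part of \<open>G\<close> can be closed up to loops by words of bounded length, and
  conversely all loops of a fixed length can be concatenated freely inside a ball of \<open>G\<close>; this gives
  (ii) \<open>\<longleftrightarrow>\<close> (iii). In the reduced case the pieces are glued by conjugates of an element of \<open>N\<close>.

  If the loops grow with a smaller rate, then suitable generating functions of the numbers of words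
  ending in \<open>g\<close> converge and define a positive function \<open>h\<close> with \<open>\<Sum>\<^sub>s h(s g) \<le> t h(g)\<close>, \<open>t < 2k\<close>. An
  invariant mean would give the functions \<open>g \<mapsto> ln h(s g) - ln h(g)\<close> total mean \<open>0\<close>, but by concavity it is
  negative. If \<open>G\<close> is not amenable, then the number of all loops of length \<open>n\<close> is at most
  \<open>C y\<^sup>n\<close> with \<open>y < 2k\<close>, since otherwise the numbers of words of length \<open>n\<close> ending in \<open>g\<close> give almost invariant
  vectors in \<open>\<ell>\<^sup>2(G)\<close>. For reduced words one expands the number of all loops in terms of reduced loops,
  with the numbers of walks in the \<open>2k\<close>-regular tree as coefficients, and bounds these from below.
\<close>

section \<open>Amenability criteria for finitely generated groups\<close>

text \<open>An upper limit that is too small bounds the counts at all lengths, but one that is large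
  supplies only scattered lengths; there may be no loops of odd length at all. The concatenation of
  loops is therefore built to need just one good length. A mean on \<open>G\<close> is only finitely
  additive, so the potential has to be replaced by a function whose increments take finitely many
  values. In the converse direction squares of counts enter because the numbers of all words are
  powers of one symmetric operator applied to a point mass, so that their inner products are again
  numbers of loops. Numbers of reduced words are not such powers, which is why non-amenability is
  exploited for all words and then transferred through the tree. Reduced words may also cancel at a
  seam; glue of trivial value needs both a relation in \<open>G\<close> and enough letters to choose
  from.\<close>

lemma finitely_additive_Union:
  fixes \<mu> :: "'a set \<Rightarrow> real"
  assumes add: "\<And>A B. A \<subseteq> U \<Longrightarrow> B \<subseteq> U \<Longrightarrow> A \<inter> B = {} \<Longrightarrow> \<mu> (A \<union> B) = \<mu> A + \<mu> B"
    and "finite T" and "\<And>t. t \<in> T \<Longrightarrow> X t \<subseteq> U"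
    and "\<And>s t. s \<in> T \<Longrightarrow> t \<in> T \<Longrightarrow> s \<noteq> t \<Longrightarrow> X s \<inter> X t = {}"
  shows "\<mu> (\<Union>t\<in>T. X t) = (\<Sum>t\<in>T. \<mu> (X t))"
  using assms(2-)
proof (induction T rule: finite_induct)
  case empty
  then show ?case
    using add[of "{}" "{}"] by simp
next
  case (insert t T)
  have "\<mu> (X t \<union> (\<Union>t\<in>T. X t)) = \<mu> (X t) + \<mu> (\<Union>t\<in>T. X t)"
  proof (rule add)
    show "X t \<inter> (\<Union>t\<in>T. X t) = {}"
      using insert.hyps insert.prems(2) by fastforce
  qed (use insert.prems in auto)
  with insert show ?case
    by simp
qed

text \<open>Generators are indexed instead of being group elements, since a quotient may identify
  different letters or send them to the identity; what is counted are words in the letters.\<close>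

locale marked_group = group G for G (structure) +
  fixes J :: "'i set" and bar :: "'i \<Rightarrow> 'i" and p :: "'i \<Rightarrow> 'a"
  assumes finite_J: "finite J" and two_le_card_J: "2 \<le> card J"
    and p_closed [simp]: "s \<in> J \<Longrightarrow> p s \<in> carrier G"
    and bar_closed [simp]: "s \<in> J \<Longrightarrow> bar s \<in> J"
    and bar_bar [simp]: "bar (bar s) = s"
    and p_bar: "s \<in> J \<Longrightarrow> p (bar s) = inv p s"
begin

definition ev :: "'i list \<Rightarrow> 'a" where
  "ev w = foldr (\<lambda>s g. p s \<otimes> g) w \<one>"

lemma ev_simps [simp]: "ev [] = \<one>" "ev (s # w) = p s \<otimes> ev w"
  by (simp_all add: ev_def)

lemma ev_closed [simp]: "set w \<subseteq> J \<Longrightarrow> ev w \<in> carrier G"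
  by (induction w) auto

lemma ev_append [simp]: "set v \<subseteq> J \<Longrightarrow> set w \<subseteq> J \<Longrightarrow> ev (v @ w) = ev v \<otimes> ev w"
  by (induction v) (auto simp: m_assoc)

lemma bar_bij: "bij_betw bar J J"
  by (rule bij_betwI[of _ _ _ bar]) auto

lemma sum_bar: "(\<Sum>s\<in>J. f (bar s)) = (\<Sum>s\<in>J. f s)"
  by (rule sum.reindex_bij_betw[OF bar_bij])

lemma p_bar_cancel [simp]:
  assumes "s \<in> J" "g \<in> carrier G"
  shows "p (bar s) \<otimes> (p s \<otimes> g) = g" "p s \<otimes> (p (bar s) \<otimes> g) = g"
  using assms by (simp_all add: p_bar flip: m_assoc)

lemma bij_betw_p: "s \<in> J \<Longrightarrow> bij_betw (\<lambda>g. p s \<otimes> g) (carrier G) (carrier G)"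
  by (rule bij_betwI[of _ _ _ "\<lambda>g. p (bar s) \<otimes> g"]) auto

lemma l_coset_image: "g <# A = (\<lambda>x. g \<otimes> x) ` A"
  by (auto simp: l_coset_def)

text \<open>The increment of \<open>H\<close> along \<open>bar s\<close> at
  \<open>p s \<otimes> g\<close> is minus the increment along \<open>s\<close> at \<open>g\<close>.
  Under an invariant mean the two therefore have opposite averages and the sum over \<open>J\<close>
  vanishes, whereas the drift bound makes it at most -1. Bounded integer increments take finitely
  many values, so finite additivity suffices to average them.\<close>

lemma not_amenable_if_negative_drift:
  fixes H :: "'a \<Rightarrow> int"
  assumes bound: "\<And>s g. s \<in> J \<Longrightarrow> g \<in> carrier G \<Longrightarrow> \<bar>H (p s \<otimes> g) - H g\<bar> \<le> B"
    and drift: "\<And>g. g \<in> carrier G \<Longrightarrow> (\<Sum>s\<in>J. H (p s \<otimes> g) - H g) \<le> -1"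
  shows "\<not> amenable G"
proof
  assume "amenable G"
  then obtain \<mu> :: "'a set \<Rightarrow> real" where \<mu>: "(\<forall>A. A \<subseteq> carrier G \<longrightarrow> 0 \<le> \<mu> A) \<and> \<mu> (carrier G) = 1 \<and>
     (\<forall>A B. A \<subseteq> carrier G \<longrightarrow> B \<subseteq> carrier G \<longrightarrow> A \<inter> B = {} \<longrightarrow> \<mu> (A \<union> B) = \<mu> A + \<mu> B) \<and>
     (\<forall>g\<in>carrier G. \<forall>A. A \<subseteq> carrier G \<longrightarrow> \<mu> (g <# A) = \<mu> A)"
    unfolding amenable_def by (rule exE)
  have nonneg: "0 \<le> \<mu> A" if "A \<subseteq> carrier G" for A
    using \<mu> that by simp
  have total: "\<mu> (carrier G) = 1"
    using \<mu> by simp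
  have add: "\<mu> (A \<union> B) = \<mu> A + \<mu> B"
    if "A \<subseteq> carrier G" "B \<subseteq> carrier G" "A \<inter> B = {}" for A B
    using \<mu> that by metis
  have inv: "\<mu> (g <# A) = \<mu> A" if "g \<in> carrier G" "A \<subseteq> carrier G" for g A
    using \<mu> that by metis
  define D where "D s g = H (p s \<otimes> g) - H g" for s g
  \<comment> \<open>All increments at \<open>g\<close> are recorded at once: the fibres of
    \<open>F\<close> form one finite partition on which every increment is constant.\<close>
  define F where "F g = restrict (\<lambda>s. D s g) J" for g
  define T where "T = (PiE J (\<lambda>_. {-B..B}))"
  define M where "M t = \<mu> {g \<in> carrier G. F g = t}" for t
  define E where "E s = (\<Sum>t\<in>T. of_int (t s) * M t)" for s
  have finT: "finite T"
    unfolding T_def using finite_J by (intro finite_PiE) auto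
  have FT: "F g \<in> T" if "g \<in> carrier G" for g
    using bound that by (force simp: F_def T_def D_def abs_le_iff)
  have Mempty: "\<mu> {} = 0"
    using add[of "{}" "{}"] by simp
  have Msum: "\<mu> {g \<in> carrier G. P (F g)} = (\<Sum>t\<in>{t\<in>T. P t}. M t)" for P
  proof -
    have "{g \<in> carrier G. P (F g)} = (\<Union>t\<in>{t\<in>T. P t}. {g \<in> carrier G. F g = t})"
      using FT by auto
    then show ?thesis
      unfolding M_def using finT
      by (simp only:) (rule finitely_additive_Union[OF add], auto)
  qed
  have E_eq: "E s = (\<Sum>j\<in>{-B..B}. of_int j * \<mu> {g \<in> carrier G. D s g = j})" if "s \<in> J" for s
  proof -
    have "E s = (\<Sum>j\<in>{-B..B}. \<Sum>t\<in>{t\<in>T. t s = j}. of_int (t s) * M t)"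
      unfolding E_def using finT that
      by (intro sum.group[symmetric]) (auto simp: T_def PiE_def)
    also have "\<dots> = (\<Sum>j\<in>{-B..B}. of_int j * (\<Sum>t\<in>{t\<in>T. t s = j}. M t))"
      by (intro sum.cong refl) (simp add: sum_distrib_left)
    also have "\<dots> = (\<Sum>j\<in>{-B..B}. of_int j * \<mu> {g \<in> carrier G. F g s = j})"
      by (simp add: Msum[of "\<lambda>t. t s = j" for j])
    finally show ?thesis
      using that by (simp add: F_def)
  qed
  have E_bar: "E (bar s) = - E s" if s: "s \<in> J" for s
  proof -
    have *: "\<mu> {g \<in> carrier G. D (bar s) g = j} = \<mu> {g \<in> carrier G. D s g = - j}" for j
    proof -
      have "{g \<in> carrier G. D (bar s) g = j} = p s <# {g \<in> carrier G. D s g = - j}"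
      proof (intro equalityI subsetI)
        fix g assume "g \<in> {g \<in> carrier G. D (bar s) g = j}"
        then have "g = p s \<otimes> (p (bar s) \<otimes> g)" "p (bar s) \<otimes> g \<in> {g \<in> carrier G. D s g = - j}"
          using s by (auto simp: D_def)
        then show "g \<in> p s <# {g \<in> carrier G. D s g = - j}"
          unfolding l_coset_image by (rule image_eqI)
      qed (use s in \<open>auto simp: l_coset_image D_def\<close>)
      then show ?thesis
        using inv s by simp
    qed
    have "E (bar s) = (\<Sum>j\<in>{-B..B}. of_int j * \<mu> {g \<in> carrier G. D s g = - j})"
      using s by (simp add: E_eq *)
    also have "\<dots> = (\<Sum>j\<in>{-B..B}. of_int (- j) * \<mu> {g \<in> carrier G. D s g = j})"
      by (rule sum.reindex_bij_witness[of _ uminus uminus]) auto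
    finally show ?thesis
      using s by (simp add: E_eq sum_negf)
  qed
  have "(\<Sum>s\<in>J. E s) = - (\<Sum>s\<in>J. E s)"
    using sum_bar[of E] E_bar by (simp add: sum_negf)
  then have "0 = (\<Sum>s\<in>J. E s)"
    by simp
  also have "\<dots> = (\<Sum>t\<in>T. of_int (\<Sum>s\<in>J. t s) * M t)"
    unfolding E_def by (subst sum.swap) (simp add: sum_distrib_right)
  also have "\<dots> \<le> (\<Sum>t\<in>T. (-1) * M t)"
  proof (rule sum_mono)
    fix t
    show "of_int (\<Sum>s\<in>J. t s) * M t \<le> (-1) * M t"
    proof (cases "\<exists>g\<in>carrier G. F g = t")
      case True
      then obtain g where g: "g \<in> carrier G" "F g = t"
        by blast
      have "(\<Sum>s\<in>J. t s) \<le> -1"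
        using drift[OF g(1)] g(2) by (auto simp: F_def D_def)
      then have "real_of_int (\<Sum>s\<in>J. t s) \<le> -1"
        by linarith
      moreover have "0 \<le> M t"
        by (auto simp: M_def intro!: nonneg)
      ultimately show ?thesis
        by (rule mult_right_mono)
    next
      case False
      then have "{g \<in> carrier G. F g = t} = {}"
        by blast
      then have "M t = 0"
        unfolding M_def by (simp only: Mempty)
      then show ?thesis
        by simp
    qed
  qed
  also have "\<dots> = - \<mu> {g \<in> carrier G. True}"
    by (simp only: Msum[of "\<lambda>_. True"]) (simp add: sum_negf)
  finally show False
    using total by simp
qed

text \<open>The integer function with negative drift is a rounded multiple of \<open>ln h\<close>: its increments are
  bounded although \<open>h\<close> need not be, and \<open>ln x \<le> x - 1\<close> turns superharmonicity into drift.\<close>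

lemma not_amenable_if_superharmonic:
  fixes h :: "'a \<Rightarrow> real"
  assumes pos: "\<And>g. g \<in> carrier G \<Longrightarrow> 0 < h g"
    and super: "\<And>g. g \<in> carrier G \<Longrightarrow> (\<Sum>s\<in>J. h (p s \<otimes> g)) \<le> t * h g"
    and t: "t < card J"
  shows "\<not> amenable G"
proof -
  define c where "c = real (card J)"
  \<comment> \<open>Rounding costs at most 1 for each generator, hence \<open>c\<close> in total;
    this \<open>M\<close> makes the linear part \<open>- (c + 1)\<close> and leaves drift
    -1.\<close>
  define M where "M = (c + 1) / (c - t)"
  define H where "H g = \<lfloor>M * ln (h g)\<rfloor>" for g
  have M: "0 < M" "M * (t - c) = - (c + 1)"
    using t by (auto simp: M_def c_def field_simps)
  have le: "h (p s \<otimes> g) \<le> t * h g" if "s \<in> J" "g \<in> carrier G" for s g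
  proof -
    have "h (p s \<otimes> g) \<le> (\<Sum>s\<in>J. h (p s \<otimes> g))"
      using that finite_J pos by (intro member_le_sum) (auto simp: less_imp_le)
    then show ?thesis
      using super[OF that(2)] by simp
  qed
  obtain s0 where s0: "s0 \<in> J"
    using two_le_card_J by fastforce
  have t0: "0 < t"
    using le[OF s0 one_closed] pos[of \<one>] pos[of "p s0 \<otimes> \<one>"] s0
    by (metis less_le_trans m_closed one_closed p_closed zero_less_mult_pos2)
  have ln_le: "ln (h (p s \<otimes> g)) \<le> ln t + ln (h g)" if "s \<in> J" "g \<in> carrier G" for s g
  proof -
    have "ln (h (p s \<otimes> g)) \<le> ln (t * h g)"
      using le[OF that] pos that t0 by simp
    also have "\<dots> = ln t + ln (h g)"
      using t0 pos[OF that(2)] by (simp add: ln_mult)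
    finally show ?thesis .
  qed
  \<comment> \<open>Superharmonicity bounds increments from above; the lower bound is the upper
    bound for the step back along \<open>bar s\<close>.\<close>
  have abs_le: "\<bar>ln (h (p s \<otimes> g)) - ln (h g)\<bar> \<le> ln t" if "s \<in> J" "g \<in> carrier G" for s g
    using ln_le[OF that] ln_le[of "bar s" "p s \<otimes> g"] that by simp
  show ?thesis
  proof (rule not_amenable_if_negative_drift)
    fix s g assume s: "s \<in> J" and g: "g \<in> carrier G"
    have "\<bar>M * (ln (h (p s \<otimes> g)) - ln (h g))\<bar> \<le> M * ln t"
      using abs_le[OF s g] M by (simp add: abs_mult)
    then show "\<bar>H (p s \<otimes> g) - H g\<bar> \<le> \<lceil>M * ln t\<rceil> + 1"
      unfolding H_def right_diff_distrib by linarith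
  next
    fix g assume g: "g \<in> carrier G"
    have "real_of_int (\<Sum>s\<in>J. H (p s \<otimes> g) - H g) \<le> (\<Sum>s\<in>J. M * (h (p s \<otimes> g) / h g - 1) + 1)"
      unfolding of_int_sum
    proof (rule sum_mono)
      fix s assume s: "s \<in> J"
      have "ln (h (p s \<otimes> g)) - ln (h g) = ln (h (p s \<otimes> g) / h g)"
        using pos[OF g] pos[of "p s \<otimes> g"] s g by (simp add: ln_div)
      also have "\<dots> \<le> h (p s \<otimes> g) / h g - 1"
        using pos s g by (intro ln_le_minus_one) simp
      finally have "M * (ln (h (p s \<otimes> g)) - ln (h g)) \<le> M * (h (p s \<otimes> g) / h g - 1)"
        using M by simp
      then show "real_of_int (H (p s \<otimes> g) - H g) \<le> M * (h (p s \<otimes> g) / h g - 1) + 1"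
        unfolding H_def right_diff_distrib by linarith
    qed
    also have "\<dots> = M * ((\<Sum>s\<in>J. h (p s \<otimes> g)) / h g - c) + c"
      by (simp add: sum.distrib sum_subtractf c_def right_diff_distrib flip: sum_distrib_left sum_divide_distrib)
    also have "\<dots> \<le> M * (t - c) + c"
      using super[OF g] pos[OF g] M(1)
      by (intro add_mono mult_left_mono diff_mono) (auto simp: divide_le_eq)
    also have "\<dots> = -1"
      unfolding M(2) by simp
    finally show "(\<Sum>s\<in>J. H (p s \<otimes> g) - H g) \<le> -1"
      by linarith
  qed
qed

end

section \<open>Invariant means from almost invariant ones\<close>

locale generated_group = marked_group G J bar p
  for G (structure) and J :: "'i set" and bar and p :: "'i \<Rightarrow> 'a" +
  assumes generated: "g \<in> carrier G \<Longrightarrow> \<exists>w. set w \<subseteq> J \<and> ev w = g"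
begin

text \<open>Such set functions live in a power of the unit interval, which is compact by Tychonoff.
  A cluster point along the errors \<open>1 / Suc n\<close> inherits every closed condition, and
  exact invariance under the generators passes to all of \<open>G\<close> through words.\<close>

lemma amenableI_almost_invariant:
  assumes "\<And>\<epsilon>. 0 < \<epsilon> \<Longrightarrow> \<exists>\<mu> :: 'a set \<Rightarrow> real.
     (\<forall>A. A \<subseteq> carrier G \<longrightarrow> 0 \<le> \<mu> A) \<and> \<mu> (carrier G) = 1 \<and>
     (\<forall>A B. A \<subseteq> carrier G \<longrightarrow> B \<subseteq> carrier G \<longrightarrow> A \<inter> B = {} \<longrightarrow> \<mu> (A \<union> B) = \<mu> A + \<mu> B) \<and>
     (\<forall>s\<in>J. \<forall>A. A \<subseteq> carrier G \<longrightarrow> \<bar>\<mu> (p s <# A) - \<mu> A\<bar> \<le> \<epsilon>)"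
  shows "amenable G"
proof -
  define P where "P \<epsilon> \<mu> \<longleftrightarrow>
     (\<forall>A. A \<subseteq> carrier G \<longrightarrow> 0 \<le> \<mu> A) \<and> \<mu> (carrier G) = 1 \<and>
     (\<forall>A B. A \<subseteq> carrier G \<longrightarrow> B \<subseteq> carrier G \<longrightarrow> A \<inter> B = {} \<longrightarrow> \<mu> (A \<union> B) = \<mu> A + \<mu> B) \<and>
     (\<forall>s\<in>J. \<forall>A. A \<subseteq> carrier G \<longrightarrow> \<bar>\<mu> (p s <# A) - \<mu> A\<bar> \<le> \<epsilon>)"
    for \<epsilon> :: real and \<mu> :: "'a set \<Rightarrow> real"
  have "\<forall>n. \<exists>\<mu>. P (1 / Suc n) \<mu>"
    unfolding P_def by (intro allI assms) simp
  then obtain m where m: "\<And>n. P (1 / Suc n) (m n)"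
    by metis
  have nonneg: "0 \<le> m n A" if "A \<subseteq> carrier G" for n A
    using m[of n] that by (simp add: P_def)
  have total: "m n (carrier G) = 1" for n
    using m[of n] by (simp add: P_def)
  have add: "m n (A \<union> B) = m n A + m n B"
    if "A \<subseteq> carrier G" "B \<subseteq> carrier G" "A \<inter> B = {}" for n A B
    using m[of n] that by (simp add: P_def)
  have inv: "\<bar>m n (p s <# A) - m n A\<bar> \<le> 1 / Suc n" if "s \<in> J" "A \<subseteq> carrier G" for n s A
    using m[of n] that by (simp add: P_def)
  \<comment> \<open>Sets outside the carrier get the value 0, so that each \<open>\<nu> n\<close> is
    a point of the cube indexed by all sets of the type.\<close>
  define \<nu> where "\<nu> n A = (if A \<subseteq> carrier G then m n A else 0)" for n A
  define U where "U = (PiE UNIV (\<lambda>_. {0..1}) :: ('a set \<Rightarrow> real) set)"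
  have le1: "m n A \<le> 1" if "A \<subseteq> carrier G" for n A
  proof -
    have "m n A + m n (carrier G - A) = m n (A \<union> (carrier G - A))"
      using that by (intro add[symmetric]) auto
    also have "A \<union> (carrier G - A) = carrier G"
      using that by auto
    finally show ?thesis
      using nonneg[of "carrier G - A" n] total[of n] by auto
  qed
  have "compact U"
    unfolding U_def compactin_euclidean_iff[symmetric] euclidean_product_topology[symmetric]
    by (subst compactin_PiE) auto
  moreover have "eventually (\<lambda>x. x \<in> U) (filtermap \<nu> sequentially)"
    using nonneg le1 by (auto simp: eventually_filtermap U_def \<nu>_def intro!: always_eventually)
  ultimately obtain \<mu> where \<mu>: "inf (nhds \<mu>) (filtermap \<nu> sequentially) \<noteq> bot"
    unfolding compact_filter by (metis filtermap_bot_iff sequentially_bot)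
  have lim: "P \<mu>" if "closed {x. P x}" "eventually (\<lambda>n. P (\<nu> n)) sequentially" for P
  proof (rule ccontr)
    assume "\<not> P \<mu>"
    then have "eventually (\<lambda>x. x \<in> - {x. P x}) (nhds \<mu>)"
      using that(1) by (intro eventually_nhds_in_open) (auto simp: closed_def)
    moreover have "eventually P (filtermap \<nu> sequentially)"
      using that(2) by (simp add: eventually_filtermap)
    ultimately have "eventually (\<lambda>_. False) (inf (nhds \<mu>) (filtermap \<nu> sequentially))"
      unfolding eventually_inf by (rule_tac x = "\<lambda>x. x \<in> - {x. P x}" in exI, rule_tac x = P in exI) simp
    then show False
      using \<mu> by (simp add: trivial_limit_def)
  qed
  have \<mu>_nonneg: "0 \<le> \<mu> A" if "A \<subseteq> carrier G" for A
    by (rule lim) (auto intro!: closed_Collect_le continuous_intros simp: \<nu>_def nonneg that)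
  have \<mu>_total: "\<mu> (carrier G) = 1"
    by (rule lim) (auto intro!: closed_Collect_eq continuous_intros simp: \<nu>_def total)
  have \<mu>_add: "\<mu> (A \<union> B) = \<mu> A + \<mu> B"
    if "A \<subseteq> carrier G" "B \<subseteq> carrier G" "A \<inter> B = {}" for A B
    by (rule lim) (auto intro!: closed_Collect_eq continuous_intros simp: \<nu>_def add that)
  have \<mu>_p: "\<mu> (p s <# A) = \<mu> A" if s: "s \<in> J" and A: "A \<subseteq> carrier G" for s A
  proof -
    have sA: "p s <# A \<subseteq> carrier G"
      using s A by (auto simp: l_coset_image)
    have "\<bar>\<mu> (p s <# A) - \<mu> A\<bar> \<le> 1 / Suc n" for n
    proof (rule lim)
      show "\<forall>\<^sub>F i in sequentially. \<bar>\<nu> i (p s <# A) - \<nu> i A\<bar> \<le> 1 / Suc n"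
        using eventually_ge_at_top[of n]
      proof eventually_elim
        case (elim i)
        have "\<bar>m i (p s <# A) - m i A\<bar> \<le> 1 / Suc i"
          by (rule inv[OF s A])
        also have "\<dots> \<le> 1 / Suc n"
          using elim by (simp add: field_simps)
        finally show ?case
          using A sA by (simp add: \<nu>_def)
      qed
    qed (auto intro!: closed_Collect_le continuous_intros)
    then have "\<bar>\<mu> (p s <# A) - \<mu> A\<bar> \<le> 0"
      using LIMSEQ_le_const[OF LIMSEQ_inverse_real_of_nat]
      by (metis inverse_eq_divide)
    then show ?thesis
      by simp
  qed
  have \<mu>_ev: "\<mu> (ev w <# A) = \<mu> A" if "set w \<subseteq> J" "A \<subseteq> carrier G" for w A
    using that
  proof (induction w)
    case Nil
    then show ?case
      by (simp add: lcos_mult_one)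
  next
    case (Cons s w)
    have "ev (s # w) <# A = p s <# (ev w <# A)"
      using Cons.prems by (simp add: lcos_m_assoc)
    moreover have "ev w <# A \<subseteq> carrier G"
      using Cons.prems by (intro l_coset_subset_G) auto
    ultimately show ?case
      using Cons by (simp add: \<mu>_p)
  qed
  show ?thesis
    unfolding amenable_def using \<mu>_nonneg \<mu>_total \<mu>_add \<mu>_ev generated
    by (intro exI[of _ \<mu>]) (metis (no_types))
qed

end

section \<open>Kesten's criterion\<close>

lemma infsum_finite_support:
  fixes F :: "'a \<Rightarrow> real"
  assumes "finite X" "X \<subseteq> A" "\<And>g. g \<in> A \<Longrightarrow> g \<notin> X \<Longrightarrow> F g = 0"
  shows "infsum F A = (\<Sum>g\<in>X. F g)"
proof -
  have "infsum F A = infsum F X"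
    using assms by (intro infsum_cong_neutral) auto
  then show ?thesis
    using assms by simp
qed

text \<open>Young's inequality for \<open>\<bar>a - b\<bar> * \<bar>a + b\<bar>\<close>. Summed over
  the group it turns closeness of two functions in the 2-norm into closeness of their squares in the
  1-norm.\<close>

lemma abs_power2_diff_le:
  fixes a b \<theta> :: real
  assumes "0 < \<theta>"
  shows "\<bar>a\<^sup>2 - b\<^sup>2\<bar> \<le> (a - b)\<^sup>2 / (2 * \<theta>) + \<theta> * (a\<^sup>2 + b\<^sup>2)"
proof -
  have "\<bar>a\<^sup>2 - b\<^sup>2\<bar> = \<bar>a - b\<bar> * \<bar>a + b\<bar>"
    by (simp add: power2_eq_square square_diff_square_factored abs_mult mult.commute)
  also have "\<dots> \<le> (a - b)\<^sup>2 / (2 * \<theta>) + \<theta> * (a + b)\<^sup>2 / 2"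
  proof -
    have "0 \<le> (\<bar>a - b\<bar> - \<theta> * \<bar>a + b\<bar>)\<^sup>2 / (2 * \<theta>)"
      using assms by simp
    also have "\<dots> = (a - b)\<^sup>2 / (2 * \<theta>) + \<theta> * (a + b)\<^sup>2 / 2 - \<bar>a - b\<bar> * \<bar>a + b\<bar>"
      using assms by (simp add: power2_diff power_mult_distrib field_simps power2_eq_square)
    finally show ?thesis
      by simp
  qed
  also have "\<theta> * (a + b)\<^sup>2 / 2 \<le> \<theta> * (a\<^sup>2 + b\<^sup>2)"
  proof -
    have "(a + b)\<^sup>2 \<le> 2 * (a\<^sup>2 + b\<^sup>2)"
      using zero_le_power2[of "a - b"] by (simp add: power2_sum power2_diff)
    then show ?thesis
      using mult_left_mono[of "(a + b)\<^sup>2" _ "\<theta> / 2"] assms by simp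
  qed
  finally show ?thesis
    by simp
qed

section \<open>Numbers of words with a given value\<close>

context marked_group
begin

definition words :: "('i \<Rightarrow> 'i \<Rightarrow> bool) \<Rightarrow> nat \<Rightarrow> 'i list set" where
  "words r n = {w. length w = n \<and> set w \<subseteq> J \<and> successively r w}"

definition cnt :: "('i \<Rightarrow> 'i \<Rightarrow> bool) \<Rightarrow> nat \<Rightarrow> 'a \<Rightarrow> nat" where
  "cnt r n g = card {w \<in> words r n. ev w = g}"

abbreviation free_words :: "nat \<Rightarrow> 'i list set" where
  "free_words \<equiv> words (\<lambda>_ _. True)"

abbreviation walks :: "nat \<Rightarrow> 'a \<Rightarrow> nat" where
  "walks \<equiv> cnt (\<lambda>_ _. True)"

lemma finite_words [simp]: "finite (words r n)"
  by (rule finite_subset[OF _ finite_lists_length_eq[OF finite_J, of n]]) (auto simp: words_def)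

lemma successively_True [simp]: "successively (\<lambda>_ _. True) w"
  by (simp add: successively_conv_nth)

lemma cnt_pos_iff: "0 < cnt r n g \<longleftrightarrow> (\<exists>w\<in>words r n. ev w = g)"
  by (auto simp: cnt_def card_gt_0_iff)

lemma words_0: "words r 0 = {[]}"
  by (auto simp: words_def)

lemma cnt_0: "cnt r 0 g = (if g = \<one> then 1 else 0)"
proof -
  have "{w \<in> words r 0. ev w = g} = (if g = \<one> then {[]} else {})"
    by (auto simp: words_0)
  then show ?thesis
    by (simp add: cnt_def)
qed

lemma finite_support_cnt: "finite {g \<in> carrier G. real (cnt r n g) \<noteq> 0}"
  by (rule finite_subset[of _ "ev ` words r n"]) (use cnt_pos_iff in fastforce)+

text \<open>Splitting off the first letter gives the arguments \<open>p (bar s) \<otimes> g\<close>,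
  and \<open>bar\<close> permutes \<open>J\<close>. Thus \<open>walks n\<close> is the
  \<open>n\<close>-th power of the operator that sums left translates, applied to the point mass at
  \<open>\<one>\<close>.\<close>

lemma walks_Suc:
  assumes g: "g \<in> carrier G"
  shows "walks (Suc n) g = (\<Sum>s\<in>J. walks n (p s \<otimes> g))"
proof -
  let ?A = "\<lambda>s. {w \<in> free_words n. ev w = p (bar s) \<otimes> g}"
  have "bij_betw (\<lambda>(s, w). s # w) (SIGMA s:J. ?A s) {w \<in> free_words (Suc n). ev w = g}"
    unfolding bij_betw_def
  proof
    show "inj_on (\<lambda>(s, w). s # w) (SIGMA s:J. ?A s)"
      by (auto simp: inj_on_def)
    show "(\<lambda>(s, w). s # w) ` (SIGMA s:J. ?A s) = {w \<in> free_words (Suc n). ev w = g}"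
    proof (intro equalityI subsetI)
      fix w assume "w \<in> {w \<in> free_words (Suc n). ev w = g}"
      then obtain s v where w: "w = s # v" "s \<in> J" "set v \<subseteq> J" "length v = n" "p s \<otimes> ev v = g"
        by (cases w) (auto simp: words_def)
      then have "(s, v) \<in> (SIGMA s:J. ?A s)"
        by (auto simp: words_def)
      then show "w \<in> (\<lambda>(s, w). s # w) ` (SIGMA s:J. ?A s)"
        using w by force
    qed (use g in \<open>auto simp: words_def\<close>)
  qed
  then have "walks (Suc n) g = card (SIGMA s:J. ?A s)"
    by (simp add: cnt_def bij_betw_same_card)
  also have "\<dots> = (\<Sum>s\<in>J. walks n (p (bar s) \<otimes> g))"
    using finite_J by (simp add: cnt_def)
  finally show ?thesis
    by (simp add: sum_bar[of "\<lambda>s. walks n (p s \<otimes> g)"])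
qed

lemma infsum_translate:
  assumes "s \<in> J"
  shows "infsum (\<lambda>g. F (p s \<otimes> g)) (carrier G) = infsum F (carrier G)"
  using infsum_reindex_bij_betw[OF bij_betw_p[OF assms]] .

lemma finite_support_translate:
  fixes F :: "'a \<Rightarrow> real"
  assumes "s \<in> J" "finite {g \<in> carrier G. F g \<noteq> 0}"
  shows "finite {g \<in> carrier G. F (p s \<otimes> g) \<noteq> 0}"
proof (rule finite_subset)
  show "{g \<in> carrier G. F (p s \<otimes> g) \<noteq> 0} \<subseteq> (\<lambda>g. p (bar s) \<otimes> g) ` {g \<in> carrier G. F g \<noteq> 0}"
  proof
    fix g assume "g \<in> {g \<in> carrier G. F (p s \<otimes> g) \<noteq> 0}"
    then show "g \<in> (\<lambda>g. p (bar s) \<otimes> g) ` {g \<in> carrier G. F g \<noteq> 0}"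
      using assms(1) by (intro image_eqI[of _ _ "p s \<otimes> g"]) auto
  qed
qed (use assms in auto)

text \<open>The operator in \<open>walks_Suc\<close> is symmetric because \<open>J\<close> is closed
  under \<open>bar\<close>, so one application can be moved from the first factor to the
  second.\<close>

lemma infsum_walks_mult:
  "(\<Sum>\<^sub>\<infinity>g\<in>carrier G. real (walks n g) * real (walks m g)) = real (walks (n + m) \<one>)"
proof (induction n arbitrary: m)
  case 0
  have "(\<Sum>\<^sub>\<infinity>g\<in>carrier G. real (walks 0 g) * real (walks m g))
      = (\<Sum>g\<in>{\<one>}. real (walks 0 g) * real (walks m g))"
    by (rule infsum_finite_support) (auto simp: cnt_0)
  then show ?case
    by (simp add: cnt_0)
next
  case (Suc n)
  define X where "X = {g \<in> carrier G. real (walks n g) \<noteq> 0} \<union> {g \<in> carrier G. real (walks m g) \<noteq> 0}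
    \<union> {g \<in> carrier G. real (walks (Suc m) g) \<noteq> 0}"
  have X: "finite X" "X \<subseteq> carrier G"
    by (auto simp only: X_def intro!: finite_support_cnt finite_UnI)
  have "(\<Sum>\<^sub>\<infinity>g\<in>carrier G. real (walks (Suc n) g) * real (walks m g))
      = (\<Sum>g\<in>X. real (walks (Suc n) g) * real (walks m g))"
    by (rule infsum_finite_support[OF X]) (auto simp: X_def)
  also have "\<dots> = (\<Sum>g\<in>X. \<Sum>s\<in>J. real (walks n (p s \<otimes> g)) * real (walks m g))"
    using X by (intro sum.cong refl) (auto simp: walks_Suc sum_distrib_right)
  also have "\<dots> = (\<Sum>s\<in>J. \<Sum>g\<in>X. real (walks n (p s \<otimes> g)) * real (walks m g))"
    by (rule sum.swap)
  also have "\<dots> = (\<Sum>s\<in>J. \<Sum>\<^sub>\<infinity>g\<in>carrier G. real (walks n (p s \<otimes> g)) * real (walks m g))"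
    by (intro sum.cong refl infsum_finite_support[OF X, symmetric]) (auto simp: X_def)
  also have "\<dots> = (\<Sum>s\<in>J. \<Sum>\<^sub>\<infinity>g\<in>carrier G. real (walks n g) * real (walks m (p (bar s) \<otimes> g)))"
  proof (intro sum.cong refl)
    fix s assume s: "s \<in> J"
    show "(\<Sum>\<^sub>\<infinity>g\<in>carrier G. real (walks n (p s \<otimes> g)) * real (walks m g))
        = (\<Sum>\<^sub>\<infinity>g\<in>carrier G. real (walks n g) * real (walks m (p (bar s) \<otimes> g)))"
      by (subst infsum_translate[OF s, symmetric], rule infsum_cong) (use s in simp)
  qed
  also have "\<dots> = (\<Sum>s\<in>J. \<Sum>\<^sub>\<infinity>g\<in>carrier G. real (walks n g) * real (walks m (p s \<otimes> g)))"
    by (rule sum_bar)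
  also have "\<dots> = (\<Sum>s\<in>J. \<Sum>g\<in>X. real (walks n g) * real (walks m (p s \<otimes> g)))"
    by (intro sum.cong refl infsum_finite_support[OF X]) (auto simp: X_def)
  also have "\<dots> = (\<Sum>g\<in>X. \<Sum>s\<in>J. real (walks n g) * real (walks m (p s \<otimes> g)))"
    by (rule sum.swap)
  also have "\<dots> = (\<Sum>g\<in>X. real (walks n g) * real (walks (Suc m) g))"
    using X by (intro sum.cong refl) (auto simp: walks_Suc sum_distrib_left)
  also have "\<dots> = (\<Sum>\<^sub>\<infinity>g\<in>carrier G. real (walks n g) * real (walks (Suc m) g))"
    by (rule infsum_finite_support[OF X, symmetric]) (auto simp: X_def)
  finally show ?case
    by (simp add: Suc)
qed

lemma walks_even_pos: "0 < walks (2 * n) \<one>"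
proof -
  obtain s where s: "s \<in> J"
    using two_le_card_J by fastforce
  have "\<exists>w\<in>free_words (2 * n). ev w = \<one>"
  proof (induction n)
    case (Suc n)
    then obtain w where "w \<in> free_words (2 * n)" "ev w = \<one>"
      by blast
    then have "s # bar s # w \<in> free_words (2 * Suc n)" "ev (s # bar s # w) = \<one>"
      using s p_bar_cancel(2)[of s \<one>] by (auto simp: words_def)
    then show ?case
      by blast
  qed (auto simp: words_0)
  then show ?thesis
    by (simp add: cnt_pos_iff)
qed

text \<open>Let \<open>c = card J\<close> and let \<open>N = walks (2 * n) \<one>\<close> be the
  squared norm of \<open>walks n\<close>. The squared distances between all pairs of translates sum
  to \<open>2 * (c\<^sup>2 * N - walks (2 * Suc n) \<one>)\<close>, which the growth hypothesis
  bounds by \<open>2 * \<theta>\<^sup>2 * N\<close>. Young's inequality with the same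
  \<open>\<theta>\<close> then costs \<open>\<theta> * N\<close> for the distance and
  \<open>2 * \<theta> * N\<close> for the norms, hence the factor 3.\<close>

lemma walks_translates_close:
  assumes \<theta>: "0 < \<theta>"
    and growth: "((real (card J))\<^sup>2 - \<theta>\<^sup>2) * real (walks (2 * n) \<one>) \<le> real (walks (2 * Suc n) \<one>)"
    and s: "s \<in> J" "t \<in> J"
  shows "(\<Sum>\<^sub>\<infinity>g\<in>carrier G. \<bar>(real (walks n (p s \<otimes> g)))\<^sup>2 - (real (walks n (p t \<otimes> g)))\<^sup>2\<bar>)
     \<le> 3 * \<theta> * real (walks (2 * n) \<one>)"
proof -
  define f where "f g = real (walks n g)" for g
  define N where "N = real (walks (2 * n) \<one>)"
  define c where "c = real (card J)"
  define X where "X = (\<Union>s\<in>J. {g \<in> carrier G. f (p s \<otimes> g) \<noteq> 0})"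
  have "finite {g \<in> carrier G. f g \<noteq> 0}"
    unfolding f_def by (rule finite_support_cnt)
  then have X: "finite X" "X \<subseteq> carrier G"
    unfolding X_def using finite_J finite_support_translate[of _ f] by auto
  have X0: "f (p s \<otimes> g) = 0" if "s \<in> J" "g \<in> carrier G" "g \<notin> X" for s g
    using that by (auto simp: X_def)
  have norm: "(\<Sum>g\<in>X. (f (p s \<otimes> g))\<^sup>2) = N" if "s \<in> J" for s
  proof -
    have "(\<Sum>g\<in>X. (f (p s \<otimes> g))\<^sup>2) = (\<Sum>\<^sub>\<infinity>g\<in>carrier G. (f (p s \<otimes> g))\<^sup>2)"
      using X0 that by (intro infsum_finite_support[OF X, symmetric]) simp
    also have "\<dots> = (\<Sum>\<^sub>\<infinity>g\<in>carrier G. (f g)\<^sup>2)"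
      by (rule infsum_translate[OF that])
    finally show ?thesis
      using infsum_walks_mult[of n n] by (simp add: f_def N_def power2_eq_square mult_2)
  qed
  have norm_Suc: "(\<Sum>g\<in>X. (\<Sum>s\<in>J. f (p s \<otimes> g))\<^sup>2) = real (walks (2 * Suc n) \<one>)"
  proof -
    have "(\<Sum>g\<in>X. (\<Sum>s\<in>J. f (p s \<otimes> g))\<^sup>2) = (\<Sum>\<^sub>\<infinity>g\<in>carrier G. (\<Sum>s\<in>J. f (p s \<otimes> g))\<^sup>2)"
      using X0 by (intro infsum_finite_support[OF X, symmetric]) simp
    also have "\<dots> = (\<Sum>\<^sub>\<infinity>g\<in>carrier G. real (walks (Suc n) g) * real (walks (Suc n) g))"
      by (intro infsum_cong) (simp add: walks_Suc f_def power2_eq_square)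
    finally show ?thesis
      by (simp add: infsum_walks_mult mult_2)
  qed
  have "(\<Sum>s\<in>J. \<Sum>t\<in>J. \<Sum>g\<in>X. (f (p s \<otimes> g) - f (p t \<otimes> g))\<^sup>2)
      = (\<Sum>g\<in>X. \<Sum>s\<in>J. \<Sum>t\<in>J. (f (p s \<otimes> g) - f (p t \<otimes> g))\<^sup>2)"
    by (simp only: sum.swap[of _ X])
  also have "\<dots> = (\<Sum>g\<in>X. 2 * (c * (\<Sum>s\<in>J. (f (p s \<otimes> g))\<^sup>2)) - 2 * (\<Sum>s\<in>J. f (p s \<otimes> g))\<^sup>2)"
  proof (intro sum.cong refl)
    fix g
    have "(\<Sum>s\<in>J. \<Sum>t\<in>J. (f (p s \<otimes> g) - f (p t \<otimes> g))\<^sup>2)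
       = (\<Sum>s\<in>J. \<Sum>t\<in>J. (f (p s \<otimes> g))\<^sup>2 + (f (p t \<otimes> g))\<^sup>2 - 2 * (f (p s \<otimes> g) * f (p t \<otimes> g)))"
      by (simp add: power2_diff mult.assoc)
    then show "(\<Sum>s\<in>J. \<Sum>t\<in>J. (f (p s \<otimes> g) - f (p t \<otimes> g))\<^sup>2)
       = 2 * (c * (\<Sum>s\<in>J. (f (p s \<otimes> g))\<^sup>2)) - 2 * (\<Sum>s\<in>J. f (p s \<otimes> g))\<^sup>2"
      by (simp add: sum.distrib sum_subtractf c_def power2_eq_square sum_product flip: sum_distrib_left)
  qed
  also have "\<dots> = 2 * c * (\<Sum>s\<in>J. \<Sum>g\<in>X. (f (p s \<otimes> g))\<^sup>2) - 2 * real (walks (2 * Suc n) \<one>)"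
    by (simp only: sum_subtractf sum.swap[of _ J] norm_Suc mult.assoc flip: sum_distrib_left)
  also have "\<dots> = 2 * (c\<^sup>2 * N - real (walks (2 * Suc n) \<one>))"
  proof -
    have "(\<Sum>s\<in>J. \<Sum>g\<in>X. (f (p s \<otimes> g))\<^sup>2) = c * N"
      using norm by (simp add: c_def)
    then show ?thesis
      by (simp add: power2_eq_square)
  qed
  also have "\<dots> \<le> 2 * (\<theta>\<^sup>2 * N)"
    using growth by (simp add: c_def N_def left_diff_distrib)
  finally have total: "(\<Sum>s\<in>J. \<Sum>t\<in>J. \<Sum>g\<in>X. (f (p s \<otimes> g) - f (p t \<otimes> g))\<^sup>2) \<le> 2 * (\<theta>\<^sup>2 * N)" .
  have "(\<Sum>g\<in>X. (f (p s \<otimes> g) - f (p t \<otimes> g))\<^sup>2)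
      \<le> (\<Sum>t\<in>J. \<Sum>g\<in>X. (f (p s \<otimes> g) - f (p t \<otimes> g))\<^sup>2)"
    using s finite_J by (intro member_le_sum) (auto intro: sum_nonneg)
  also have "\<dots> \<le> (\<Sum>s\<in>J. \<Sum>t\<in>J. \<Sum>g\<in>X. (f (p s \<otimes> g) - f (p t \<otimes> g))\<^sup>2)"
    using s finite_J
    by (intro member_le_sum[of s J "\<lambda>s. \<Sum>t\<in>J. \<Sum>g\<in>X. (f (p s \<otimes> g) - f (p t \<otimes> g))\<^sup>2"] sum_nonneg) auto
  finally have close: "(\<Sum>g\<in>X. (f (p s \<otimes> g) - f (p t \<otimes> g))\<^sup>2) \<le> 2 * (\<theta>\<^sup>2 * N)"
    using total by linarith
  have "(\<Sum>\<^sub>\<infinity>g\<in>carrier G. \<bar>(f (p s \<otimes> g))\<^sup>2 - (f (p t \<otimes> g))\<^sup>2\<bar>)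
     = (\<Sum>g\<in>X. \<bar>(f (p s \<otimes> g))\<^sup>2 - (f (p t \<otimes> g))\<^sup>2\<bar>)"
    using X0 s by (intro infsum_finite_support[OF X]) simp
  also have "\<dots> \<le> (\<Sum>g\<in>X. (f (p s \<otimes> g) - f (p t \<otimes> g))\<^sup>2 / (2 * \<theta>)
      + \<theta> * ((f (p s \<otimes> g))\<^sup>2 + (f (p t \<otimes> g))\<^sup>2))"
    by (intro sum_mono abs_power2_diff_le \<theta>)
  also have "\<dots> = (\<Sum>g\<in>X. (f (p s \<otimes> g) - f (p t \<otimes> g))\<^sup>2) / (2 * \<theta>) + \<theta> * (N + N)"
    using norm s by (simp add: sum.distrib flip: sum_distrib_left sum_divide_distrib)
  also have "\<dots> \<le> 2 * (\<theta>\<^sup>2 * N) / (2 * \<theta>) + \<theta> * (N + N)"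
    using close \<theta> by (intro add_right_mono divide_right_mono) auto
  also have "\<dots> = 3 * \<theta> * N"
    using \<theta> by (simp add: power2_eq_square)
  finally show ?thesis
    by (simp add: f_def N_def)
qed

end

text \<open>If the numbers \<open>walks (2 * n) \<one>\<close>, the squared norms of \<open>f = walks n\<close>, grow by nearly
  \<open>(card J)\<^sup>2\<close> in one step, then all translates of \<open>f\<close> by generators nearly agree with each other
  (though not with \<open>f\<close> itself, by parity); hence the average of \<open>f\<^sup>2\<close> and one translate is almost
  invariant.\<close>

lemma (in generated_group) kesten_criterion:
  assumes "\<And>\<theta>. 0 < \<theta> \<Longrightarrow> \<exists>n. ((real (card J))\<^sup>2 - \<theta>\<^sup>2) * real (walks (2 * n) \<one>) \<le> real (walks (2 * Suc n) \<one>)"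
  shows "amenable G"
proof (rule amenableI_almost_invariant)
  fix \<epsilon> :: real assume \<epsilon>: "0 < \<epsilon>"
  \<comment> \<open>Two distances of \<open>3 * \<theta> * N\<close> each, divided by
    \<open>2 * N\<close>, leave \<open>3 * \<theta>\<close>.\<close>
  define \<theta> where "\<theta> = \<epsilon> / 3"
  have \<theta>: "0 < \<theta>"
    using \<epsilon> by (simp add: \<theta>_def)
  from assms[OF this] obtain n
    where n: "((real (card J))\<^sup>2 - \<theta>\<^sup>2) * real (walks (2 * n) \<one>) \<le> real (walks (2 * Suc n) \<one>)"
    by blast
  define f where "f g = (real (walks n g))\<^sup>2" for g
  define N where "N = real (walks (2 * n) \<one>)"
  have N: "0 < N"
    unfolding N_def using walks_even_pos by simp
  obtain s0 where s0: "s0 \<in> J"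
    using two_le_card_J by fastforce
  define F where "F g = (f g + f (p s0 \<otimes> g)) / (2 * N)" for g
  define \<mu> where "\<mu> A = infsum F A" for A
  have fin_f: "finite {g \<in> carrier G. f g \<noteq> 0}"
    using finite_support_cnt[of "\<lambda>_ _. True" n] by (simp add: f_def)
  have fin_fs: "finite {g \<in> carrier G. f (p s \<otimes> g) \<noteq> 0}" if "s \<in> J" for s
    using finite_support_translate[OF that fin_f] .
  have fin_F: "finite {g \<in> carrier G. F g \<noteq> 0}"
    by (rule finite_subset[OF _ finite_UnI[OF fin_f fin_fs[OF s0]]]) (auto simp: F_def)
  have summable: "h summable_on A"
    if "finite {g \<in> carrier G. h g \<noteq> 0}" "A \<subseteq> carrier G" for h :: "'a \<Rightarrow> real" and A
    by (rule finite_nonzero_values_imp_summable_on, rule finite_subset[OF _ that(1)]) (use that in auto)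
  have F_nonneg: "0 \<le> F g" for g
    using N by (simp add: F_def f_def)
  have sum_f: "infsum f (carrier G) = N"
    using infsum_walks_mult[of n n] by (simp add: f_def[abs_def] N_def power2_eq_square mult_2)
  have \<mu>_total: "\<mu> (carrier G) = 1"
  proof -
    have "\<mu> (carrier G) = (\<Sum>\<^sub>\<infinity>g\<in>carrier G. (1 / (2 * N)) * (f g + f (p s0 \<otimes> g)))"
      unfolding \<mu>_def F_def by (intro infsum_cong) simp
    also have "\<dots> = (1 / (2 * N)) * (infsum f (carrier G) + (\<Sum>\<^sub>\<infinity>g\<in>carrier G. f (p s0 \<otimes> g)))"
      by (simp only: infsum_cmult_right'
          infsum_add[OF summable[OF fin_f order_refl] summable[OF fin_fs[OF s0] order_refl]])
    also have "\<dots> = 1"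
      using N by (simp add: infsum_translate[OF s0] sum_f)
    finally show ?thesis .
  qed
  have \<mu>_p: "\<bar>\<mu> (p s <# A) - \<mu> A\<bar> \<le> \<epsilon>" if s: "s \<in> J" and A: "A \<subseteq> carrier G" for s A
  proof -
    \<comment> \<open>In \<open>F (p s \<otimes> g) - F g\<close> the terms are paired crosswise:
      \<open>f (p s \<otimes> g)\<close> with \<open>f (p s0 \<otimes> g)\<close>, and
      \<open>f (p s0 \<otimes> (p s \<otimes> g))\<close> with \<open>f g\<close>. Each pair
      consists of two generator translates of \<open>f\<close> at one point, namely \<open>g\<close>
      and \<open>p s \<otimes> g\<close>.\<close>
    let ?D = "\<lambda>g. \<bar>f (p s \<otimes> g) - f (p s0 \<otimes> g)\<bar>"
    let ?E = "\<lambda>g. \<bar>f (p s0 \<otimes> g) - f (p (bar s) \<otimes> g)\<bar>"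
    have fin_Fs: "finite {g \<in> carrier G. F (p s \<otimes> g) \<noteq> 0}"
      using finite_support_translate[OF s fin_F] .
    have fin_D: "finite {g \<in> carrier G. ?D g \<noteq> 0}"
      by (rule finite_subset[OF _ finite_UnI[OF fin_fs[OF s] fin_fs[OF s0]]]) auto
    have fin_E: "finite {g \<in> carrier G. ?E g \<noteq> 0}"
      using s by (intro finite_subset[OF _ finite_UnI[OF fin_fs[OF s0] fin_fs[of "bar s"]]]) auto
    have fin_diff: "finite {g \<in> carrier G. F (p s \<otimes> g) + (-1) * F g \<noteq> 0}"
      by (rule finite_subset[OF _ finite_UnI[OF fin_Fs fin_F]]) auto
    have "inj_on (\<lambda>g. p s \<otimes> g) A"
      using bij_betw_p[OF s] A by (meson bij_betw_def inj_on_subset)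
    then have "\<mu> (p s <# A) = infsum (\<lambda>g. F (p s \<otimes> g)) A"
      unfolding \<mu>_def l_coset_image by (simp add: infsum_reindex o_def)
    moreover have "infsum (\<lambda>g. F (p s \<otimes> g) + (-1) * F g) A
        = infsum (\<lambda>g. F (p s \<otimes> g)) A + infsum (\<lambda>g. (-1) * F g) A"
      by (rule infsum_add) (auto intro!: summable fin_Fs fin_F summable_on_cmult_right A)
    ultimately have "\<mu> (p s <# A) - \<mu> A = infsum (\<lambda>g. F (p s \<otimes> g) + (-1) * F g) A"
      by (simp only: infsum_cmult_right' \<mu>_def)
    then have "\<bar>\<mu> (p s <# A) - \<mu> A\<bar> \<le> infsum (\<lambda>g. \<bar>F (p s \<otimes> g) + (-1) * F g\<bar>) A"
      using norm_infsum_bound[of "\<lambda>g. F (p s \<otimes> g) + (-1) * F g" A] summable[of "\<lambda>g. \<bar>F (p s \<otimes> g) + (-1) * F g\<bar>" A] fin_diff A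
      by simp
    also have "\<dots> \<le> infsum (\<lambda>g. \<bar>F (p s \<otimes> g) + (-1) * F g\<bar>) (carrier G)"
      using summable[of "\<lambda>g. \<bar>F (p s \<otimes> g) + (-1) * F g\<bar>"] fin_diff A by (intro infsum_mono2) auto
    also have "\<dots> \<le> infsum (\<lambda>g. 1 / (2 * N) * (?D g + ?E (p s \<otimes> g))) (carrier G)"
    proof (rule infsum_mono)
      fix g assume g: "g \<in> carrier G"
      have "F (p s \<otimes> g) + (-1) * F g
         = 1 / (2 * N) * ((f (p s \<otimes> g) - f (p s0 \<otimes> g)) + (f (p s0 \<otimes> (p s \<otimes> g)) - f g))"
        by (simp add: F_def diff_divide_distrib add_divide_distrib)
      then have "\<bar>F (p s \<otimes> g) + (-1) * F g\<bar>
         = 1 / (2 * N) * \<bar>(f (p s \<otimes> g) - f (p s0 \<otimes> g)) + (f (p s0 \<otimes> (p s \<otimes> g)) - f g)\<bar>"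
        using N by (simp only: abs_mult) simp
      also have "\<dots> \<le> 1 / (2 * N) * (?D g + ?E (p s \<otimes> g))"
        using s g N by (intro mult_left_mono) (auto intro: abs_triangle_ineq)
      finally show "\<bar>F (p s \<otimes> g) + (-1) * F g\<bar> \<le> 1 / (2 * N) * (?D g + ?E (p s \<otimes> g))" .
    next
      show "(\<lambda>g. 1 / (2 * N) * (?D g + ?E (p s \<otimes> g))) summable_on carrier G"
        by (intro summable_on_cmult_right summable_on_add summable fin_D order_refl
            finite_support_translate[OF s fin_E])
    qed (use fin_diff in \<open>auto intro!: summable\<close>)
    also have "\<dots> = 1 / (2 * N) * (infsum ?D (carrier G) + infsum ?E (carrier G))"
      using infsum_translate[OF s, of ?E]
      by (simp only: infsum_cmult_right' infsum_add[OF summable[OF fin_D order_refl]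
          summable[OF finite_support_translate[OF s fin_E] order_refl]])
    also have "\<dots> \<le> 1 / (2 * N) * (3 * \<theta> * N + 3 * \<theta> * N)"
      using walks_translates_close[OF \<theta> n s s0] walks_translates_close[OF \<theta> n s0 bar_closed[OF s]] N
      by (intro mult_left_mono add_mono) (auto simp: f_def N_def)
    also have "\<dots> = \<epsilon>"
      using N by (simp add: \<theta>_def)
    finally show ?thesis .
  qed
  show "\<exists>\<mu> :: 'a set \<Rightarrow> real. (\<forall>A. A \<subseteq> carrier G \<longrightarrow> 0 \<le> \<mu> A) \<and> \<mu> (carrier G) = 1 \<and>
     (\<forall>A B. A \<subseteq> carrier G \<longrightarrow> B \<subseteq> carrier G \<longrightarrow> A \<inter> B = {} \<longrightarrow> \<mu> (A \<union> B) = \<mu> A + \<mu> B) \<and>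
     (\<forall>s\<in>J. \<forall>A. A \<subseteq> carrier G \<longrightarrow> \<bar>\<mu> (p s <# A) - \<mu> A\<bar> \<le> \<epsilon>)"
  proof (intro exI[of _ \<mu>] conjI allI ballI impI \<mu>_total \<mu>_p)
    fix A show "0 \<le> \<mu> A"
      unfolding \<mu>_def by (intro infsum_nonneg F_nonneg)
  next
    fix A B assume "A \<subseteq> carrier G" "B \<subseteq> carrier G" "A \<inter> B = {}"
    then show "\<mu> (A \<union> B) = \<mu> A + \<mu> B"
      unfolding \<mu>_def by (intro infsum_Un_disjoint summable fin_F)
  qed
qed

text \<open>Failure of Kesten's criterion gives a fixed factor below \<open>(card J)\<^sup>2\<close>
  for every step between even lengths. The count at an odd length \<open>2 * n + 1\<close> is the
  inner product of \<open>walks n\<close> and \<open>walks (Suc n)\<close>, bounded by the two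
  neighbouring even lengths.\<close>

lemma (in generated_group) walks_decay_if_not_amenable:
  assumes "\<not> amenable G"
  shows "\<exists>y C. 1 \<le> y \<and> y < real (card J) \<and> (\<forall>n. real (walks n \<one>) \<le> C * y ^ n)"
proof -
  define c where "c = real (card J)"
  define a where "a n = real (walks (2 * n) \<one>)" for n
  obtain \<theta> :: real where \<theta>: "0 < \<theta>" "\<And>n. a (Suc n) < (c\<^sup>2 - \<theta>\<^sup>2) * a n"
    using assms kesten_criterion unfolding a_def c_def by (metis (no_types) not_le_imp_less)
  \<comment> \<open>The maximum with 1 secures \<open>1 \<le> y\<close>, at no loss because
    \<open>1 < c\<^sup>2\<close>.\<close>
  define L where "L = max (c\<^sup>2 - \<theta>\<^sup>2) 1"
  define y where "y = sqrt L"
  have y: "1 \<le> y" "y\<^sup>2 = L"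
    by (simp_all add: y_def L_def)
  have "L < c\<^sup>2"
    using two_le_card_J \<theta>(1) less_1_mult[of c c] by (auto simp: L_def c_def power2_eq_square)
  then have y_less: "y < c"
    using y by (intro power_less_imp_less_base[of y 2 c]) (auto simp: c_def)
  have a_nonneg: "0 \<le> a n" for n
    by (simp add: a_def)
  have a_le: "a n \<le> y ^ (2 * n)" for n
  proof (induction n)
    case 0
    then show ?case
      by (simp add: a_def cnt_0)
  next
    case (Suc n)
    have "a (Suc n) \<le> L * a n"
      using \<theta>(2)[of n] mult_right_mono[of "c\<^sup>2 - \<theta>\<^sup>2" L "a n"] a_nonneg[of n]
      by (auto simp: L_def)
    also have "\<dots> \<le> L * y ^ (2 * n)"
      using Suc by (intro mult_left_mono) (auto simp: L_def)
    finally show ?case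
      by (simp add: y(2)[symmetric] power2_eq_square mult.assoc)
  qed
  have odd: "real (walks (2 * n + 1) \<one>) \<le> a n + a (Suc n)" for n
  proof -
    have fin: "finite {g \<in> carrier G. real (walks n g) * real (walks m g) \<noteq> 0}" for n m
      by (rule finite_subset[OF _ finite_support_cnt[of _ n]]) auto
    have "real (walks (n + Suc n) \<one>) = (\<Sum>\<^sub>\<infinity>g\<in>carrier G. real (walks n g) * real (walks (Suc n) g))"
      by (simp only: infsum_walks_mult)
    also have "\<dots> \<le> (\<Sum>\<^sub>\<infinity>g\<in>carrier G. real (walks n g) * real (walks n g)
        + real (walks (Suc n) g) * real (walks (Suc n) g))"
    proof (rule infsum_mono)
      fix g
      show "real (walks n g) * real (walks (Suc n) g)
         \<le> real (walks n g) * real (walks n g) + real (walks (Suc n) g) * real (walks (Suc n) g)"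
        using sum_squares_bound[of "real (walks n g)" "real (walks (Suc n) g)"]
          mult_nonneg_nonneg[of "real (walks n g)" "real (walks (Suc n) g)"]
        unfolding power2_eq_square by linarith
    qed (intro summable_on_add finite_nonzero_values_imp_summable_on fin)+
    also have "\<dots> = a n + a (Suc n)"
      by (subst infsum_add)
        (simp_all add: finite_nonzero_values_imp_summable_on[OF fin] infsum_walks_mult a_def mult_2)
    finally show ?thesis
      by (simp add: mult_2)
  qed
  have "real (walks n \<one>) \<le> (1 + y) * y ^ n" for n
  proof (cases "even n")
    case True
    then obtain m where "n = 2 * m"
      by blast
    then have "real (walks n \<one>) \<le> 1 * y ^ n"
      using a_le[of m] by (simp add: a_def)
    also have "\<dots> \<le> (1 + y) * y ^ n"
      using y by (intro mult_right_mono) auto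
    finally show ?thesis .
  next
    case False
    then obtain m where m: "n = 2 * m + 1"
      using oddE by blast
    have "real (walks n \<one>) \<le> a m + a (Suc m)"
      using odd m by simp
    also have "\<dots> \<le> y ^ (2 * m) + y ^ (2 * Suc m)"
      by (intro add_mono a_le)
    also have "\<dots> \<le> y ^ n + y * y ^ n"
      using y m by (intro add_mono power_increasing) auto
    finally show ?thesis
      by (simp add: distrib_right)
  qed
  then show ?thesis
    using y(1) y_less unfolding c_def by blast
qed

section \<open>Systems of admissible words\<close>

context marked_group
begin

abbreviation reduced_walks :: "nat \<Rightarrow> 'a \<Rightarrow> nat" where
  "reduced_walks \<equiv> cnt (\<lambda>s t. t \<noteq> bar s)"

text \<open>Counts pairs of a letter \<open>s\<close> and a reduced word \<open>w\<close> such that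
  \<open>s # w\<close> has value \<open>g\<close>. Either \<open>s # w\<close> is reduced, or
  \<open>w = bar s # v\<close> and the pair cancels to \<open>v\<close>; then \<open>s\<close> may
  be any letter except \<open>hd v\<close>, and any letter at all if \<open>v\<close> is empty. This
  is the recursion for spheres in a regular tree.\<close>

lemma sum_reduced_walks:
  assumes g: "g \<in> carrier G"
  shows "(\<Sum>s\<in>J. reduced_walks n (p s \<otimes> g)) = reduced_walks (Suc n) g +
    (case n of 0 \<Rightarrow> 0 | Suc m \<Rightarrow> (if m = 0 then card J else card J - 1) * reduced_walks m g)"
proof -
  let ?W = "words (\<lambda>s t. t \<noteq> bar s)"
  define A where "A s = {w \<in> ?W n. ev w = p (bar s) \<otimes> g}" for s
  define B where "B = {(s, w) \<in> Sigma J A. s # w \<in> ?W (Suc n)}"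
  define C where "C = {(s, w) \<in> Sigma J A. s # w \<notin> ?W (Suc n)}"
  have fin: "finite (Sigma J A)"
    using finite_J by (auto simp: A_def)
  have "(\<Sum>s\<in>J. reduced_walks n (p s \<otimes> g)) = (\<Sum>s\<in>J. reduced_walks n (p (bar s) \<otimes> g))"
    by (simp add: sum_bar[of "\<lambda>s. reduced_walks n (p s \<otimes> g)"])
  also have "\<dots> = card (Sigma J A)"
    using finite_J by (simp add: cnt_def A_def)
  also have "Sigma J A = B \<union> C"
    by (auto simp: B_def C_def)
  also have "card \<dots> = card B + card C"
    by (rule card_Un_disjoint) (auto simp: B_def C_def intro: finite_subset[OF _ fin])
  also have "card B = reduced_walks (Suc n) g"
  proof -
    have "bij_betw (\<lambda>(s, w). s # w) B {w \<in> ?W (Suc n). ev w = g}"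
      unfolding bij_betw_def
    proof
      show "inj_on (\<lambda>(s, w). s # w) B"
        by (auto simp: inj_on_def)
      show "(\<lambda>(s, w). s # w) ` B = {w \<in> ?W (Suc n). ev w = g}"
      proof (intro equalityI subsetI)
        fix w assume w: "w \<in> {w \<in> ?W (Suc n). ev w = g}"
        then obtain s v where v: "w = s # v" "s \<in> J" "set v \<subseteq> J" "length v = n" "p s \<otimes> ev v = g"
          by (cases w) (auto simp: words_def)
        moreover from this have "ev v = p (bar s) \<otimes> g"
          using p_bar_cancel(1)[of s "ev v"] by simp
        ultimately have "(s, v) \<in> B"
          using w by (auto simp: words_def A_def B_def successively_Cons)
        then show "w \<in> (\<lambda>(s, w). s # w) ` B"
          using v by force
      qed (use g in \<open>auto simp: A_def B_def\<close>)
    qed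
    then show ?thesis
      by (simp add: cnt_def bij_betw_same_card)
  qed
  also have "card C = (case n of 0 \<Rightarrow> 0 | Suc m \<Rightarrow> (if m = 0 then card J else card J - 1) * reduced_walks m g)"
  proof (cases n)
    case 0
    have "C = {}"
      by (auto simp: C_def A_def 0 words_def)
    then show ?thesis
      by (simp add: 0)
  next
    case (Suc m)
    define V where "V = {v \<in> ?W m. ev v = g}"
    define S where "S v = {s \<in> J. v = [] \<or> hd v \<noteq> s}" for v
    have "bij_betw (\<lambda>(v, s). (s, bar s # v)) (Sigma V S) C"
      unfolding bij_betw_def
    proof
      show "inj_on (\<lambda>(v, s). (s, bar s # v)) (Sigma V S)"
        by (auto simp: inj_on_def)
      show "(\<lambda>(v, s). (s, bar s # v)) ` Sigma V S = C"
      proof (intro equalityI subsetI)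
        fix x assume "x \<in> C"
        then obtain s w where x: "x = (s, w)" "s \<in> J" "w \<in> ?W n" "ev w = p (bar s) \<otimes> g" "s # w \<notin> ?W (Suc n)"
          by (auto simp: C_def A_def)
        then obtain v where w: "w = bar s # v"
          using Suc by (cases w) (auto simp: words_def)
        have v: "set v \<subseteq> J"
          using x w by (auto simp: words_def)
        have "p s \<otimes> (p (bar s) \<otimes> ev v) = p s \<otimes> (p (bar s) \<otimes> g)"
          using x w by simp
        then have "ev v = g"
          using x v g by simp
        then have "(v, s) \<in> Sigma V S"
          using x w Suc by (auto simp: V_def S_def words_def successively_Cons)
        then show "x \<in> (\<lambda>(v, s). (s, bar s # v)) ` Sigma V S"
          using x w by force
      next
        fix x assume "x \<in> (\<lambda>(v, s). (s, bar s # v)) ` Sigma V S"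
        then show "x \<in> C"
          using Suc by (auto simp: C_def A_def V_def S_def words_def successively_Cons)
      qed
    qed
    then have "card C = card (Sigma V S)"
      by (simp add: bij_betw_same_card)
    also have "\<dots> = (\<Sum>v\<in>V. card (S v))"
      using finite_J by (intro card_SigmaI) (auto simp: V_def S_def)
    also have "\<dots> = (\<Sum>v\<in>V. if m = 0 then card J else card J - 1)"
    proof (intro sum.cong refl)
      fix v assume v: "v \<in> V"
      show "card (S v) = (if m = 0 then card J else card J - 1)"
      proof (cases v)
        case Nil
        then show ?thesis
          using v by (simp add: S_def V_def words_def)
      next
        case (Cons x xs)
        then have "S v = J - {x}" "x \<in> J" "m \<noteq> 0"
          using v by (auto simp: S_def V_def words_def)
        then show ?thesis
          using finite_J by simp
      qed
    qed
    finally show ?thesis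
      by (simp add: Suc cnt_def V_def)
  qed
  finally show ?thesis .
qed

end

text \<open>The connecting words have a common length \<open>gap\<close>, so that words glued by them can be recovered
  from the result.\<close>

locale transition_system = generated_group G J bar p
  for G (structure) and J :: "'i set" and bar and p :: "'i \<Rightarrow> 'a" +
  fixes r :: "'i \<Rightarrow> 'i \<Rightarrow> bool" and \<kappa> gap :: nat
  assumes card_predecessors: "y \<in> J \<Longrightarrow> card {x \<in> J. r x y} = \<kappa>"
    and connect: "x \<in> J \<Longrightarrow> y \<in> J \<Longrightarrow>
      \<exists>c. length c = gap \<and> set c \<subseteq> J \<and> ev c = \<one> \<and> successively r (x # c @ [y])"
    and reach: "g \<in> carrier G \<Longrightarrow> \<exists>u. u \<noteq> [] \<and> set u \<subseteq> J \<and> successively r u \<and> ev u = g"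
    and r_refl: "x \<in> J \<Longrightarrow> r x x"
begin

text \<open>The constant is uniform in \<open>n\<close>, so the negation yields, for every
  \<open>y\<close> in \<open>[1, \<kappa>)\<close> and every \<open>C\<close>, some length
  \<open>n\<close> with more than \<open>C * y ^ n\<close> loops.\<close>

definition loops_decay :: bool where
  "loops_decay \<longleftrightarrow> (\<exists>y C. 1 \<le> y \<and> y < real \<kappa> \<and> (\<forall>n. real (cnt r n \<one>) \<le> C * y ^ n))"

definition connector :: "'i \<Rightarrow> 'i \<Rightarrow> 'i list" where
  "connector x y = (SOME c. length c = gap \<and> set c \<subseteq> J \<and> ev c = \<one> \<and> successively r (x # c @ [y]))"

lemma connector:
  assumes "x \<in> J" "y \<in> J"
  shows "length (connector x y) = gap" "set (connector x y) \<subseteq> J" "ev (connector x y) = \<one>"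
    "successively r (x # connector x y @ [y])"
  using someI_ex[OF connect[OF assms]] by (simp_all add: connector_def)

lemma successively_connector:
  assumes "set v \<subseteq> J" "set w \<subseteq> J" "v \<noteq> []" "w \<noteq> []" "successively r v" "successively r w"
  shows "successively r (v @ connector (last v) (hd w) @ w)"
proof -
  have "last v \<in> J" "hd w \<in> J"
    using assms by (meson hd_in_set last_in_set subsetD)+
  then have "successively r (last v # connector (last v) (hd w) @ [hd w])"
    by (rule connector)
  then show ?thesis
    using assms by (auto simp: successively_append_iff successively_Cons hd_append split: if_splits)
qed

text \<open>Closing up by a connector and a fixed word for \<open>inv g\<close> is injective because
  the original word is the prefix of length \<open>n\<close>. Length 0 is left out: the connector
  starts from a last letter.\<close>

lemma cnt_le_loops:
  assumes g: "g \<in> carrier G"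
  shows "\<exists>m. \<forall>n\<ge>1. cnt r n g \<le> cnt r (n + m) \<one>"
proof -
  obtain u where u: "u \<noteq> []" "set u \<subseteq> J" "successively r u" "ev u = inv g"
    using reach[of "inv g"] g by auto
  have hd_u: "hd u \<in> J"
    using u by (meson hd_in_set subsetD)
  show ?thesis
  proof (intro exI[of _ "gap + length u"] allI impI)
    fix n :: nat assume n: "1 \<le> n"
    define \<phi> where "\<phi> w = w @ connector (last w) (hd u) @ u" for w
    show "cnt r n g \<le> cnt r (n + (gap + length u)) \<one>"
      unfolding cnt_def
    proof (rule card_inj_on_le[of \<phi>])
      show "inj_on \<phi> {w \<in> words r n. ev w = g}"
        by (auto simp: inj_on_def \<phi>_def words_def)
      show "\<phi> ` {w \<in> words r n. ev w = g} \<subseteq> {w \<in> words r (n + (gap + length u)). ev w = \<one>}"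
      proof safe
        fix w assume w: "w \<in> words r n" "g = ev w"
        then have w': "w \<noteq> []" "set w \<subseteq> J" "successively r w" "length w = n"
          using n by (auto simp: words_def)
        then have "last w \<in> J"
          by (meson last_in_set subsetD)
        note c = connector[OF this hd_u]
        show "\<phi> w \<in> words r (n + (gap + length u))"
          using successively_connector[OF w'(2) u(2) w'(1) u(1) w'(3) u(3)] c u w'
          by (auto simp: \<phi>_def words_def)
        show "ev (\<phi> w) = \<one>"
          using c u w w' by (simp add: \<phi>_def)
      qed
    qed simp
  qed
qed

lemma cnt_le_exponential:
  assumes "1 \<le> y" "\<And>n. real (cnt r n \<one>) \<le> C * y ^ n" "g \<in> carrier G"
  shows "\<exists>C'. \<forall>n. real (cnt r n g) \<le> C' * y ^ n"
proof -
  obtain m where m: "\<And>n. 1 \<le> n \<Longrightarrow> cnt r n g \<le> cnt r (n + m) \<one>"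
    using cnt_le_loops[OF assms(3)] by blast
  have "real (cnt r n g) \<le> (1 + \<bar>C\<bar> * y ^ m) * y ^ n" for n
  proof (cases "n = 0")
    case True
    then show ?thesis
      using assms(1) by (simp add: cnt_0)
  next
    case False
    then have "real (cnt r n g) \<le> real (cnt r (n + m) \<one>)"
      using m[of n] by simp
    also have "\<dots> \<le> C * y ^ (n + m)"
      by (rule assms(2))
    also have "\<dots> \<le> \<bar>C\<bar> * y ^ (n + m)"
      using assms(1) by (intro mult_right_mono) auto
    also have "\<dots> \<le> (1 + \<bar>C\<bar> * y ^ m) * y ^ n"
      using assms(1) by (simp add: power_add algebra_simps)
    finally show ?thesis .
  qed
  then show ?thesis
    by blast
qed

end

lemma summable_power_bound:
  fixes a :: "nat \<Rightarrow> real"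
  assumes "\<And>n. 0 \<le> a n" "\<And>n. a n \<le> C * y ^ n" "0 \<le> y" "0 < z" "z * y < 1"
  shows "summable (\<lambda>n. a n * z ^ n)"
proof (rule summable_comparison_test')
  show "summable (\<lambda>n. C * (z * y) ^ n)"
    using assms by (intro summable_mult summable_geometric) auto
  fix n
  have "a n * z ^ n \<le> C * y ^ n * z ^ n"
    using assms by (intro mult_right_mono) auto
  then show "norm (a n * z ^ n) \<le> C * (z * y) ^ n"
    using assms by (simp add: power_mult_distrib ac_simps)
qed

section \<open>Amenability and loops among unrestricted words\<close>

context generated_group
begin

lemma transition_system_free: "transition_system G J bar p (\<lambda>_ _. True) (card J) 0"
proof (unfold_locales)
  fix g assume g: "g \<in> carrier G"
  obtain s where s: "s \<in> J"
    using two_le_card_J by fastforce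
  obtain w where "set w \<subseteq> J" "ev w = g"
    using generated[OF g] by blast
  then show "\<exists>u. u \<noteq> [] \<and> set u \<subseteq> J \<and> successively (\<lambda>_ _. True) u \<and> ev u = g"
    using s g by (intro exI[of _ "s # bar s # w"]) auto
qed auto

lemma free_decay_if_not_amenable:
  "\<not> amenable G \<Longrightarrow> transition_system.loops_decay G J p (\<lambda>_ _. True) (card J)"
  using walks_decay_if_not_amenable
  by (simp add: transition_system.loops_decay_def[OF transition_system_free])

text \<open>\<open>h\<close> is the Green function at \<open>z = 1 / t\<close> with
  \<open>y < t < card J\<close>. The decay makes the series converge, and \<open>walks_Suc\<close>
  shifts it, so that the sum over the neighbours of \<open>g\<close> is
  \<open>t * (h g - walks 0 g)\<close>.\<close>

lemma not_amenable_if_free_decay: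
  assumes "transition_system.loops_decay G J p (\<lambda>_ _. True) (card J)"
  shows "\<not> amenable G"
proof -
  interpret F: transition_system G J bar p "\<lambda>_ _. True" "card J" 0
    by (rule transition_system_free)
  obtain y C where y: "1 \<le> y" "y < real (card J)" and C: "\<And>n. real (walks n \<one>) \<le> C * y ^ n"
    using assms unfolding F.loops_decay_def by blast
  obtain t where t: "y < t" "t < real (card J)"
    using dense[OF y(2)] by blast
  define z where "z = 1 / t"
  have z: "0 < z" "z * y < 1"
    using t y by (auto simp: z_def)
  define h where "h g = (\<Sum>n. real (walks n g) * z ^ n)" for g
  have summable: "summable (\<lambda>n. real (walks n g) * z ^ n)" if g: "g \<in> carrier G" for g
  proof -
    obtain C' where "\<And>n. real (walks n g) \<le> C' * y ^ n"
      using F.cnt_le_exponential[OF y(1) C g] by blast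
    then show ?thesis
      using y z by (intro summable_power_bound[of _ C' y]) auto
  qed
  show ?thesis
  proof (rule not_amenable_if_superharmonic[OF _ _ t(2)])
    fix g assume g: "g \<in> carrier G"
    obtain w where w: "set w \<subseteq> J" "ev w = g"
      using generated[OF g] by blast
    then have "0 < walks (length w) g"
      unfolding cnt_pos_iff by (auto simp: words_def)
    then show "0 < h g"
      unfolding h_def using z by (intro suminf_pos2[OF summable[OF g], of "length w"]) auto
    have "(\<Sum>s\<in>J. h (p s \<otimes> g)) = (\<Sum>n. \<Sum>s\<in>J. real (walks n (p s \<otimes> g)) * z ^ n)"
      unfolding h_def using g by (intro suminf_sum[symmetric] summable) auto
    also have "\<dots> = (\<Sum>n. t * (real (walks (Suc n) g) * z ^ Suc n))"
      using y t by (simp add: walks_Suc[OF g] sum_distrib_right z_def)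
    also have "\<dots> = t * (\<Sum>n. real (walks (Suc n) g) * z ^ Suc n)"
      using summable[OF g] by (intro suminf_mult) (simp only: summable_Suc_iff[of "\<lambda>n. real (walks n g) * z ^ n"])
    also have "\<dots> = t * (h g - real (walks 0 g))"
      using suminf_split_head[OF summable[OF g]] by (simp add: h_def)
    also have "\<dots> \<le> t * h g"
      using t y by (intro mult_left_mono) auto
    finally show "(\<Sum>s\<in>J. h (p s \<otimes> g)) \<le> t * h g" .
  qed
qed

lemma amenable_iff_free: "amenable G \<longleftrightarrow> \<not> transition_system.loops_decay G J p (\<lambda>_ _. True) (card J)"
  using free_decay_if_not_amenable not_amenable_if_free_decay by blast

end

section \<open>Grigorchuk's cogrowth criterion\<close>

text \<open>With the second root \<open>\<beta> = 1 / (q * \<alpha>) > \<alpha>\<close>, the defect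
  \<open>d j = u (Suc j) - \<alpha> * u j\<close> equals \<open>\<beta> ^ j * d 0\<close>. A
  negative \<open>d 0\<close> would lower \<open>u j / \<alpha> ^ j\<close> by at least a fixed
  amount in every step, against nonnegativity; hence
  \<open>\<alpha> * u j \<le> u (Suc j)\<close>.\<close>

lemma geometric_lower_bound:
  fixes u :: "nat \<Rightarrow> real"
  assumes nonneg: "\<And>j. 0 \<le> u j"
    and rec: "\<And>j. q * u (Suc (Suc j)) = (q * \<alpha> + 1 / \<alpha>) * u (Suc j) - u j"
    and \<alpha>: "0 < \<alpha>" "q * \<alpha>\<^sup>2 < 1" and q: "0 < q"
  shows "\<alpha> ^ j * u 0 \<le> u j"
proof -
  define \<beta> where "\<beta> = 1 / (q * \<alpha>)"
  have \<beta>: "0 < \<beta>" "\<alpha> < \<beta>" "q * \<alpha> * \<beta> = 1"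
    using \<alpha> q by (auto simp: \<beta>_def field_simps power2_eq_square)
  define d where "d j = u (Suc j) - \<alpha> * u j" for j
  have d_Suc: "d (Suc j) = \<beta> * d j" for j
  proof -
    have "q * d (Suc j) = (1 / \<alpha>) * d j"
      using rec[of j] \<alpha> by (simp add: d_def algebra_simps)
    then show ?thesis
      using \<alpha> q by (simp add: \<beta>_def field_simps)
  qed
  have d_eq: "d j = \<beta> ^ j * d 0" for j
    by (induction j) (simp_all add: d_Suc)
  have "0 \<le> d 0"
  proof (rule ccontr)
    assume "\<not> 0 \<le> d 0"
    then have d0: "d 0 < 0"
      by simp
    have le: "u j / \<alpha> ^ j \<le> u 0 + real j * (d 0 / \<alpha>)" for j
    proof (induction j)
      case (Suc j)
      have "\<alpha> ^ j \<le> \<beta> ^ j"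
        using \<alpha> \<beta> by (intro power_mono) auto
      then have "\<beta> ^ j * d 0 \<le> \<alpha> ^ j * d 0"
        using d0 by (simp add: mult_right_mono_neg)
      then have "d j / \<alpha> ^ Suc j \<le> \<alpha> ^ j * d 0 / \<alpha> ^ Suc j"
        using \<alpha> d_eq[of j] by (intro divide_right_mono) auto
      also have "\<dots> = d 0 / \<alpha>"
        using \<alpha> by simp
      finally have *: "d j / \<alpha> ^ Suc j \<le> d 0 / \<alpha>" .
      have "u (Suc j) / \<alpha> ^ Suc j = d j / \<alpha> ^ Suc j + u j / \<alpha> ^ j"
        using \<alpha> by (simp add: d_def field_simps)
      also have "\<dots> \<le> d 0 / \<alpha> + (u 0 + real j * (d 0 / \<alpha>))"
        using * Suc by (rule add_mono)
      finally show ?case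
        by (simp add: algebra_simps add_divide_distrib)
    qed simp
    obtain j :: nat where "real j > u 0 / (- (d 0 / \<alpha>))"
      using reals_Archimedean2 by blast
    moreover have "0 < - (d 0 / \<alpha>)"
      using d0 \<alpha> by (simp add: divide_neg_pos)
    ultimately have "u 0 < real j * - (d 0 / \<alpha>)"
      by (simp only: pos_divide_less_eq)
    then have "u 0 + real j * (d 0 / \<alpha>) < 0"
      by simp
    moreover have "0 \<le> u j / \<alpha> ^ j"
      using nonneg \<alpha> by simp
    ultimately show False
      using le[of j] by linarith
  qed
  then have "0 \<le> d j" for j
    using d_eq[of j] \<beta> by simp
  then have step: "\<alpha> * u j \<le> u (Suc j)" for j
    by (simp add: d_def)
  show ?thesis
  proof (induction j)
    case (Suc j)
    have "\<alpha> ^ Suc j * u 0 \<le> \<alpha> * u j"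
      using mult_left_mono[OF Suc, of \<alpha>] \<alpha> by (simp add: mult.assoc)
    also note step
    finally show ?case .
  qed simp
qed

text \<open>In the \<open>q + 1\<close>-regular tree, \<open>tree_walks q n j\<close> is the number of walks of length \<open>n\<close> between
  two given vertices at distance \<open>j\<close>.\<close>

fun tree_walks :: "real \<Rightarrow> nat \<Rightarrow> nat \<Rightarrow> real" where
  "tree_walks q 0 j = (if j = 0 then 1 else 0)"
| "tree_walks q (Suc n) 0 = (q + 1) * tree_walks q n 1"
| "tree_walks q (Suc n) (Suc j) = tree_walks q n j + q * tree_walks q n (Suc (Suc j))"

lemma tree_walks_nonneg: "0 \<le> q \<Longrightarrow> 0 \<le> tree_walks q n j"
  by (induction q n j rule: tree_walks.induct) auto

lemma tree_walks_eq_0: "n < j \<Longrightarrow> tree_walks q n j = 0"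
  by (induction q n j rule: tree_walks.induct) auto

lemma not_successively_split:
  "\<not> successively P xs \<Longrightarrow> \<exists>ys x y zs. xs = ys @ x # y # zs \<and> \<not> P x y"
proof (induction P xs rule: successively.induct)
  case (3 P x y xs)
  show ?case
  proof (cases "P x y")
    case True
    then obtain ys a b zs where "y # xs = ys @ a # b # zs" "\<not> P a b"
      using 3 by auto
    then show ?thesis
      by (metis append_Cons)
  next
    case False
    then show ?thesis
      by (metis append_Nil)
  qed
qed auto

text \<open>\<open>relation\<close> stands for a non-trivial element of \<open>N\<close>. Four
  letters always leave one that differs from three forbidden ones, which is the room needed for
  gluing.\<close>

locale reduced_walk_group = generated_group G J bar p
  for G (structure) and J :: "'i set" and bar and p :: "'i \<Rightarrow> 'a" +
  assumes four_le_card_J: "4 \<le> card J"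
    and bar_neq: "bar s \<noteq> s"
    and relation: "\<exists>w. w \<noteq> [] \<and> set w \<subseteq> J \<and> successively (\<lambda>s t. t \<noteq> bar s) w \<and> ev w = \<one>"
begin

abbreviation red :: "'i \<Rightarrow> 'i \<Rightarrow> bool" where
  "red \<equiv> (\<lambda>s t. t \<noteq> bar s)"

lemma exists_avoiding_three: "\<exists>t\<in>J. t \<notin> {a, b, c}"
proof (rule ccontr)
  assume "\<not> ?thesis"
  then have "J \<subseteq> {a, b, c}"
    by blast
  then have "card J \<le> card {a, b, c}"
    by (intro card_mono) auto
  also have "\<dots> \<le> 3"
    by (simp add: card_insert_if)
  finally show False
    using four_le_card_J by simp
qed

text \<open>A relation \<open>w\<close> is conjugated twice: the first conjugation brings it into the form
  \<open>s \<dots> bar s\<close>, and the second one can then avoid the two neighbours.\<close>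

lemma reduced_connector:
  assumes w: "w \<noteq> []" "set w \<subseteq> J" "successively red w" "ev w = \<one>"
    and xy: "x \<in> J" "y \<in> J"
  shows "\<exists>c. length c = length w + 4 \<and> set c \<subseteq> J \<and> ev c = \<one> \<and> successively red (x # c @ [y])"
proof -
  \<comment> \<open>\<open>s\<close> keeps \<open>s # w\<close> and \<open>w @ [bar s]\<close>
    reduced; only two letters are forbidden, hence the repetition. The letter \<open>t\<close> has
    to fit \<open>s\<close> and the outer neighbours \<open>x\<close> and \<open>y\<close>.\<close>
  obtain s where s: "s \<in> J" "s \<notin> {bar (hd w), last w, last w}"
    using exists_avoiding_three by blast
  obtain t where t: "t \<in> J" "t \<notin> {bar s, bar x, y}"
    using exists_avoiding_three by blast
  have "hd w \<noteq> bar s"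
    using s by auto
  moreover have "bar t \<noteq> s"
    using t by auto
  moreover have "bar s \<noteq> bar (last w)"
    using s bar_bar by (metis insertCI)
  ultimately have "successively red (x # (t # s # w @ [bar s, bar t]) @ [y])"
    using w s t by (auto simp: successively_append_iff successively_Cons)
  moreover have "ev (t # s # w @ [bar s, bar t]) = \<one>"
    using w s t p_bar_cancel(2)[of s "p (bar t) \<otimes> \<one>"] p_bar_cancel(2)[of t "\<one>"] by simp
  ultimately show ?thesis
    using w s t by (intro exI[of _ "t # s # w @ [bar s, bar t]"]) auto
qed

text \<open>A shortest word for \<open>g\<close> has no cancelling pair. For \<open>\<one>\<close>
  it would be empty, so the relation serves instead.\<close>

lemma reduced_representative:
  assumes g: "g \<in> carrier G"
  shows "\<exists>u. u \<noteq> [] \<and> set u \<subseteq> J \<and> successively red u \<and> ev u = g"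
proof (cases "g = \<one>")
  case True
  then show ?thesis
    using relation by simp
next
  case False
  define P where "P u \<longleftrightarrow> set u \<subseteq> J \<and> ev u = g" for u
  define u where "u = arg_min length P"
  have "\<exists>u. P u"
    using generated[OF g] by (simp add: P_def)
  then have u: "P u" "\<And>v. P v \<Longrightarrow> length u \<le> length v"
    unfolding u_def using arg_min_nat_lemma[of P _ length] by blast+
  have "successively red u"
  proof (rule ccontr)
    assume "\<not> successively red u"
    then obtain ys x y zs where "u = ys @ x # y # zs" "y = bar x"
      using not_successively_split by blast
    moreover from this have "P (ys @ zs)"
      using u(1) by (auto simp: P_def)
    ultimately show False
      using u(2)[of "ys @ zs"] by simp
  qed
  then show ?thesis
    using u(1) False by (intro exI[of _ u]) (auto simp: P_def)
qed

lemma transition_system_reduced: "\<exists>gap. transition_system G J bar p red (card J - 1) gap"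
proof -
  obtain w where w: "w \<noteq> []" "set w \<subseteq> J" "successively red w" "ev w = \<one>"
    using relation by blast
  have "transition_system G J bar p red (card J - 1) (length w + 4)"
  proof (unfold_locales)
    fix y assume y: "y \<in> J"
    have "{x \<in> J. y \<noteq> bar x} = J - {bar y}"
      by auto
    then show "card {x \<in> J. y \<noteq> bar x} = card J - 1"
      using y finite_J by simp
  qed (use reduced_connector[OF w] reduced_representative bar_neq in \<open>simp_all add: eq_commute\<close>)
  then show ?thesis
    by blast
qed

abbreviation q :: real where
  "q \<equiv> real (card J) - 1"

lemma q_ge: "3 \<le> q"
  using four_le_card_J by simp

lemma sum_reduced_walks_real:
  assumes "g \<in> carrier G"
  shows "(\<Sum>s\<in>J. real (reduced_walks n (p s \<otimes> g))) = real (reduced_walks (Suc n) g)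
    + (case n of 0 \<Rightarrow> 0 | Suc m \<Rightarrow> (if m = 0 then q + 1 else q) * real (reduced_walks m g))"
proof -
  have "(\<Sum>s\<in>J. real (reduced_walks n (p s \<otimes> g))) = real (\<Sum>s\<in>J. reduced_walks n (p s \<otimes> g))"
    by simp
  also note sum_reduced_walks[OF assms]
  finally show ?thesis
    using four_le_card_J by (simp add: of_nat_diff split: nat.split)
qed

text \<open>A word with value \<open>g\<close> is a walk in the tree that ends in the vertex of some
  reduced word with value \<open>g\<close>, and the number of walks to a vertex depends only on its
  distance \<open>j\<close> from the root. Any \<open>K > n\<close> is allowed since the
  coefficients vanish beyond \<open>n\<close>; so the induction can keep one
  \<open>K\<close>.\<close>

lemma walks_eq_sum_reduced_walks:
  assumes "g \<in> carrier G" "n < K"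
  shows "real (walks n g) = (\<Sum>j<K. tree_walks q n j * real (reduced_walks j g))"
  using assms
proof (induction n arbitrary: g K)
  case 0
  have "(\<Sum>j<K. tree_walks q 0 j * real (reduced_walks j g)) = (\<Sum>j\<in>{0}. tree_walks q 0 j * real (reduced_walks j g))"
    using 0 by (intro sum.mono_neutral_right) auto
  then show ?case
    by (simp add: cnt_0)
next
  case (Suc n)
  let ?N = "tree_walks q n" and ?R = "\<lambda>j. real (reduced_walks j g)"
  obtain K' where K: "K = Suc (Suc K')" "n \<le> K'"
    using Suc.prems that[of "K - 2"] by auto
  have zero: "?N (Suc K') = 0" "?N (Suc (Suc K')) = 0"
    using K by (auto intro!: tree_walks_eq_0)
  have "real (walks (Suc n) g) = (\<Sum>s\<in>J. real (walks n (p s \<otimes> g)))"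
    by (simp add: walks_Suc Suc.prems)
  also have "\<dots> = (\<Sum>s\<in>J. \<Sum>j<K. ?N j * real (reduced_walks j (p s \<otimes> g)))"
    using Suc.prems K by (intro sum.cong refl Suc.IH) auto
  also have "\<dots> = (\<Sum>j<K. ?N j * (\<Sum>s\<in>J. real (reduced_walks j (p s \<otimes> g))))"
    by (subst sum.swap) (simp add: sum_distrib_left)
  also have "\<dots> = (\<Sum>j<K. ?N j * (?R (Suc j)
      + (case j of 0 \<Rightarrow> 0 | Suc m \<Rightarrow> (if m = 0 then q + 1 else q) * ?R m)))"
    by (simp add: sum_reduced_walks_real Suc.prems)
  also have "\<dots> = (\<Sum>j<K. ?N j * ?R (Suc j))
      + (\<Sum>j<Suc K'. ?N (Suc j) * ((if j = 0 then q + 1 else q) * ?R j))"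
    unfolding distrib_left sum.distrib K(1) sum.lessThan_Suc_shift[of _ "Suc K'"] by simp
  also have "\<dots> = (\<Sum>j<Suc K'. ?N j * ?R (Suc j))
      + ((q + 1) * ?N 1 * ?R 0 + (\<Sum>j<K'. q * ?N (Suc (Suc j)) * ?R (Suc j)))"
  proof -
    have "(\<Sum>j<K. ?N j * ?R (Suc j)) = (\<Sum>j<Suc K'. ?N j * ?R (Suc j))"
      by (simp add: K(1) zero)
    moreover have "(\<Sum>j<Suc K'. ?N (Suc j) * ((if j = 0 then q + 1 else q) * ?R j))
        = (q + 1) * ?N 1 * ?R 0 + (\<Sum>j<K'. q * ?N (Suc (Suc j)) * ?R (Suc j))"
      by (subst sum.lessThan_Suc_shift) (simp add: ac_simps)
    ultimately show ?thesis
      by simp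
  qed
  also have "(\<Sum>j<K'. q * ?N (Suc (Suc j)) * ?R (Suc j)) = (\<Sum>j<Suc K'. q * ?N (Suc (Suc j)) * ?R (Suc j))"
    by (simp add: zero)
  also have "(\<Sum>j<Suc K'. ?N j * ?R (Suc j))
      + ((q + 1) * ?N 1 * ?R 0 + (\<Sum>j<Suc K'. q * ?N (Suc (Suc j)) * ?R (Suc j)))
    = (\<Sum>j<K. tree_walks q (Suc n) j * ?R j)"
    unfolding K(1) sum.lessThan_Suc_shift[of _ "Suc K'"] by (simp add: sum.distrib distrib_right)
  finally show ?case .
qed

lemma tree_walks_mult_le:
  assumes "g \<in> carrier G"
  shows "tree_walks q n j * real (reduced_walks j g) \<le> real (walks n g)"
proof -
  have "tree_walks q n j * real (reduced_walks j g)
      \<le> (\<Sum>j<Suc (n + j). tree_walks q n j * real (reduced_walks j g))"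
    using q_ge by (intro member_le_sum[of j "{..<Suc (n + j)}" "\<lambda>j. tree_walks q n j * real (reduced_walks j g)"])
      (auto intro!: mult_nonneg_nonneg tree_walks_nonneg)
  then show ?thesis
    using walks_eq_sum_reduced_walks[OF assms, of n "Suc (n + j)"] by simp
qed

text \<open>The numbers \<open>u j = (\<Sum>n. tree_walks q n j * z ^ n)\<close> satisfy a linear recursion whose
  characteristic polynomial has the roots \<open>\<alpha>\<close> and \<open>1 / (q * \<alpha>)\<close>. Positivity forces \<open>u j \<ge> \<alpha> ^ j\<close>,
  which bounds the number of reduced loops by the generating function of all loops.\<close>

lemma reduced_decay_if_not_amenable:
  assumes "\<not> amenable G"
  shows "\<exists>y C. 1 \<le> y \<and> y < q \<and> (\<forall>n. real (reduced_walks n \<one>) \<le> C * y ^ n)"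
proof -
  interpret F: transition_system G J bar p "\<lambda>_ _. True" "card J" 0
    by (rule transition_system_free)
  obtain y C where y: "1 \<le> y" "y < q + 1" and C: "\<And>n. real (walks n \<one>) \<le> C * y ^ n"
    using walks_decay_if_not_amenable[OF assms] by auto
  have q: "0 < q" "1 < q"
    using q_ge by auto
  \<comment> \<open>At \<open>\<alpha> = 1 / q\<close> this expression is \<open>q + 1 > y\<close>,
    and \<open>q * \<alpha>\<^sup>2\<close> is \<open>1 / q < 1\<close>. Both inequalities persist
    slightly to the right, where the final rate \<open>1 / \<alpha>\<close> drops below
    \<open>q\<close>.\<close>
  have "eventually (\<lambda>\<alpha>. y < q * \<alpha> + 1 / \<alpha>) (at_right (1 / q))"
    using y q by (intro order_tendstoD(1)[where y = "q * (1 / q) + 1 / (1 / q)"] tendsto_intros) auto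
  moreover have "eventually (\<lambda>\<alpha>. q * \<alpha>\<^sup>2 < 1) (at_right (1 / q))"
    using q by (intro order_tendstoD(2)[where y = "q * (1 / q)\<^sup>2"] tendsto_intros)
      (auto simp: power2_eq_square)
  moreover have "eventually (\<lambda>\<alpha>. \<alpha> \<in> {1 / q<..<1}) (at_right (1 / q))"
    using q by (intro eventually_at_rightI[of _ 1]) auto
  ultimately have "eventually (\<lambda>\<alpha>. y < q * \<alpha> + 1 / \<alpha> \<and> q * \<alpha>\<^sup>2 < 1 \<and> \<alpha> \<in> {1 / q<..<1}) (at_right (1 / q))"
    by eventually_elim simp
  then obtain \<alpha> where \<alpha>: "y < q * \<alpha> + 1 / \<alpha>" "q * \<alpha>\<^sup>2 < 1" "1 / q < \<alpha>" "\<alpha> < 1"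
    by (metis (no_types, lifting) eventually_happens greaterThanLessThan_iff trivial_limit_at_right_real)
  have \<alpha>0: "0 < \<alpha>"
    using \<alpha>(3) q by (meson divide_pos_pos less_trans zero_less_one)
  define t where "t = q * \<alpha> + 1 / \<alpha>"
  define z where "z = 1 / t"
  have t: "y < t"
    using \<alpha> by (simp add: t_def)
  have z: "0 < z" "z * y < 1" "t * z = 1"
    using t y by (auto simp: z_def)
  have N0: "0 \<le> tree_walks q n j" for n j
    using q by (intro tree_walks_nonneg) simp
  have summable_walks: "summable (\<lambda>n. real (walks n g) * z ^ n)" if g: "g \<in> carrier G" for g
  proof -
    obtain C' where "\<And>n. real (walks n g) \<le> C' * y ^ n"
      using F.cnt_le_exponential[OF y(1) C g] by blast
    then show ?thesis
      using y z by (intro summable_power_bound[of _ C' y]) auto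
  qed
  have summable: "summable (\<lambda>n. tree_walks q n j * z ^ n)" for j
  proof -
    obtain s where s: "s \<in> J"
      using two_le_card_J by fastforce
    \<comment> \<open>A power of one letter is reduced because \<open>bar s \<noteq> s\<close>. Its
      value has a reduced word of length \<open>j\<close>, so tree walks to distance
      \<open>j\<close> are dominated by the walks to that value.\<close>
    define w where "w = replicate j s"
    have w: "set w \<subseteq> J" "w \<in> words red j"
      using s bar_neq[of s] by (auto simp: w_def words_def successively_conv_nth)
    then have pos: "0 < reduced_walks j (ev w)"
      unfolding cnt_pos_iff by blast
    show ?thesis
    proof (rule summable_comparison_test')
      show "summable (\<lambda>n. real (walks n (ev w)) * z ^ n)"
        using w by (intro summable_walks) simp
      fix n
      have "tree_walks q n j * 1 \<le> tree_walks q n j * real (reduced_walks j (ev w))"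
        using pos by (intro mult_left_mono N0) auto
      also have "\<dots> \<le> real (walks n (ev w))"
        using w by (intro tree_walks_mult_le) simp
      finally show "norm (tree_walks q n j * z ^ n) \<le> real (walks n (ev w)) * z ^ n"
        using z N0 by (simp add: abs_mult mult_right_mono)
    qed
  qed
  define u where "u j = (\<Sum>n. tree_walks q n j * z ^ n)" for j
  have u_nonneg: "0 \<le> u j" for j
    unfolding u_def using z by (intro suminf_nonneg summable mult_nonneg_nonneg N0) auto
  have u_0: "1 \<le> u 0"
    using sum_le_suminf[OF summable[of 0], of "{0}"] z N0 by (simp add: u_def)
  \<comment> \<open>\<open>tree_walks q 0 (Suc j) = 0\<close>, so splitting off the first term of
    the series leaves no inhomogeneous part; \<open>t\<close> is \<open>q\<close> times the sum of
    the two intended roots.\<close>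
  have u_rec: "q * u (Suc (Suc j)) = (q * \<alpha> + 1 / \<alpha>) * u (Suc j) - u j" for j
  proof -
    have "u (Suc j) = (\<Sum>n. tree_walks q (Suc n) (Suc j) * z ^ Suc n)"
      using suminf_split_head[OF summable[of "Suc j"]] by (simp add: u_def)
    also have "\<dots> = (\<Sum>n. z * (tree_walks q n j * z ^ n) + z * q * (tree_walks q n (Suc (Suc j)) * z ^ n))"
      by (simp add: algebra_simps)
    also have "\<dots> = z * u j + z * q * u (Suc (Suc j))"
      unfolding u_def by (subst suminf_add[symmetric]) (auto intro!: summable_mult summable simp: suminf_mult[OF summable])
    finally have "u (Suc j) = z * (u j + q * u (Suc (Suc j)))"
      by (simp only: distrib_left mult.assoc)
    then have "t * u (Suc j) = u j + q * u (Suc (Suc j))"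
      by (simp only: z(3) mult_1_left flip: mult.assoc)
    then show ?thesis
      unfolding t_def by linarith
  qed
  have u_ge: "\<alpha> ^ j \<le> u j" for j
  proof -
    have "\<alpha> ^ j * 1 \<le> \<alpha> ^ j * u 0"
      using u_0 \<alpha>0 by (intro mult_left_mono) auto
    also have "\<dots> \<le> u j"
      by (rule geometric_lower_bound[where u = u, OF u_nonneg u_rec \<alpha>0 \<alpha>(2) q(1)])
    finally show ?thesis
      by simp
  qed
  define H where "H = (\<Sum>n. real (walks n \<one>) * z ^ n)"
  have "real (reduced_walks j \<one>) \<le> H * (1 / \<alpha>) ^ j" for j
  proof -
    have "real (reduced_walks j \<one>) * \<alpha> ^ j \<le> real (reduced_walks j \<one>) * u j"
      by (intro mult_left_mono u_ge) simp
    also have "\<dots> = (\<Sum>n. real (reduced_walks j \<one>) * (tree_walks q n j * z ^ n))"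
      unfolding u_def by (rule suminf_mult[OF summable, symmetric])
    also have "\<dots> \<le> H"
      unfolding H_def
    proof (intro suminf_le summable_mult summable summable_walks one_closed)
      fix n
      show "real (reduced_walks j \<one>) * (tree_walks q n j * z ^ n) \<le> real (walks n \<one>) * z ^ n"
        using mult_right_mono[OF tree_walks_mult_le[OF one_closed, of n j], of "z ^ n"] z
        by (simp add: ac_simps)
    qed
    finally show ?thesis
      using \<alpha>0 by (simp add: power_one_over field_simps)
  qed
  moreover have "1 \<le> 1 / \<alpha>" "1 / \<alpha> < q"
    using \<alpha> \<alpha>0 q by (auto simp: field_simps)
  ultimately show ?thesis
    by blast
qed

text \<open>The series with weight \<open>\<alpha>\<close>, \<open>1 / q < \<alpha> < 1 / y\<close>,
  converges, and \<open>sum_reduced_walks\<close> makes it superharmonic with factor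
  \<open>1 / \<alpha> + q * \<alpha>\<close>. This equals \<open>q + 1\<close> at
  \<open>\<alpha> = 1 / q\<close> and at \<open>\<alpha> = 1\<close> and is smaller in
  between.\<close>

lemma not_amenable_if_reduced_decay:
  assumes y: "1 \<le> y" "y < q" and C: "\<And>n. real (reduced_walks n \<one>) \<le> C * y ^ n"
  shows "\<not> amenable G"
proof -
  obtain gap where "transition_system G J bar p red (card J - 1) gap"
    using transition_system_reduced by blast
  then interpret T: transition_system G J bar p red "card J - 1" gap .
  have q: "0 < q" "1 < q"
    using q_ge by auto
  obtain \<alpha> where \<alpha>: "1 / q < \<alpha>" "\<alpha> < 1 / y"
    using dense[of "1 / q" "1 / y"] y q by (auto simp: frac_less2)
  have \<alpha>0: "0 < \<alpha>"
    using \<alpha>(1) q by (meson divide_pos_pos less_trans zero_less_one)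
  have \<alpha>y: "\<alpha> * y < 1"
    using \<alpha> y by (simp add: field_simps)
  have \<alpha>1: "\<alpha> < 1"
    using \<alpha>y mult_left_mono[OF y(1), of \<alpha>] \<alpha>0 by linarith
  define h where "h g = (\<Sum>n. real (reduced_walks n g) * \<alpha> ^ n)" for g
  have summable: "summable (\<lambda>n. real (reduced_walks n g) * \<alpha> ^ n)" if g: "g \<in> carrier G" for g
  proof -
    obtain C' where "\<And>n. real (reduced_walks n g) \<le> C' * y ^ n"
      using T.cnt_le_exponential[OF y(1) C g] by blast
    then show ?thesis
      using y \<alpha>0 \<alpha>y by (intro summable_power_bound[of _ C' y]) auto
  qed
  show ?thesis
  proof (rule not_amenable_if_superharmonic)
    have "(\<alpha> - 1) * (q * \<alpha> - 1) < 0"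
      using \<alpha> \<alpha>1 q by (intro mult_neg_pos) (auto simp: field_simps)
    then have "q * \<alpha>\<^sup>2 + 1 < (q + 1) * \<alpha>"
      by (simp add: algebra_simps power2_eq_square)
    then show "1 / \<alpha> + q * \<alpha> < real (card J)"
      using \<alpha>0 by (simp add: field_simps power2_eq_square)
    fix g assume g: "g \<in> carrier G"
    let ?R = "\<lambda>n. real (reduced_walks n g)"
    obtain w where w: "set w \<subseteq> J" "successively red w" "ev w = g"
      using reduced_representative[OF g] by blast
    then have "0 < reduced_walks (length w) g"
      unfolding cnt_pos_iff by (auto simp: words_def)
    then show "0 < h g"
      unfolding h_def using \<alpha>0 by (intro suminf_pos2[OF summable[OF g], of "length w"]) auto
    have h_sums: "(\<lambda>n. ?R n * \<alpha> ^ n) sums h g"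
      unfolding h_def using summable[OF g] by (rule summable_sums)
    have "(\<lambda>n. ?R (Suc n) * \<alpha> ^ Suc n) sums (h g - ?R 0)"
      using h_sums by (subst sums_Suc_iff) simp
    from sums_mult[OF this, of "1 / \<alpha>"]
    have up: "(\<lambda>n. ?R (Suc n) * \<alpha> ^ n) sums ((h g - ?R 0) / \<alpha>)"
      using \<alpha>0 by (simp add: mult.left_commute)
    define D where "D n = (case n of 0 \<Rightarrow> 0 | Suc m \<Rightarrow> (if m = 0 then q + 1 else q) * ?R m) * \<alpha> ^ n" for n
    \<comment> \<open>The summand \<open>\<alpha> * ?R 0\<close> accounts for the factor
      \<open>q + 1\<close>, in place of \<open>q\<close>, of cancellations to the empty
      word.\<close>
    have "(\<lambda>m. q * \<alpha> * (?R m * \<alpha> ^ m) + (if m = 0 then \<alpha> * ?R 0 else 0)) sums (q * \<alpha> * h g + \<alpha> * ?R 0)"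
      by (intro sums_add sums_mult h_sums sums_single)
    moreover have "(\<lambda>m. q * \<alpha> * (?R m * \<alpha> ^ m) + (if m = 0 then \<alpha> * ?R 0 else 0)) = (\<lambda>m. D (Suc m))"
      by (auto simp: D_def fun_eq_iff algebra_simps)
    ultimately have "(\<lambda>m. D (Suc m)) sums (q * \<alpha> * h g + \<alpha> * ?R 0)"
      by simp
    from sums_Suc[OF this] have down: "D sums (q * \<alpha> * h g + \<alpha> * ?R 0)"
      by (simp add: D_def[abs_def])
    have "(\<Sum>s\<in>J. h (p s \<otimes> g)) = (\<Sum>n. \<Sum>s\<in>J. real (reduced_walks n (p s \<otimes> g)) * \<alpha> ^ n)"
      unfolding h_def using g by (intro suminf_sum[symmetric] summable) auto
    also have "\<dots> = (\<Sum>n. ?R (Suc n) * \<alpha> ^ n + D n)"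
      by (simp add: sum_reduced_walks_real[OF g] distrib_right D_def flip: sum_distrib_right)
    also have "\<dots> = (h g - ?R 0) / \<alpha> + (q * \<alpha> * h g + \<alpha> * ?R 0)"
      by (intro sums_unique[symmetric] sums_add up down)
    also have "\<dots> = (1 / \<alpha> + q * \<alpha>) * h g - (1 / \<alpha> - \<alpha>) * ?R 0"
      by (simp add: algebra_simps diff_divide_distrib)
    also have "\<dots> \<le> (1 / \<alpha> + q * \<alpha>) * h g"
    proof -
      have "1 \<le> 1 / \<alpha>"
        using \<alpha>0 \<alpha>1 by simp
      then have "0 \<le> (1 / \<alpha> - \<alpha>) * ?R 0"
        using \<alpha>1 by (intro mult_nonneg_nonneg) auto
      then show ?thesis
        by simp
    qed
    finally show "(\<Sum>s\<in>J. h (p s \<otimes> g)) \<le> (1 / \<alpha> + q * \<alpha>) * h g" .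
  qed
qed

lemma amenable_iff_reduced:
  assumes "transition_system G J bar p red (card J - 1) gap"
  shows "amenable G \<longleftrightarrow> \<not> transition_system.loops_decay G J p red (card J - 1)"
proof -
  have "real (card J - 1) = q"
    using four_le_card_J by (simp add: of_nat_diff)
  then show ?thesis
    using reduced_decay_if_not_amenable not_amenable_if_reduced_decay
    unfolding transition_system.loops_decay_def[OF assms] by metis
qed

end

section \<open>Pressure\<close>

lemma log_card_mono:
  assumes "X \<subseteq> Y"
  shows "log_card X \<le> log_card Y"
proof (cases "finite Y \<and> X \<noteq> {}")
  case True
  then have "finite X" "X \<noteq> {}" "Y \<noteq> {}"
    using assms finite_subset by blast+
  moreover from this have "0 < card X" "card X \<le> card Y"
    using True assms by (auto simp: card_gt_0_iff intro: card_mono)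
  ultimately show ?thesis
    using True by (simp add: log_card_def)
qed (auto simp: log_card_def)

lemma pressure_mono:
  assumes "D \<subseteq> E"
  shows "pressure \<eta> D \<le> pressure \<eta> E"
  unfolding pressure_def
proof (rule Limsup_mono)
  show "\<forall>\<^sub>F T in at_top. ereal (1 / T) * log_card {w \<in> D. T - \<eta> < real (length w) \<and> real (length w) \<le> T}
      \<le> ereal (1 / T) * log_card {w \<in> E. T - \<eta> < real (length w) \<and> real (length w) \<le> T}"
    using eventually_gt_at_top[of "0 :: real"]
  proof eventually_elim
    case (elim T)
    have "{w \<in> D. T - \<eta> < real (length w) \<and> real (length w) \<le> T}
        \<subseteq> {w \<in> E. T - \<eta> < real (length w) \<and> real (length w) \<le> T}"
      using assms by auto
    then show ?case
      using elim by (intro ereal_mult_left_mono log_card_mono) auto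
  qed
qed

text \<open>All lengths in a window are at most \<open>T\<close>, so it holds at most
  \<open>(T + 1) * (B * y powr T)\<close> words whatever \<open>\<eta>\<close> is; the linear factor
  disappears when the logarithm is divided by \<open>T\<close>.\<close>

lemma pressure_le_if_exponential:
  assumes y: "1 \<le> y"
    and fin: "\<And>n. finite {w \<in> D. length w = n}"
    and card: "\<And>n. real (card {w \<in> D. length w = n}) \<le> C * y ^ n"
  shows "pressure \<eta> D \<le> ereal (ln y)"
proof -
  define B where "B = max C 1"
  have B: "1 \<le> B" "real (card {w \<in> D. length w = n}) \<le> B * y ^ n" for n
    using order_trans[OF card[of n] mult_right_mono[of C B "y ^ n"]] y by (auto simp: B_def)
  let ?W = "\<lambda>T::real. {w \<in> D. T - \<eta> < real (length w) \<and> real (length w) \<le> T}"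
  have bound: "ereal (1 / T) * log_card (?W T) \<le> ereal (ln ((T + 1) * B) / T + ln y)" if T: "1 \<le> T" for T
  proof (cases "?W T = {}")
    case True
    then show ?thesis
      using T by (simp add: log_card_def del: Collect_empty_eq)
  next
    case False
    define m where "m = nat \<lfloor>T\<rfloor>"
    have m: "real m \<le> T"
      using T by (simp add: m_def)
    have sub: "?W T \<subseteq> (\<Union>n\<in>{..m}. {w \<in> D. length w = n})"
      by (auto simp: m_def le_nat_floor)
    have fin_W: "finite (?W T)"
      by (rule finite_subset[OF sub]) (auto intro: fin)
    then have pos: "0 < card (?W T)"
      using False by (simp add: card_gt_0_iff)
    have "card (?W T) \<le> (\<Sum>n\<le>m. card {w \<in> D. length w = n})"
      by (rule order_trans[OF card_mono[OF _ sub] card_UN_le]) (auto intro: fin)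
    then have "real (card (?W T)) \<le> (\<Sum>n\<le>m. real (card {w \<in> D. length w = n}))"
      unfolding of_nat_sum[symmetric] of_nat_le_iff .
    also have "\<dots> \<le> (\<Sum>n\<le>m. B * y ^ m)"
    proof (rule sum_mono)
      fix n assume "n \<in> {..m}"
      then have "B * y ^ n \<le> B * y ^ m"
        using y B by (intro mult_left_mono power_increasing) auto
      then show "real (card {w \<in> D. length w = n}) \<le> B * y ^ m"
        using B(2)[of n] by linarith
    qed
    also have "\<dots> = (real m + 1) * (B * y ^ m)"
      by simp
    also have "\<dots> \<le> (T + 1) * (B * y powr T)"
    proof -
      have "y ^ m = y powr real m"
        using y by (simp add: powr_realpow)
      also have "\<dots> \<le> y powr T"
        using y m by (intro powr_mono) auto
      finally show ?thesis
        using m y B T by (intro mult_mono) auto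
    qed
    finally have "ln (real (card (?W T))) \<le> ln ((T + 1) * (B * y powr T))"
      using pos y B T by (subst ln_le_cancel_iff) auto
    also have "\<dots> = ln ((T + 1) * B) + T * ln y"
      using T y B by (simp add: ln_mult ln_powr)
    finally have "ln (real (card (?W T))) / T \<le> (ln ((T + 1) * B) + T * ln y) / T"
      using T by (intro divide_right_mono) auto
    also have "\<dots> = ln ((T + 1) * B) / T + ln y"
      using T by (simp add: add_divide_distrib)
    finally show ?thesis
      using fin_W False by (simp add: log_card_def del: Collect_empty_eq)
  qed
  have "((\<lambda>T::real. ln ((T + 1) * B) / T) \<longlongrightarrow> 0) at_top"
    using B(1) by real_asymp
  from tendsto_add[OF this tendsto_const[of "ln y"]]
  have "((\<lambda>T. ereal (ln ((T + 1) * B) / T + ln y)) \<longlongrightarrow> ereal (ln y)) at_top"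
    by simp
  then have "Limsup at_top (\<lambda>T::real. ereal (ln ((T + 1) * B) / T + ln y)) = ereal (ln y)"
    by (intro lim_imp_Limsup) auto
  moreover have "pressure \<eta> D \<le> Limsup at_top (\<lambda>T::real. ereal (ln ((T + 1) * B) / T + ln y))"
    unfolding pressure_def
    using eventually_ge_at_top[of "1 :: real"] by (intro Limsup_mono) (elim eventually_mono, rule bound)
  ultimately show ?thesis
    by simp
qed

text \<open>For integer \<open>T = n\<close> the window contains the length \<open>n\<close> because
  \<open>\<eta> > 0\<close>, and an eventual bound over real \<open>T\<close> holds in particular
  along the integers.\<close>

lemma exponential_if_pressure_less:
  assumes "pressure \<eta> D < ereal (ln y)" "0 < y" "0 < \<eta>"
  shows "eventually (\<lambda>n. real (card {w \<in> D. length w = n}) \<le> y ^ n) sequentially"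
proof -
  let ?W = "\<lambda>T::real. {w \<in> D. T - \<eta> < real (length w) \<and> real (length w) \<le> T}"
  have "eventually (\<lambda>T. ereal (1 / T) * log_card (?W T) < ereal (ln y)) at_top"
    using assms(1) unfolding pressure_def by (rule Limsup_lessD)
  then have "eventually (\<lambda>n. ereal (1 / real n) * log_card (?W (real n)) < ereal (ln y)) sequentially"
    using filterlim_real_sequentially by (rule eventually_compose_filterlim)
  then show ?thesis
    using eventually_gt_at_top[of 0]
  proof eventually_elim
    case (elim n)
    have sub: "{w \<in> D. length w = n} \<subseteq> ?W (real n)"
      using assms(3) by auto
    show ?case
    proof (cases "{w \<in> D. length w = n} = {}")
      case True
      then show ?thesis
        unfolding True using assms(2) by simp
    next
      case False
      then have ne: "?W (real n) \<noteq> {}"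
        using sub by blast
      have fin: "finite (?W (real n))"
        using elim by (auto simp: log_card_def split: if_splits)
      then have pos: "0 < card (?W (real n))"
        using ne by (simp add: card_gt_0_iff)
      have "ln (real (card (?W (real n)))) / real n < ln y"
        using elim fin ne by (simp add: log_card_def del: Collect_empty_eq)
      then have "ln (real (card (?W (real n)))) < ln (y ^ n)"
        using elim assms(2) by (simp add: ln_realpow field_simps)
      then have "real (card (?W (real n))) < y ^ n"
        using pos assms(2) by (subst (asm) ln_less_cancel_iff) auto
      moreover have "card {w \<in> D. length w = n} \<le> card (?W (real n))"
        by (rule card_mono[OF fin sub])
      ultimately show ?thesis
        by linarith
    qed
  qed
qed

text \<open>Large counts at infinitely many lengths suffice because the pressure is an upper
  limit.\<close>

lemma ln_le_pressure_if_frequently: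
  assumes "0 < y" "0 < \<eta>" "\<And>N. \<exists>n\<ge>N. y ^ n \<le> real (card {w \<in> D. length w = n})"
  shows "ereal (ln y) \<le> pressure \<eta> D"
proof (rule ccontr)
  assume "\<not> ereal (ln y) \<le> pressure \<eta> D"
  then obtain x where x: "pressure \<eta> D < ereal x" "x < ln y"
    using ereal_dense2[of "pressure \<eta> D" "ereal (ln y)"] by (auto simp: not_le)
  have "exp x < y"
    using x(2) assms(1) by (metis exp_less_cancel_iff exp_ln)
  have "eventually (\<lambda>n. real (card {w \<in> D. length w = n}) \<le> exp x ^ n) sequentially"
    using x(1) assms(2) by (intro exponential_if_pressure_less) auto
  then obtain N where N: "\<And>n. N \<le> n \<Longrightarrow> real (card {w \<in> D. length w = n}) \<le> exp x ^ n"
    by (auto simp: eventually_sequentially)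
  obtain n where n: "n \<ge> Suc N" "y ^ n \<le> real (card {w \<in> D. length w = n})"
    using assms(3) by blast
  have "exp x ^ n < y ^ n"
    using n(1) \<open>exp x < y\<close> by (intro power_strict_mono) auto
  then show False
    using N[of n] n by linarith
qed

section \<open>Shift spaces over group extensions\<close>

lemma compactin_markov_shift:
  assumes "finite B" "B \<subseteq> A"
  shows "compactin (shift_topology A R) {x \<in> markov_shift A R. \<forall>n. x n \<in> B}"
proof -
  let ?T = "product_topology (\<lambda>_::nat. discrete_topology A) UNIV"
  define S where "S = {(a, b) \<in> A \<times> A. R a b}"
  have comp: "compactin ?T (PiE UNIV (\<lambda>_. B))"
    using assms by (subst compactin_PiE) (auto simp: compactin_discrete_topology)
  have "closedin ?T {x \<in> topspace ?T. (x n, x (Suc n)) \<in> S}" for n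
  proof (rule closedin_continuous_map_preimage)
    show "continuous_map ?T (prod_topology (discrete_topology A) (discrete_topology A)) (\<lambda>x. (x n, x (Suc n)))"
      by (intro continuous_map_pairedI continuous_map_product_projection) auto
    show "closedin (prod_topology (discrete_topology A) (discrete_topology A)) S"
      unfolding prod_topology_discrete_topology[symmetric] closedin_discrete_topology S_def by auto
  qed
  then have "closedin ?T (\<Inter>n. {x \<in> topspace ?T. (x n, x (Suc n)) \<in> S})"
    by (intro closedin_INT) auto
  from closed_Int_compactin[OF this comp]
  have "compactin ?T ((\<Inter>n. {x \<in> topspace ?T. (x n, x (Suc n)) \<in> S}) \<inter> PiE UNIV (\<lambda>_. B))" .
  also have "(\<Inter>n. {x \<in> topspace ?T. (x n, x (Suc n)) \<in> S}) \<inter> PiE UNIV (\<lambda>_. B)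
      = {x \<in> markov_shift A R. \<forall>n. x n \<in> B}"
    using assms by (auto simp: S_def markov_shift_def PiE_def Pi_def)
  finally show ?thesis
    unfolding shift_topology_def compactin_subtopology by auto
qed

lemma finite_projection_if_compactin:
  assumes "compactin (shift_topology A R) K"
  shows "finite ((\<lambda>x. x n) ` K)" "(\<lambda>x. x n) ` K \<subseteq> A"
proof -
  have "continuous_map (shift_topology A R) (discrete_topology A) (\<lambda>x. x n)"
    unfolding shift_topology_def
    by (intro continuous_map_from_subtopology continuous_map_product_projection) auto
  from image_compactin[OF assms this]
  show "finite ((\<lambda>x. x n) ` K)" "(\<lambda>x. x n) ` K \<subseteq> A"
    by (auto simp: compactin_discrete_topology)
qed

section \<open>Counting and concatenating admissible words\<close>

context transition_system
begin

lemma finite_set_J: "finite {w. set w \<subseteq> J \<and> length w \<le> n}"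
  by (rule finite_lists_length_le[OF finite_J])

lemma card_words: "card (words r (Suc n)) = card J * \<kappa> ^ n"
proof (induction n)
  case 0
  have "words r (Suc 0) = (\<lambda>s. [s]) ` J"
    by (auto simp: words_def length_Suc_conv)
  then show ?case
    by (simp add: card_image inj_on_def)
next
  case (Suc n)
  have "bij_betw (\<lambda>(w, s). s # w) (SIGMA w:words r (Suc n). {s \<in> J. r s (hd w)}) (words r (Suc (Suc n)))"
    unfolding bij_betw_def
  proof
    show "inj_on (\<lambda>(w, s). s # w) (SIGMA w:words r (Suc n). {s \<in> J. r s (hd w)})"
      by (auto simp: inj_on_def)
    show "(\<lambda>(w, s). s # w) ` (SIGMA w:words r (Suc n). {s \<in> J. r s (hd w)}) = words r (Suc (Suc n))"
    proof (intro equalityI subsetI)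
      fix w assume w: "w \<in> words r (Suc (Suc n))"
      then obtain s v where "w = s # v"
        by (cases w) (auto simp: words_def)
      then show "w \<in> (\<lambda>(w, s). s # w) ` (SIGMA w:words r (Suc n). {s \<in> J. r s (hd w)})"
        using w by (intro image_eqI[of _ _ "(v, s)"]) (auto simp: words_def successively_Cons)
    qed (auto simp: words_def successively_Cons)
  qed
  then have "card (words r (Suc (Suc n))) = card (SIGMA w:words r (Suc n). {s \<in> J. r s (hd w)})"
    by (simp add: bij_betw_same_card)
  also have "\<dots> = (\<Sum>w\<in>words r (Suc n). card {s \<in> J. r s (hd w)})"
    using finite_J by (intro card_SigmaI) auto
  also have "\<dots> = (\<Sum>w\<in>words r (Suc n). \<kappa>)"
  proof (intro sum.cong refl card_predecessors)
    fix w assume "w \<in> words r (Suc n)"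
    then have "w \<noteq> []" "set w \<subseteq> J"
      by (auto simp: words_def)
    then show "hd w \<in> J"
      by (meson hd_in_set subsetD)
  qed
  finally show ?case
    by (simp add: Suc)
qed

lemma loops_decay_if_eventually:
  assumes y: "1 \<le> y" "y < real \<kappa>" and ev: "eventually (\<lambda>n. real (cnt r n \<one>) \<le> y ^ n) sequentially"
  shows loops_decay
proof -
  obtain N where N: "\<And>n. N \<le> n \<Longrightarrow> real (cnt r n \<one>) \<le> y ^ n"
    using ev by (auto simp: eventually_sequentially)
  define C where "C = 1 + (\<Sum>n<N. real (cnt r n \<one>))"
  have "real (cnt r n \<one>) \<le> C * y ^ n" for n
  proof (cases "N \<le> n")
    case True
    have "1 * y ^ n \<le> C * y ^ n"
      using y by (intro mult_right_mono) (auto simp: C_def sum_nonneg)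
    then show ?thesis
      using N[OF True] by simp
  next
    case False
    then have "real (cnt r n \<one>) \<le> (\<Sum>n<N. real (cnt r n \<one>))"
      by (intro member_le_sum) auto
    then have "real (cnt r n \<one>) * 1 \<le> C * y ^ n"
      using y by (intro mult_mono) (auto simp: C_def sum_nonneg)
    then show ?thesis
      by simp
  qed
  then show ?thesis
    using y unfolding loops_decay_def by blast
qed

text \<open>Each block is a word followed by the connector to the next one, and the last connector
  leads to \<open>z\<close>. Taking for \<open>z\<close> the first letter of the result makes it
  repeatable.\<close>

fun join :: "'i list list \<Rightarrow> 'i \<Rightarrow> 'i list" where
  "join [] z = []"
| "join (w # ws) z = w @ connector (last w) (hd (join ws z @ [z])) @ join ws z"

lemma join_words:
  assumes "set ws \<subseteq> {w \<in> words r m. ev w = \<one>}" "0 < m" "z \<in> J"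
  shows "length (join ws z) = length ws * (m + gap)" "set (join ws z) \<subseteq> J"
    "ev (join ws z) = \<one>" "successively r (join ws z @ [z])"
proof -
  have "length (join ws z) = length ws * (m + gap) \<and> set (join ws z) \<subseteq> J \<and>
    ev (join ws z) = \<one> \<and> successively r (join ws z @ [z])"
    using assms(1)
  proof (induction ws)
    case (Cons w ws)
    have w: "w \<noteq> []" "set w \<subseteq> J" "length w = m" "successively r w" "ev w = \<one>"
      using Cons.prems assms(2) by (auto simp: words_def)
    have IH: "length (join ws z) = length ws * (m + gap)" "set (join ws z) \<subseteq> J"
      "ev (join ws z) = \<one>" "successively r (join ws z @ [z])"
      using Cons by auto
    have "set (join ws z @ [z]) \<subseteq> J"
      using IH(2) assms(3) by auto
    then have hd: "hd (join ws z @ [z]) \<in> J" and last: "last w \<in> J"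
      using w by (meson hd_in_set last_in_set subsetD snoc_eq_iff_butlast)+
    show ?case
      using connector[OF last hd] w IH assms(3) successively_connector[of w "join ws z @ [z]"]
      by simp
  qed (use assms in auto)
  then show "length (join ws z) = length ws * (m + gap)" "set (join ws z) \<subseteq> J"
    "ev (join ws z) = \<one>" "successively r (join ws z @ [z])"
    by auto
qed

lemma join_inj:
  assumes "length vs = length ws" "set vs \<subseteq> {w \<in> words r m. ev w = \<one>}" "set ws \<subseteq> {w \<in> words r m. ev w = \<one>}"
    "0 < m" "z \<in> J" "join vs z = join ws z"
  shows "vs = ws"
  using assms
proof (induction vs ws rule: list_induct2)
  case (Cons v vs w ws)
  have len: "length v = m" "length w = m"
    using Cons.prems by (auto simp: words_def)
  have rest: "join us z = drop (m + gap) (join (u # us) z)"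
    if u: "set (u # us) \<subseteq> {w \<in> words r m. ev w = \<one>}" for u us
  proof -
    have "length (join (u # us) z) = Suc (length us) * (m + gap)" "length (join us z) = length us * (m + gap)"
      using join_words(1)[of "u # us" m z] join_words(1)[of us m z] u Cons.prems by auto
    then have "length (u @ connector (last u) (hd (join us z @ [z]))) = m + gap"
      by simp
    then show ?thesis
      by (metis append.assoc append_eq_conv_conj join.simps(2))
  qed
  have "length v = length w"
    using len by simp
  then have "v = w"
    using Cons.prems by simp
  moreover have "join vs z = join ws z"
  proof -
    have "join vs z = drop (m + gap) (join (v # vs) z)"
      by (rule rest[OF Cons.prems(1)])
    also have "\<dots> = drop (m + gap) (join (w # ws) z)"
      by (simp only: Cons.prems(5))
    also have "\<dots> = join ws z"
      by (rule rest[OF Cons.prems(2), symmetric])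
    finally show ?thesis .
  qed
  ultimately show ?case
    using Cons by simp
qed simp

text \<open>The value returns to \<open>\<one>\<close> after every complete block, so a prefix has
  the value of a part of one block. The bound \<open>m + gap\<close> is independent of the number of
  blocks, which keeps long concatenations in a fixed ball.\<close>

lemma ev_take_join:
  assumes "set ws \<subseteq> {w \<in> words r m. ev w = \<one>}" "0 < m" "z \<in> J"
  shows "\<exists>u. set u \<subseteq> J \<and> length u \<le> m + gap \<and> ev (take i (join ws z)) = ev u"
  using assms(1)
proof (induction ws arbitrary: i)
  case Nil
  then show ?case
    by (auto intro!: exI[of _ "[]"])
next
  case (Cons w ws)
  define b where "b = w @ connector (last w) (hd (join ws z @ [z]))"
  have "join (w # ws) z = b @ join ws z"
    by (simp add: b_def)
  moreover have J: "set (join (w # ws) z) \<subseteq> J" "set (join ws z) \<subseteq> J"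
    using join_words(2)[OF Cons.prems assms(2,3)] join_words(2)[of ws m z] Cons.prems assms by auto
  moreover have "ev (join (w # ws) z) = \<one>" "ev (join ws z) = \<one>"
    "length (join (w # ws) z) = Suc (length ws) * (m + gap)" "length (join ws z) = length ws * (m + gap)"
    using join_words(1,3)[OF Cons.prems assms(2,3)] join_words(1,3)[of ws m z] Cons.prems assms by auto
  ultimately have b: "join (w # ws) z = b @ join ws z" "set b \<subseteq> J" "length b = m + gap" "ev b = \<one>"
    by auto
  show ?case
  proof (cases "i \<le> length b")
    case True
    then show ?thesis
      using b J by (intro exI[of _ "take i b"]) (auto dest: in_set_takeD simp del: join.simps)
  next
    case False
    then have "ev (take i (join (w # ws) z)) = ev (take (i - length b) (join ws z))"
      using b J set_take_subset[of "i - length b" "join ws z"] by (simp del: join.simps)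
    then show ?thesis
      using Cons.IH[of "i - length b"] Cons.prems by (simp del: join.simps)
  qed
qed

end

text \<open>\<open>e\<close> embeds the abstract letters into the alphabet and \<open>\<phi>\<close>
  reads off their images in \<open>G\<close>; \<open>R\<close> is described on the alphabet only.
  With \<open>r\<close> as the restriction on consecutive generators, one locale covers both shift
  spaces.\<close>

locale skew_shift = transition_system G J bar p r \<kappa> gap
  for G (structure) and J :: "'i set" and bar and p :: "'i \<Rightarrow> 'a" and r and \<kappa> gap +
  fixes e :: "'i \<Rightarrow> 'e" and \<phi> :: "'e \<Rightarrow> 'a" and R :: "'e \<times> 'a \<Rightarrow> 'e \<times> 'a \<Rightarrow> bool"
  assumes inj_e: "inj_on e J"
    and \<phi>_e: "s \<in> J \<Longrightarrow> \<phi> (e s) = p s"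
    and R_iff: "x \<in> J \<Longrightarrow> y \<in> J \<Longrightarrow> h \<in> carrier G \<Longrightarrow> h' \<in> carrier G \<Longrightarrow>
      R (e x, h) (e y, h') \<longleftrightarrow> r x y \<and> h \<otimes> p x = h'"
    and \<kappa>_gt_1: "1 < \<kappa>"
begin

definition A :: "('e \<times> 'a) set" where
  "A = e ` J \<times> carrier G"

definition C where
  "C = {w \<in> admissible_words A R. snd (hd w) = \<one>}"

definition loops where
  "loops = {w \<in> C. snd (last w) \<otimes> \<phi> (fst (last w)) = \<one>}"

fun lift :: "'a \<Rightarrow> 'i list \<Rightarrow> ('e \<times> 'a) list" where
  "lift h [] = []"
| "lift h (s # w) = (e s, h) # lift (h \<otimes> p s) w"

lemma length_lift [simp]: "length (lift h w) = length w"
  by (induction w arbitrary: h) auto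

lemma lift_eq_Nil_iff [simp]: "lift h w = [] \<longleftrightarrow> w = []"
  by (metis length_0_conv length_lift)

lemma hd_lift: "w \<noteq> [] \<Longrightarrow> hd (lift h w) = (e (hd w), h)"
  by (cases w) auto

lemma lift_nth:
  assumes "h \<in> carrier G" "set w \<subseteq> J" "i < length w"
  shows "lift h w ! i = (e (w ! i), h \<otimes> ev (take i w))"
  using assms
proof (induction w arbitrary: h i)
  case (Cons s w)
  show ?case
  proof (cases i)
    case (Suc j)
    have "set (take j w) \<subseteq> J"
      using Cons.prems by (auto dest: in_set_takeD)
    then show ?thesis
      using Cons Suc by (simp add: m_assoc)
  qed (use Cons in simp)
qed simp

lemma lift_append:
  "h \<in> carrier G \<Longrightarrow> set v \<subseteq> J \<Longrightarrow> lift h (v @ w) = lift h v @ lift (h \<otimes> ev v) w"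
  by (induction v arbitrary: h) (auto simp: m_assoc)

lemma last_lift:
  assumes "h \<in> carrier G" "set w \<subseteq> J" "w \<noteq> []"
  shows "snd (last (lift h w)) \<otimes> \<phi> (fst (last (lift h w))) = h \<otimes> ev w"
proof -
  have J: "last w \<in> J" "set (butlast w) \<subseteq> J"
    using assms by (auto dest: in_set_butlastD)
  have "lift h (butlast w @ [last w]) = lift h (butlast w) @ lift (h \<otimes> ev (butlast w)) [last w]"
    by (rule lift_append[OF assms(1) J(2)])
  moreover have "ev w = ev (butlast w) \<otimes> p (last w)"
    using ev_append[of "butlast w" "[last w]"] assms J by simp
  ultimately show ?thesis
    using assms J by (simp add: \<phi>_e m_assoc)
qed

lemma lift_inj:
  "set v \<subseteq> J \<Longrightarrow> set w \<subseteq> J \<Longrightarrow> lift h v = lift h w \<Longrightarrow> v = w"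
proof (induction v arbitrary: w h)
  case (Cons s v)
  then obtain t u where "w = t # u"
    by (cases w) auto
  then show ?case
    using Cons inj_onD[OF inj_e, of s t] by auto
qed (metis lift.simps(1) lift_eq_Nil_iff)

lemma lift_admissible:
  assumes "h \<in> carrier G" "set w \<subseteq> J" "w \<noteq> []" "successively r w"
  shows "lift h w \<in> admissible_words A R"
  using assms
proof (induction w arbitrary: h)
  case (Cons s w)
  show ?case
  proof (cases "w = []")
    case False
    have "lift (h \<otimes> p s) w \<in> admissible_words A R"
      using Cons False by (auto simp: successively_Cons)
    moreover have "R (e s, h) (hd (lift (h \<otimes> p s) w))"
    proof -
      have "hd w \<in> J"
        using Cons.prems False by auto
      then show ?thesis
        using Cons.prems False by (auto simp: hd_lift R_iff successively_Cons)
    qed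
    ultimately show ?thesis
      using Cons.prems False by (auto simp: admissible_words_def successively_Cons A_def)
  qed (use Cons in \<open>auto simp: admissible_words_def A_def\<close>)
qed simp

lemma admissible_liftE:
  assumes "v \<in> admissible_words A R"
  shows "\<exists>w. w \<noteq> [] \<and> set w \<subseteq> J \<and> successively r w \<and> v = lift (snd (hd v)) w"
  using assms
proof (induction v)
  case (Cons a v)
  then obtain s h where a: "a = (e s, h)" "s \<in> J" "h \<in> carrier G"
    by (auto simp: admissible_words_def A_def)
  show ?case
  proof (cases "v = []")
    case True
    then show ?thesis
      using a by (intro exI[of _ "[s]"]) auto
  next
    case False
    have v: "v \<in> admissible_words A R" "R a (hd v)"
      using Cons.prems False by (auto simp: admissible_words_def successively_Cons)
    obtain w where w: "w \<noteq> []" "set w \<subseteq> J" "successively r w" "v = lift (snd (hd v)) w"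
      using Cons.IH[OF v(1)] by blast
    have "hd v \<in> A"
      using v(1) False by (auto simp: admissible_words_def)
    moreover have hd: "hd v = (e (hd w), snd (hd v))" "hd w \<in> J"
      using w hd_lift[OF w(1), of "snd (hd v)"] by auto
    ultimately have "snd (hd v) \<in> carrier G"
      by (auto simp: A_def)
    then have "r s (hd w)" "h \<otimes> p s = snd (hd v)"
      using v(2) hd a R_iff[of s "hd w" h "snd (hd v)"] by auto
    then show ?thesis
      using a w by (intro exI[of _ "s # w"]) (auto simp: successively_Cons)
  qed
qed (simp add: admissible_words_def)

lemma C_level: "1 \<le> n \<Longrightarrow> {v \<in> C. length v = n} = lift \<one> ` words r n"
proof (intro equalityI subsetI)
  fix v assume "v \<in> {v \<in> C. length v = n}"
  then show "v \<in> lift \<one> ` words r n"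
    using admissible_liftE[of v] by (force simp: C_def words_def)
next
  fix v assume n: "1 \<le> n" and "v \<in> lift \<one> ` words r n"
  then obtain w where w: "v = lift \<one> w" "w \<in> words r n"
    by blast
  then have "w \<noteq> []" "set w \<subseteq> J" "successively r w" "length w = n"
    using n by (auto simp: words_def)
  then show "v \<in> {v \<in> C. length v = n}"
    using w by (auto simp: C_def lift_admissible hd_lift)
qed

lemma inj_on_lift: "inj_on (lift \<one>) (words r n)"
  using lift_inj by (auto simp: inj_on_def words_def)

lemma C_level_0: "{v \<in> C. length v = 0} = {}"
  by (auto simp: C_def admissible_words_def)

lemma finite_C_level: "finite {v \<in> C. length v = n}"
  using C_level[of n] C_level_0 by (cases "n = 0") auto

lemma card_C_level: "card {v \<in> C. length v = Suc n} = card J * \<kappa> ^ n"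
  by (simp only: C_level[of "Suc n", simplified] card_image[OF inj_on_lift] card_words)

lemma loops_subset_C: "loops \<subseteq> C"
  by (auto simp: loops_def)

lemma card_loops_level: "1 \<le> n \<Longrightarrow> card {v \<in> loops. length v = n} = cnt r n \<one>"
proof -
  assume n: "1 \<le> n"
  have "{v \<in> loops. length v = n} = {v \<in> {v \<in> C. length v = n}. snd (last v) \<otimes> \<phi> (fst (last v)) = \<one>}"
    by (auto simp: loops_def)
  also have "\<dots> = lift \<one> ` {w \<in> words r n. ev w = \<one>}"
    using n last_lift[OF one_closed] by (auto simp: C_level[OF n] words_def) force+
  finally have "card {v \<in> loops. length v = n} = card (lift \<one> ` {w \<in> words r n. ev w = \<one>})"
    by simp
  also have "\<dots> = cnt r n \<one>"
    unfolding cnt_def by (intro card_image inj_on_subset[OF inj_on_lift]) auto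
  finally show ?thesis .
qed

lemma card_loops_level_le: "card {v \<in> loops. length v = n} \<le> cnt r n \<one>"
proof (cases "n = 0")
  case True
  then have "{v \<in> loops. length v = n} = {}"
    using C_level_0 loops_subset_C by auto
  then show ?thesis
    by (metis card.empty zero_le)
qed (simp add: card_loops_level)

lemma pressure_C:
  assumes \<eta>: "0 < \<eta>"
  shows "pressure \<eta> C = ereal (ln \<kappa>)"
proof (rule antisym)
  show "pressure \<eta> C \<le> ereal (ln \<kappa>)"
  proof (rule pressure_le_if_exponential[OF _ finite_C_level])
    show "1 \<le> real \<kappa>"
      using \<kappa>_gt_1 by simp
    fix n
    show "real (card {w \<in> C. length w = n}) \<le> real (card J) * real \<kappa> ^ n"
    proof (cases n)
      case 0
      then show ?thesis
        unfolding 0 C_level_0 by simp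
    next
      case (Suc m)
      then have "card J * \<kappa> ^ m \<le> card J * \<kappa> ^ n"
        using \<kappa>_gt_1 by simp
      then show ?thesis
        unfolding Suc card_C_level of_nat_mult[symmetric] of_nat_power[symmetric] of_nat_le_iff .
    qed
  qed
  show "ereal (ln \<kappa>) \<le> pressure \<eta> C"
  proof (rule ln_le_pressure_if_frequently[OF _ \<eta>])
    show "0 < real \<kappa>"
      using \<kappa>_gt_1 by simp
    fix N
    have "\<kappa> \<le> card J"
    proof -
      obtain s where "s \<in> J"
        using two_le_card_J by fastforce
      from card_predecessors[OF this] show ?thesis
        using card_mono[OF finite_J, of "{x \<in> J. r x s}"] by auto
    qed
    then have "\<kappa> ^ Suc N \<le> card {w \<in> C. length w = Suc N}"
      unfolding card_C_level by simp
    then show "\<exists>n\<ge>N. real \<kappa> ^ n \<le> real (card {w \<in> C. length w = n})"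
      by (intro exI[of _ "Suc N"]) (simp only: of_nat_power[symmetric] of_nat_le_iff le_SucI)
  qed
qed

lemma real_between:
  assumes "P < ereal (ln \<kappa>)"
  obtains y where "1 \<le> y" "y < real \<kappa>" "P < ereal (ln y)"
proof -
  have "max P 0 < ereal (ln \<kappa>)"
    using assms \<kappa>_gt_1 by simp
  then obtain x where x: "max P 0 < ereal x" "ereal x < ereal (ln \<kappa>)"
    using ereal_dense2 by blast
  have "exp x < real \<kappa>"
    using x(2) \<kappa>_gt_1 by (metis exp_less_cancel_iff exp_ln less_ereal.simps(1) of_nat_0_less_iff less_trans zero_less_one)
  moreover have "0 < x"
    using x(1) by simp
  ultimately show ?thesis
    using that[of "exp x"] x by auto
qed

lemma pressure_eq_iff:
  assumes \<eta>: "0 < \<eta>"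
  shows "pressure \<eta> C = pressure \<eta> loops \<longleftrightarrow> \<not> loops_decay"
proof
  assume eq: "pressure \<eta> C = pressure \<eta> loops"
  show "\<not> loops_decay"
  proof
    assume loops_decay
    then obtain y B where y: "1 \<le> y" "y < real \<kappa>" and B: "\<And>n. real (cnt r n \<one>) \<le> B * y ^ n"
      unfolding loops_decay_def by blast
    have "pressure \<eta> loops \<le> ereal (ln y)"
    proof (rule pressure_le_if_exponential[OF y(1)])
      fix n
      show "finite {w \<in> loops. length w = n}"
        by (rule finite_subset[OF _ finite_C_level[of n]]) (auto simp: loops_def)
      show "real (card {w \<in> loops. length w = n}) \<le> B * y ^ n"
        using card_loops_level_le[of n] B[of n] by linarith
    qed
    also have "\<dots> < ereal (ln \<kappa>)"
      using y by simp
    finally show False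
      using eq pressure_C[OF \<eta>] by simp
  qed
next
  assume no_decay: "\<not> loops_decay"
  have "\<not> pressure \<eta> loops < ereal (ln \<kappa>)"
  proof
    assume "pressure \<eta> loops < ereal (ln \<kappa>)"
    then obtain y where y: "1 \<le> y" "y < real \<kappa>" "pressure \<eta> loops < ereal (ln y)"
      by (rule real_between)
    have "eventually (\<lambda>n. real (card {w \<in> loops. length w = n}) \<le> y ^ n) sequentially"
      using y \<eta> by (intro exponential_if_pressure_less) auto
    then have "eventually (\<lambda>n. real (cnt r n \<one>) \<le> y ^ n) sequentially"
      using eventually_ge_at_top[of 1] by eventually_elim (simp add: card_loops_level)
    then show False
      using loops_decay_if_eventually y no_decay by blast
  qed
  then show "pressure \<eta> C = pressure \<eta> loops"
    using pressure_mono[OF loops_subset_C, of \<eta>] pressure_C[OF \<eta>] by (simp add: antisym)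
qed

end

section \<open>Exhausting principle, finite irreducibility and compactness\<close>

context skew_shift
begin

definition ball :: "nat \<Rightarrow> 'a set" where
  "ball n = ev ` {w. set w \<subseteq> J \<and> length w \<le> n}"

lemma ball_subset: "ball n \<subseteq> carrier G"
  by (auto simp: ball_def)

text \<open>The candidates for the sets \<open>K n\<close>: invariance under the shift is built in,
  and for finite \<open>B\<close> only finitely many letters occur.\<close>

definition confined :: "'a set \<Rightarrow> (nat \<Rightarrow> 'e \<times> 'a) set" where
  "confined B = {x \<in> markov_shift A R. \<forall>n. snd (x n) \<in> B}"

lemma compactin_confined:
  assumes "finite B" "B \<subseteq> carrier G"
  shows "compactin (shift_topology A R) (confined B)"
proof -
  have "confined B = {x \<in> markov_shift A R. \<forall>n. x n \<in> e ` J \<times> B}"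
    by (auto simp: confined_def markov_shift_def A_def mem_Times_iff)
  moreover have "compactin (shift_topology A R) {x \<in> markov_shift A R. \<forall>n. x n \<in> e ` J \<times> B}"
    using assms finite_J by (intro compactin_markov_shift) (auto simp: A_def)
  ultimately show ?thesis
    by simp
qed

lemma left_shift_confined: "left_shift ` confined B \<subseteq> confined B"
  by (auto simp: confined_def left_shift_def markov_shift_def)

text \<open>The sequence that repeats \<open>v\<close> forever is admissible at the seams by
  \<open>successively r (v @ [hd v])\<close>, and \<open>ev v = \<one>\<close> makes its group
  coordinates periodic too, so they remain values of prefixes of \<open>v\<close>.\<close>

lemma periodic_extension:
  assumes v: "v \<noteq> []" "set v \<subseteq> J" "successively r (v @ [hd v])" "ev v = \<one>"
    and B: "\<And>i. ev (take i v) \<in> B"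
  shows "lift \<one> v \<in> words_of A R (confined B)"
proof -
  define l where "l = length v"
  define x where "x i = (e (v ! (i mod l)), ev (take (i mod l) v))" for i
  have l: "0 < l"
    using v by (simp add: l_def)
  have v_nth: "v ! i \<in> J" if "i < l" for i
    using that v by (auto simp: l_def)
  have ev_take: "ev (take i v) \<in> carrier G" for i
    using v set_take_subset[of i v] by (intro ev_closed) auto
  have r_nth: "r ((v @ [hd v]) ! i) ((v @ [hd v]) ! Suc i)" if "i < l" for i
    using v(3) that by (simp add: successively_conv_nth l_def)
  have ev_Suc: "ev (take i v) \<otimes> p (v ! i) = ev (take (Suc i) v)" if "i < l" for i
  proof -
    have "take (Suc i) v = take i v @ [v ! i]"
      using that by (simp add: take_Suc_conv_app_nth l_def)
    then show ?thesis
      using v_nth[OF that] v set_take_subset[of i v] by simp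
  qed
  have "x i \<in> A" for i
    using v_nth[of "i mod l"] l ev_take by (auto simp: x_def A_def)
  moreover have "R (x i) (x (Suc i))" for i
  proof -
    define j where "j = i mod l"
    have j: "j < l"
      using l by (simp add: j_def)
    show ?thesis
    proof (cases "Suc j = l")
      case True
      then have "Suc i mod l = 0"
        by (simp add: mod_Suc j_def)
      moreover have "r (v ! j) (v ! 0)"
        using r_nth[OF j] True v by (auto simp: nth_append l_def hd_conv_nth)
      moreover have "ev (take j v) \<otimes> p (v ! j) = \<one>"
        using ev_Suc[OF j] True v by (simp add: l_def)
      ultimately show ?thesis
        using v_nth[OF j] v_nth[OF l] ev_take[of j] by (simp add: x_def R_iff flip: j_def)
    next
      case False
      then have "Suc i mod l = Suc j" "Suc j < l"
        using j by (auto simp: mod_Suc j_def)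
      moreover from this have "r (v ! j) (v ! Suc j)"
        using r_nth[OF j] by (simp add: nth_append l_def)
      ultimately show ?thesis
        using v_nth[OF j] v_nth[of "Suc j"] ev_take ev_Suc[OF j]
        by (simp add: x_def R_iff flip: j_def)
    qed
  qed
  ultimately have x: "x \<in> markov_shift A R"
    by (simp add: markov_shift_def)
  then have "x \<in> confined B"
    using B by (simp add: confined_def x_def)
  moreover have "x \<in> cylinder A R (lift \<one> v)"
    using x lift_nth[OF one_closed v(2)] ev_take by (simp add: cylinder_def x_def l_def)
  moreover have "lift \<one> v \<in> admissible_words A R"
    using v by (intro lift_admissible) (auto simp: successively_append_iff)
  ultimately show ?thesis
    by (auto simp: words_of_def)
qed

text \<open>One length \<open>m\<close> with many loops is enough: concatenating \<open>k\<close> of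
  them gives at least \<open>y ^ (k * (m + gap))\<close> words of length
  \<open>k * (m + gap)\<close>, all of them periodic and confined to one ball.\<close>

lemma pressure_confined_ge:
  assumes no_decay: "\<not> loops_decay" and y: "1 \<le> y" "y < real \<kappa>" and \<eta>: "0 < \<eta>"
  shows "\<exists>n0. \<forall>n\<ge>n0. ereal (ln y) \<le> pressure \<eta> (C \<inter> words_of A R (confined (ball n)))"
proof -
  \<comment> \<open>The failure of decay is used with the constant \<open>y ^ gap\<close>, which
    pays in advance for the connectors.\<close>
  obtain m where m: "y ^ gap * y ^ m < real (cnt r m \<one>)"
    using no_decay y unfolding loops_decay_def by (meson not_le)
  have m_pos: "0 < m"
  proof (rule ccontr)
    assume "\<not> 0 < m"
    then have "y ^ gap < 1"
      using m by (simp add: cnt_0)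
    then show False
      using one_le_power[OF y(1), of gap] by simp
  qed
  define L where "L = {w \<in> words r m. ev w = \<one>}"
  define l where "l = m + gap"
  have card_L: "y ^ l \<le> real (card L)"
    using m by (simp add: L_def cnt_def l_def power_add mult.commute)
  have "ereal (ln y) \<le> pressure \<eta> (C \<inter> words_of A R (confined (ball n)))" if n: "l \<le> n" for n
  proof (rule ln_le_pressure_if_frequently[OF _ \<eta>])
    show "0 < y"
      using y by simp
    fix N :: nat
    define k where "k = Suc N"
    define W where "W = {ws. set ws \<subseteq> L \<and> length ws = k}"
    \<comment> \<open>The closing letter is the first letter of the first loop. It can be read off
      the result, so \<open>join_inj\<close> applies although it varies with
      \<open>ws\<close>.\<close>
    define \<psi> where "\<psi> ws = join ws (hd (hd ws))" for ws
    have ws: "set ws \<subseteq> {w \<in> words r m. ev w = \<one>}" "hd (hd ws) \<in> J" "hd ws \<noteq> []" "ws \<noteq> []" "length ws = k"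
      if "ws \<in> W" for ws
    proof -
      show ws: "set ws \<subseteq> {w \<in> words r m. ev w = \<one>}" "ws \<noteq> []" "length ws = k"
        using that by (auto simp: W_def L_def k_def)
      have "hd ws \<in> words r m"
        using hd_in_set[OF ws(2)] ws(1) by blast
      then have hd: "length (hd ws) = m" "set (hd ws) \<subseteq> J"
        by (auto simp: words_def)
      then show "hd ws \<noteq> []"
        using m_pos by auto
      then show "hd (hd ws) \<in> J"
        using hd(2) hd_in_set by blast
    qed
    have \<psi>: "length (\<psi> ws) = k * l" "set (\<psi> ws) \<subseteq> J" "\<psi> ws \<noteq> []" "successively r (\<psi> ws @ [hd (\<psi> ws)])"
      "ev (\<psi> ws) = \<one>" "hd (\<psi> ws) = hd (hd ws)" if "ws \<in> W" for ws
    proof -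
      show hd: "hd (\<psi> ws) = hd (hd ws)"
        using ws(3,4)[OF that] by (cases ws) (auto simp: \<psi>_def)
      show "\<psi> ws \<noteq> []"
        using ws(3,4)[OF that] by (cases ws) (auto simp: \<psi>_def)
      show "length (\<psi> ws) = k * l" "set (\<psi> ws) \<subseteq> J" "successively r (\<psi> ws @ [hd (\<psi> ws)])" "ev (\<psi> ws) = \<one>"
        unfolding hd using join_words[OF ws(1)[OF that] m_pos ws(2)[OF that]] ws(5)[OF that]
        by (auto simp: \<psi>_def l_def)
    qed
    have inj: "inj_on (\<lambda>ws. lift \<one> (\<psi> ws)) W"
    proof (rule inj_onI)
      fix vs ws assume vs: "vs \<in> W" and ws': "ws \<in> W" and eq: "lift \<one> (\<psi> vs) = lift \<one> (\<psi> ws)"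
      have eq': "\<psi> vs = \<psi> ws"
        using lift_inj[OF _ _ eq] \<psi>(2) vs ws' by blast
      then have "hd (hd vs) = hd (hd ws)"
        using \<psi>(6) vs ws' by metis
      then have "join vs (hd (hd ws)) = join ws (hd (hd ws))"
        using eq' by (simp add: \<psi>_def)
      then show "vs = ws"
        using join_inj[of vs ws m "hd (hd ws)"] ws vs ws' m_pos by auto
    qed
    have "lift \<one> (\<psi> v) \<in> C \<inter> words_of A R (confined (ball n))" if v: "v \<in> W" for v
    proof
      show "lift \<one> (\<psi> v) \<in> words_of A R (confined (ball n))"
      proof (rule periodic_extension)
        fix i
        show "ev (take i (\<psi> v)) \<in> ball n"
          using ev_take_join[OF ws(1)[OF v] m_pos ws(2)[OF v], of i] n
          by (force simp: \<psi>_def ball_def l_def)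
      qed (use \<psi> v in auto)
      then show "lift \<one> (\<psi> v) \<in> C"
        using \<psi>(3)[OF v] by (simp add: words_of_def C_def hd_lift)
    qed
    then have sub: "(\<lambda>ws. lift \<one> (\<psi> ws)) ` W
        \<subseteq> {w \<in> C \<inter> words_of A R (confined (ball n)). length w = k * l}"
      using \<psi>(1) by auto
    have "y ^ (k * l) = (y ^ l) ^ k"
      by (simp add: mult.commute flip: power_mult)
    also have "\<dots> \<le> real (card L) ^ k"
      using card_L y by (intro power_mono) auto
    also have "\<dots> = real (card W)"
      by (simp add: W_def card_lists_length_eq L_def)
    also have "card W = card ((\<lambda>ws. lift \<one> (\<psi> ws)) ` W)"
      by (rule card_image[OF inj, symmetric])
    also have "\<dots> \<le> card {w \<in> C \<inter> words_of A R (confined (ball n)). length w = k * l}"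
      by (rule card_mono[OF finite_subset[OF _ finite_C_level[of "k * l"]] sub]) auto
    finally have "y ^ (k * l) \<le> real (card {w \<in> C \<inter> words_of A R (confined (ball n)). length w = k * l})"
      by simp
    moreover have "N \<le> k * l"
      using mult_le_mono[of N k 1 l] m_pos unfolding k_def l_def by linarith
    ultimately show "\<exists>n'\<ge>N. y ^ n' \<le> real (card {w \<in> C \<inter> words_of A R (confined (ball n)). length w = n'})"
      by blast
  qed
  then show ?thesis
    by blast
qed

lemma exhausting_if_no_decay:
  assumes "\<not> loops_decay" and \<eta>: "0 < \<eta>"
  shows "exhausting_principle \<eta> A R C"
  unfolding exhausting_principle_def
proof (intro exI[of _ "\<lambda>n. confined (ball n)"] conjI allI left_shift_confined)
  fix n
  show "compactin (shift_topology A R) (confined (ball n))"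
    using finite_set_J by (intro compactin_confined ball_subset) (simp add: ball_def)
next
  show "(\<lambda>n. pressure \<eta> (C \<inter> words_of A R (confined (ball n)))) \<longlonglongrightarrow> pressure \<eta> C"
  proof (rule order_tendstoI)
    fix a assume "a < pressure \<eta> C"
    then obtain y where y: "1 \<le> y" "y < real \<kappa>" "a < ereal (ln y)"
      unfolding pressure_C[OF \<eta>] by (rule real_between)
    then obtain n0 where "\<forall>n\<ge>n0. ereal (ln y) \<le> pressure \<eta> (C \<inter> words_of A R (confined (ball n)))"
      using pressure_confined_ge[OF assms(1) y(1,2) \<eta>] by blast
    then show "\<forall>\<^sub>F n in sequentially. a < pressure \<eta> (C \<inter> words_of A R (confined (ball n)))"
      using y(3) unfolding eventually_sequentially by (meson less_le_trans)
  next
    fix a assume "pressure \<eta> C < a"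
    then show "\<forall>\<^sub>F n in sequentially. pressure \<eta> (C \<inter> words_of A R (confined (ball n))) < a"
      using pressure_mono[of "C \<inter> words_of A R (confined (ball n))" C \<eta> for n]
      by (intro always_eventually allI) (meson inf_le1 le_less_trans)
  qed
qed

text \<open>By invariance all coordinates of points in a compact \<open>K n\<close> lie in the
  finite set of zeroth coordinates, so the words of \<open>K n\<close> end in finitely many group
  elements. Their number is bounded with the same rate \<open>y\<close> as that of the loops; only
  the constant depends on \<open>n\<close>, so the pressures stay at most
  \<open>ln y < ln \<kappa>\<close>.\<close>

lemma no_decay_if_exhausting:
  assumes "exhausting_principle \<eta> A R C" and \<eta>: "0 < \<eta>"
  shows "\<not> loops_decay"
proof
  assume loops_decay
  then obtain y D where y: "1 \<le> y" "y < real \<kappa>" and D: "\<And>n. real (cnt r n \<one>) \<le> D * y ^ n"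
    unfolding loops_decay_def by blast
  obtain K where K: "\<And>n. compactin (shift_topology A R) (K n)" "\<And>n. left_shift ` K n \<subseteq> K n"
    and lim: "(\<lambda>n. pressure \<eta> (C \<inter> words_of A R (K n))) \<longlonglongrightarrow> pressure \<eta> C"
    using assms(1) unfolding exhausting_principle_def by blast
  have "pressure \<eta> (C \<inter> words_of A R (K n)) \<le> ereal (ln y)" for n
  proof -
    \<comment> \<open>The group elements reached after reading a letter at position 0; shifting
      brings the last letter of any word there.\<close>
    define B where "B = (\<lambda>a. snd a \<otimes> \<phi> (fst a)) ` (\<lambda>x. x 0) ` K n"
    have B: "finite B" "B \<subseteq> carrier G"
      using finite_projection_if_compactin[OF K(1)[of n], of 0] by (auto simp: B_def A_def \<phi>_e)
    have shift: "(\<lambda>j. x (i + j)) \<in> K n" if "x \<in> K n" for x i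
    proof (induction i)
      case (Suc i)
      have "left_shift (\<lambda>j. x (i + j)) \<in> K n"
        using K(2)[of n] Suc by blast
      then show ?case
        by (simp add: left_shift_def)
    qed (simp add: that)
    have sub: "{v \<in> C \<inter> words_of A R (K n). length v = m} \<subseteq> lift \<one> ` (\<Union>g\<in>B. {w \<in> words r m. ev w = g})"
      if m: "1 \<le> m" for m
    proof
      fix v assume v: "v \<in> {v \<in> C \<inter> words_of A R (K n). length v = m}"
      then have "v \<in> lift \<one> ` words r m"
        using C_level[OF m] by auto
      then obtain w where w: "v = lift \<one> w" "w \<in> words r m"
        by blast
      obtain x where x: "x \<in> cylinder A R v" "x \<in> K n"
        using v by (auto simp: words_of_def)
      have "last v = x (m - 1)"
        using v x(1) m by (cases "v = []") (auto simp: cylinder_def last_conv_nth)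
      then have "snd (last v) \<otimes> \<phi> (fst (last v)) \<in> B"
        using imageI[OF shift[OF x(2), of "m - 1"], of "\<lambda>x. x 0"]
        unfolding B_def by (intro image_eqI[of _ _ "last v"]) simp_all
      moreover have "snd (last v) \<otimes> \<phi> (fst (last v)) = ev w"
        using w m last_lift[OF one_closed, of w] by (cases "w = []") (auto simp: words_def)
      ultimately show "v \<in> lift \<one> ` (\<Union>g\<in>B. {w \<in> words r m. ev w = g})"
        using w by auto
    qed
    have "\<forall>g\<in>B. \<exists>E. \<forall>m. real (cnt r m g) \<le> E * y ^ m"
      using cnt_le_exponential[OF y(1) D] B(2) by blast
    then obtain E where E: "\<And>g m. g \<in> B \<Longrightarrow> real (cnt r m g) \<le> E g * y ^ m"
      by metis
    define F where "F = (\<Sum>g\<in>B. E g)"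
    have F: "0 \<le> F"
      unfolding F_def
    proof (rule sum_nonneg)
      fix g assume "g \<in> B"
      from E[OF this, of 0] show "0 \<le> E g"
        by simp
    qed
    show ?thesis
    proof (rule pressure_le_if_exponential[OF y(1)])
      fix m
      show "finite {w \<in> C \<inter> words_of A R (K n). length w = m}"
        by (rule finite_subset[OF _ finite_C_level[of m]]) auto
      show "real (card {w \<in> C \<inter> words_of A R (K n). length w = m}) \<le> F * y ^ m"
      proof (cases "m = 0")
        case True
        then have "{w \<in> C \<inter> words_of A R (K n). length w = m} = {}"
          using C_level_0 by auto
        then show ?thesis
          using F y by (metis card.empty mult_nonneg_nonneg of_nat_0 zero_le_power order_trans zero_le_one)
      next
        case False
        have "card {w \<in> C \<inter> words_of A R (K n). length w = m}
            \<le> card (lift \<one> ` (\<Union>g\<in>B. {w \<in> words r m. ev w = g}))"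
          using False B(1) by (intro card_mono sub) auto
        also have "\<dots> \<le> card (\<Union>g\<in>B. {w \<in> words r m. ev w = g})"
          using B(1) by (intro card_image_le) auto
        also have "\<dots> \<le> (\<Sum>g\<in>B. cnt r m g)"
          unfolding cnt_def by (rule card_UN_le[OF B(1)])
        finally have "real (card {w \<in> C \<inter> words_of A R (K n). length w = m}) \<le> (\<Sum>g\<in>B. real (cnt r m g))"
          unfolding of_nat_sum[symmetric] of_nat_le_iff .
        also have "\<dots> \<le> (\<Sum>g\<in>B. E g * y ^ m)"
          by (intro sum_mono E)
        finally show ?thesis
          by (simp add: F_def sum_distrib_right)
      qed
    qed
  qed
  then have "pressure \<eta> C \<le> ereal (ln y)"
    by (intro LIMSEQ_le_const2[OF lim]) auto
  then show False
    using y by (simp add: pressure_C[OF \<eta>])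
qed

lemma exhausting_iff: "0 < \<eta> \<Longrightarrow> exhausting_principle \<eta> A R C \<longleftrightarrow> \<not> loops_decay"
  using exhausting_if_no_decay no_decay_if_exhausting by blast

section \<open>Finite irreducibility and compactness\<close>

lemma finitely_irreducible_if_finite:
  assumes fin: "finite (carrier G)"
  shows "finitely_irreducible A R C"
proof -
  have "\<forall>g\<in>carrier G. \<exists>u. u \<noteq> [] \<and> set u \<subseteq> J \<and> successively r u \<and> ev u = inv g"
    using reach by simp
  from bchoice[OF this]
  obtain U where U: "\<And>g. g \<in> carrier G \<Longrightarrow> U g \<noteq> [] \<and> set (U g) \<subseteq> J \<and> successively r (U g) \<and> ev (U g) = inv g"
    by blast
  \<comment> \<open>\<open>C1\<close> ends at \<open>g\<close> and \<open>C2\<close> starts at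
    \<open>\<one>\<close>, so the middle word must have value \<open>inv g\<close>. Besides
    \<open>g\<close> it depends only on the two adjacent letters, which leaves finitely many
    words.\<close>
  define D where "D = (\<lambda>(g, x, y). connector x (hd (U g)) @ U g @ connector (last (U g)) y)"
  define \<Lambda> where "\<Lambda> = (\<lambda>t. lift (fst t) (D t)) ` (carrier G \<times> J \<times> J) \<inter> admissible_words A R"
  show ?thesis
    unfolding finitely_irreducible_def
  proof (intro exI[of _ \<Lambda>] conjI ballI)
    show "finite \<Lambda>" "\<Lambda> \<subseteq> admissible_words A R"
      using fin finite_J by (auto simp: \<Lambda>_def)
    fix C1 C2 assume C1: "C1 \<in> C" and C2: "C2 \<in> C"
    obtain v where v: "v \<noteq> []" "set v \<subseteq> J" "successively r v" "C1 = lift \<one> v"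
      using C1 admissible_liftE[of C1] by (auto simp: C_def)
    obtain w where w: "w \<noteq> []" "set w \<subseteq> J" "successively r w" "C2 = lift \<one> w"
      using C2 admissible_liftE[of C2] by (auto simp: C_def)
    define g where "g = ev v"
    have g: "g \<in> carrier G"
      using v by (simp add: g_def)
    note u = U[OF g]
    have J: "last v \<in> J" "hd w \<in> J" "hd (U g) \<in> J" "last (U g) \<in> J"
      using v w u by (meson hd_in_set last_in_set subsetD)+
    note c = connector[OF J(1,3)] connector[OF J(4,2)]
    define d where "d = D (g, last v, hd w)"
    have d: "set d \<subseteq> J" "d \<noteq> []" "ev d = inv g"
      using c u g by (auto simp: d_def D_def)
    have "successively r (U g @ connector (last (U g)) (hd w) @ w)"
      using u w by (intro successively_connector) auto
    then have "successively r (v @ connector (last v) (hd (U g @ connector (last (U g)) (hd w) @ w))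
        @ (U g @ connector (last (U g)) (hd w) @ w))"
      using u v w c by (intro successively_connector) auto
    then have succ: "successively r (v @ d @ w)"
      using u by (simp add: d_def D_def)
    have "lift \<one> (v @ d @ w) = C1 @ lift g d @ C2"
      using v w d g by (simp add: lift_append g_def)
    moreover have "lift \<one> (v @ d @ w) \<in> C"
      using v w d succ by (auto simp: C_def hd_lift intro!: lift_admissible)
    moreover have "lift g d \<in> \<Lambda>"
    proof -
      have "successively r d"
        using succ by (simp add: successively_append_iff)
      then have "lift g d \<in> admissible_words A R"
        using d g by (intro lift_admissible)
      then show ?thesis
        using g J by (auto simp: \<Lambda>_def d_def intro!: image_eqI[of _ _ "(g, last v, hd w)"])
    qed
    ultimately show "\<exists>D\<in>\<Lambda> \<union> {[]}. C1 @ D @ C2 \<in> C"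
      by auto
  qed
qed

text \<open>In \<open>C1 @ D @ C2\<close> the letter after \<open>C1\<close> carries the endpoint of
  \<open>C1\<close> as its group coordinate. A word \<open>C1\<close> with endpoint \<open>g\<close>
  thus forces \<open>D\<close> to start at \<open>g\<close>, or \<open>g = \<one>\<close> if
  \<open>D\<close> is empty.\<close>

lemma finite_if_finitely_irreducible:
  assumes "finitely_irreducible A R C"
  shows "finite (carrier G)"
proof -
  obtain \<Lambda> where \<Lambda>: "finite \<Lambda>" "\<Lambda> \<subseteq> admissible_words A R"
    "\<And>C1 C2. C1 \<in> C \<Longrightarrow> C2 \<in> C \<Longrightarrow> \<exists>D\<in>\<Lambda> \<union> {[]}. C1 @ D @ C2 \<in> C"
    using assms unfolding finitely_irreducible_def by blast
  have "carrier G \<subseteq> insert \<one> ((\<lambda>D. snd (hd D)) ` \<Lambda>)"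
  proof
    fix g assume g: "g \<in> carrier G"
    obtain u where u: "u \<noteq> []" "set u \<subseteq> J" "successively r u" "ev u = g"
      using reach[OF g] by blast
    have C1: "lift \<one> u \<in> C"
      using u by (auto simp: C_def hd_lift intro!: lift_admissible)
    then obtain D where D: "D \<in> \<Lambda> \<union> {[]}" "lift \<one> u @ D @ lift \<one> u \<in> C"
      using \<Lambda>(3) by blast
    have hd: "hd (D @ lift \<one> u) \<in> A"
      using D(2) u(1) hd_in_set[of "D @ lift \<one> u"] by (auto simp: C_def admissible_words_def)
    have last: "last (lift \<one> u) \<in> A"
      using C1 u(1) last_in_set[of "lift \<one> u"] by (auto simp: C_def admissible_words_def)
    have "R (last (lift \<one> u)) (hd (D @ lift \<one> u))"
      using D(2) u(1) by (auto simp: C_def admissible_words_def successively_append_iff hd_append)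
    then have "snd (last (lift \<one> u)) \<otimes> \<phi> (fst (last (lift \<one> u))) = snd (hd (D @ lift \<one> u))"
      using hd last by (auto simp: A_def R_iff \<phi>_e)
    then have "g = snd (hd (D @ lift \<one> u))"
      using last_lift[OF one_closed u(2,1)] u(2,4) g by simp
    then show "g \<in> insert \<one> ((\<lambda>D. snd (hd D)) ` \<Lambda>)"
      using D(1) u(1) by (cases "D = []") (auto simp: hd_lift)
  qed
  then show ?thesis
    using \<Lambda>(1) finite_subset by blast
qed

lemma compact_if_finite:
  assumes "finite (carrier G)"
  shows "compact_space (shift_topology A R)"
proof -
  have "topspace (shift_topology A R) = confined (carrier G)"
    by (auto simp: shift_topology_def confined_def markov_shift_def A_def mem_Times_iff)
  then show ?thesis
    using compactin_confined[OF assms order_refl] by (simp add: compact_space_def)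
qed

text \<open>A sequence that repeats one letter is admissible by \<open>r_refl\<close> and may start
  at any group element, while in a compact space the zeroth coordinate takes finitely many
  values.\<close>

lemma finite_if_compact:
  assumes "compact_space (shift_topology A R)"
  shows "finite (carrier G)"
proof -
  have top: "topspace (shift_topology A R) = markov_shift A R"
    by (auto simp: shift_topology_def markov_shift_def)
  obtain s where s: "s \<in> J"
    using two_le_card_J by fastforce
  have "carrier G \<subseteq> snd ` (\<lambda>x. x 0) ` markov_shift A R"
  proof
    fix g assume g: "g \<in> carrier G"
    define x where "x n = (e s, g \<otimes> p s [^] n)" for n :: nat
    have "x \<in> markov_shift A R"
      using s g r_refl[OF s] by (auto simp: markov_shift_def x_def A_def R_iff m_assoc)
    moreover have "snd (x 0) = g"
      using g by (simp add: x_def)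
    ultimately show "g \<in> snd ` (\<lambda>x. x 0) ` markov_shift A R"
      by (metis image_eqI)
  qed
  moreover have "finite ((\<lambda>x. x 0) ` markov_shift A R)"
    using assms finite_projection_if_compactin(1)[of A R "markov_shift A R" 0]
    by (simp add: compact_space_def top)
  ultimately show ?thesis
    using finite_subset by blast
qed

theorem skew_shift_equivalences:
  assumes "amenable G \<longleftrightarrow> \<not> loops_decay" "0 < \<eta>"
  shows "(amenable G \<longleftrightarrow> exhausting_principle \<eta> A R C) \<and>
    (exhausting_principle \<eta> A R C \<longleftrightarrow> pressure \<eta> C = pressure \<eta> loops) \<and>
    (finite (carrier G) \<longleftrightarrow> finitely_irreducible A R C) \<and>
    (finitely_irreducible A R C \<longleftrightarrow> compact_space (shift_topology A R))"
  using assms exhausting_iff pressure_eq_iff finitely_irreducible_if_finite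
    finite_if_finitely_irreducible compact_if_finite finite_if_compact by blast

end

section \<open>Quotients of free groups\<close>

abbreviation letters :: "nat \<Rightarrow> nat letter set" where
  "letters k \<equiv> {1..k} \<times> UNIV"

abbreviation letter_image :: "nat \<Rightarrow> nat letter list set \<Rightarrow> nat letter \<Rightarrow> nat letter list set" where
  "letter_image k N x \<equiv> factor_map k N [x]"

lemma mult_free_group_singleton: "[x] \<otimes>\<^bsub>free_group S\<^esub> w = cancel_cons x w"
  by (simp add: free_group_def)

lemma one_free_group: "\<one>\<^bsub>free_group S\<^esub> = []"
  by (simp add: free_group_def)

lemma carrier_free_group: "carrier (free_group S) = reduced_words S"
  by (simp add: free_group_def)

lemma singleton_mem_free_group: "[x] \<in> carrier (free_group S) \<longleftrightarrow> fst x \<in> S"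
  by (simp add: carrier_free_group reduced_words_def)

lemma inv_free_group_singleton:
  assumes "fst x \<in> S"
  shows "inv\<^bsub>free_group S\<^esub> [x] = [letter_inv x]"
proof -
  interpret group "free_group S"
    by (rule group_free_group)
  show ?thesis
    using assms by (intro inv_equality) (simp_all add: mult_free_group_singleton one_free_group singleton_mem_free_group)
qed

lemma sym_gens_eq: "sym_gens k = (\<lambda>x. [x]) ` letters k"
proof -
  have "(\<lambda>i. inv\<^bsub>free_group_of_rank k\<^esub> (free_gen i)) ` {1..k} = (\<lambda>i. [(i, False)]) ` {1..k}"
    by (intro image_cong refl) (simp add: free_gen_def inv_free_group_singleton letter_inv_def)
  then show ?thesis
    unfolding sym_gens_def free_gen_def[abs_def] by (auto simp: image_iff)
qed

locale free_quotient =
  fixes k :: nat and N :: "nat letter list set"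
  assumes k: "1 \<le> k" and normal: "N \<lhd> free_group_of_rank k"
begin

declare One_nat_def [simp del]

abbreviation Q where
  "Q \<equiv> free_group_of_rank k Mod N"

lemma factor_map_hom: "factor_map k N \<in> hom (free_group_of_rank k) Q"
  using normal.r_coset_hom_Mod[OF normal] by (simp add: factor_map_def[abs_def])

lemma group_hom_factor_map: "group_hom (free_group_of_rank k) Q (factor_map k N)"
  using factor_map_hom normal.factorgroup_is_group[OF normal] group_free_group
  by (auto intro!: group_hom.intro group_hom_axioms.intro)

lemma marked_group: "marked_group Q (letters k) letter_inv (letter_image k N)"
proof -
  interpret h: group_hom "free_group_of_rank k" Q "factor_map k N"
    by (rule group_hom_factor_map)
  show ?thesis
  proof (unfold_locales)
    fix x assume x: "x \<in> letters k"
    then have "fst x \<in> {1..k}"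
      by auto
    then show "letter_image k N x \<in> carrier Q"
      by (intro h.hom_closed) (simp add: singleton_mem_free_group)
    show "letter_inv x \<in> letters k"
      using x by (auto simp: letter_inv_def)
    show "letter_image k N (letter_inv x) = inv\<^bsub>Q\<^esub> letter_image k N x"
      using \<open>fst x \<in> {1..k}\<close> h.hom_inv[of "[x]"]
      by (simp add: inv_free_group_singleton singleton_mem_free_group)
  qed (use k in auto)
qed

sublocale marked_group Q "letters k" letter_inv "letter_image k N"
  by (rule marked_group)

text \<open>Prepending a letter to a word that stays reduced involves no cancellation, so the
  product of the letter images in \<open>Q\<close> is the image of the word itself.\<close>

lemma ev_reduced: "w \<in> carrier (free_group_of_rank k) \<Longrightarrow> ev w = factor_map k N w"
proof (induction w)
  case Nil
  interpret h: group_hom "free_group_of_rank k" Q "factor_map k N"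
    by (rule group_hom_factor_map)
  show ?case
    using h.hom_one by (simp add: one_free_group)
next
  case (Cons x w)
  interpret h: group_hom "free_group_of_rank k" Q "factor_map k N"
    by (rule group_hom_factor_map)
  have w: "w \<in> carrier (free_group_of_rank k)" and x: "[x] \<in> carrier (free_group_of_rank k)"
    using Cons.prems by (auto simp: carrier_free_group reduced_words_def successively_Cons)
  have "[x] \<otimes>\<^bsub>free_group_of_rank k\<^esub> w = x # w"
    using Cons.prems by (cases w) (auto simp: mult_free_group_singleton carrier_free_group reduced_words_def)
  then have "factor_map k N (x # w) = letter_image k N x \<otimes>\<^bsub>Q\<^esub> factor_map k N w"
    using h.hom_mult[OF x w] by simp
  then show ?case
    using Cons.IH[OF w] by simp
qed

lemma set_subset_letters: "w \<in> carrier (free_group_of_rank k) \<Longrightarrow> set w \<subseteq> letters k"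
  by (auto simp: carrier_free_group reduced_words_def)

sublocale generated_group Q "letters k" letter_inv "letter_image k N"
proof unfold_locales
  fix g assume "g \<in> carrier Q"
  then obtain w where "w \<in> carrier (free_group_of_rank k)" "g = factor_map k N w"
    by (auto simp: FactGroup_def RCOSETS_def factor_map_def)
  then show "\<exists>w. set w \<subseteq> letters k \<and> ev w = g"
    using ev_reduced set_subset_letters by blast
qed

text \<open>A non-identity element of \<open>N\<close> is a non-empty reduced word with trivial
  image, that is, the required relation; \<open>2 \<le> k\<close> gives four letters.\<close>

lemma reduced_walk_group:
  assumes "2 \<le> k" "N \<noteq> {\<one>\<^bsub>free_group_of_rank k\<^esub>}"
  shows "reduced_walk_group Q (letters k) letter_inv (letter_image k N)"
proof unfold_locales
  have sub: "subgroup N (free_group_of_rank k)"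
    using normal by (rule normal_imp_subgroup)
  then have "[] \<in> N"
    using subgroup.one_closed[OF sub] by (simp add: one_free_group)
  then obtain w where w: "w \<in> N" "w \<noteq> []"
    using assms(2) by (auto simp: one_free_group)
  have carrier: "w \<in> carrier (free_group_of_rank k)"
    using subgroup.mem_carrier[OF sub w(1)] .
  have "N #>\<^bsub>free_group_of_rank k\<^esub> w = N"
    using subgroup.rcos_const[OF sub group_free_group w(1)] .
  then have "ev w = \<one>\<^bsub>Q\<^esub>"
    using ev_reduced[OF carrier] by (simp add: factor_map_def FactGroup_def)
  then show "\<exists>w. w \<noteq> [] \<and> set w \<subseteq> letters k \<and> successively (\<lambda>s t. t \<noteq> letter_inv s) w \<and> ev w = \<one>\<^bsub>Q\<^esub>"
    using w carrier set_subset_letters[OF carrier] by (auto simp: carrier_free_group reduced_words_def)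
qed (use assms(1) in auto)

lemma skew_shift_equivalences_ext:
  assumes "skew_shift Q (letters k) letter_inv (letter_image k N) r \<kappa> gap (\<lambda>x. [x]) (factor_map k N) R"
    and "amenable Q \<longleftrightarrow> \<not> transition_system.loops_decay Q (letters k) (letter_image k N) r \<kappa>"
    and "0 < \<eta>"
  shows "(amenable Q \<longleftrightarrow> exhausting_principle \<eta> (ext_alphabet k N) R (words_from_one k N R)) \<and>
    (exhausting_principle \<eta> (ext_alphabet k N) R (words_from_one k N R) \<longleftrightarrow>
      pressure \<eta> (words_from_one k N R) = pressure \<eta> (loops_at_one k N R)) \<and>
    (finite (carrier Q) \<longleftrightarrow> finitely_irreducible (ext_alphabet k N) R (words_from_one k N R)) \<and>
    (finitely_irreducible (ext_alphabet k N) R (words_from_one k N R) \<longleftrightarrow>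
      compact_space (shift_topology (ext_alphabet k N) R))"
proof -
  interpret S: skew_shift Q "letters k" letter_inv "letter_image k N" r \<kappa> gap "\<lambda>x. [x]" "factor_map k N" R
    by (rule assms(1))
  have A: "ext_alphabet k N = S.A"
    by (simp add: ext_alphabet_def S.A_def sym_gens_eq)
  have C: "words_from_one k N R = S.C"
    by (simp add: words_from_one_def S.C_def A)
  have loops: "loops_at_one k N R = S.loops"
    by (simp add: loops_at_one_def S.loops_def C)
  show ?thesis
    unfolding A C loops by (rule S.skew_shift_equivalences[OF assms(2,3)])
qed

end

theorem theorem3p17:
  fixes k :: nat and N :: "nat letter list set" and \<eta> :: real
    and R :: "ext_letter \<Rightarrow> ext_letter \<Rightarrow> bool"
  assumes "k \<ge> 1"
    and "N \<lhd> free_group_of_rank k"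
    and "R = ext_step k N \<or>
         R = ext_step_reduced k N \<and> k \<ge> 2 \<and> N \<noteq> {\<one>\<^bsub>free_group_of_rank k\<^esub>}"
    and "\<eta> > 0"
  shows "(amenable (free_group_of_rank k Mod N) \<longleftrightarrow>
            exhausting_principle \<eta> (ext_alphabet k N) R (words_from_one k N R)) \<and>
         (exhausting_principle \<eta> (ext_alphabet k N) R (words_from_one k N R) \<longleftrightarrow>
            pressure \<eta> (words_from_one k N R) = pressure \<eta> (loops_at_one k N R)) \<and>
         (finite (carrier (free_group_of_rank k Mod N)) \<longleftrightarrow>
            finitely_irreducible (ext_alphabet k N) R (words_from_one k N R)) \<and>
         (finitely_irreducible (ext_alphabet k N) R (words_from_one k N R) \<longleftrightarrow>
            compact_space (shift_topology (ext_alphabet k N) R))"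
proof -
  interpret free_quotient k N
    using assms(1,2) by (rule free_quotient.intro)
  have step: "ext_step k N ([x], h) ([y], h') \<longleftrightarrow> h \<otimes>\<^bsub>Q\<^esub> letter_image k N x = h'" for x y h h'
    by (simp add: ext_step_def)
  have step_reduced: "ext_step_reduced k N ([x], h) ([y], h') \<longleftrightarrow>
      y \<noteq> letter_inv x \<and> h \<otimes>\<^bsub>Q\<^esub> letter_image k N x = h'" for x y h h'
    by (simp add: ext_step_reduced_def step mult_free_group_singleton one_free_group)
  from assms(3) show ?thesis
  proof
    assume R: "R = ext_step k N"
    show ?thesis
    proof (rule skew_shift_equivalences_ext[OF _ amenable_iff_free assms(4)])
      \<comment> \<open>Here \<open>\<kappa> = 2 * k\<close> exceeds 1 already for
        \<open>k = 1\<close>.\<close>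
      show "skew_shift Q (letters k) letter_inv (letter_image k N) (\<lambda>_ _. True)
          (card (letters k)) 0 (\<lambda>x. [x]) (factor_map k N) R"
        using two_le_card_J
        by (intro skew_shift.intro transition_system_free skew_shift_axioms.intro)
          (auto simp: R step inj_on_def)
    qed
  next
    assume R: "R = ext_step_reduced k N \<and> k \<ge> 2 \<and> N \<noteq> {\<one>\<^bsub>free_group_of_rank k\<^esub>}"
    then interpret W: reduced_walk_group Q "letters k" letter_inv "letter_image k N"
      by (intro reduced_walk_group) auto
    obtain gap where T: "transition_system Q (letters k) letter_inv (letter_image k N)
        (\<lambda>s t. t \<noteq> letter_inv s) (card (letters k) - 1) gap"
      using W.transition_system_reduced by blast
    show ?thesis
    proof (rule skew_shift_equivalences_ext[OF _ W.amenable_iff_reduced[OF T] assms(4)])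
      \<comment> \<open>Here \<open>\<kappa> = 2 * k - 1\<close> exceeds 1 because
        \<open>k \<ge> 2\<close>.\<close>
      show "skew_shift Q (letters k) letter_inv (letter_image k N) (\<lambda>s t. t \<noteq> letter_inv s)
          (card (letters k) - 1) gap (\<lambda>x. [x]) (factor_map k N) R"
        using W.four_le_card_J R
        by (intro skew_shift.intro T skew_shift_axioms.intro) (auto simp: step_reduced inj_on_def)
    qed
  qed
qed

end
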